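(* Let $\Bbbk$ be a field. Take a finite-dimensional $\Bbbk$-linear bialgebra $H$, a vector space $V$ over $\Bbbk$, and linear maps $\mu:V\otimes V\to V$, $\nu:\Bbbk\to V$, $\lambda:H\otimes V\to V$, $\delta:V\to V\otimes H$, a priori satisfying no compatibility relations. Consider the maps $$\sigma_{H,H}=\mu_H\otimes\nu_H,\quad \sigma_{H^*,H^*}:l_1\otimes l_2\mapsto\varepsilon_H\otimes l_1l_2,\quad \sigma_{H,H^*}:h\otimes l\mapsto l_{(1)}(h_{(2)})\,l_{(2)}\otimes h_{(1)},$$ $$\sigma_{V,V}=\nu\otimes\mu,\quad \sigma_{H,V}:h\otimes v\mapsto\lambda(h_{(2)}\otimes v)\otimes h_{(1)},\quad \sigma_{V,H^*}:v\otimes l\mapsto l_{(1)}(v_{(1)})\,l_{(2)}\otimes v_{(0)},$$ where $\delta(v)=v_{(0)}\otimes v_{(1)}$. One has the following equivalences, where "cYBE for $A\otimes B\otimes C$" is the colored Yang-Baxter equation for these maps, $(A,B,C)$ being a triple of components of the ordered family $(H,V,H^* )$: 1. cYBE for $H\otimes V\otimes H^*$ $\iff$ the Yetter-Drinfel'd compatibility condition for $(V,\lambda,\delta)$. 2. cYBE for $H\otimes H\otimes V$ $\iff$ $\lambda$ defines a left $H$-module structure on $V$. Here one supposes $\lambda\circ(\nu_H\otimes\mathrm{Id}_V)=\mathrm{Id}_V$. 3. cYBE for $V\otimes H^*\otimes H^*$ $\iff$ $\delta$ defines a right $H$-comodule structure on $V$. Here one supposes $(\mathrm{Id}_V\otimes\varepsilon_H)\circ\delta=\mathrm{Id}_V$.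 4. cYBE for $H\otimes V\otimes V$ $\iff$ $\lambda$ respects the multiplication $\mu$, i.e. $\lambda(h\otimes\mu(v\otimes w))=\mu(\lambda(h_{(2)}\otimes v)\otimes\lambda(h_{(1)}\otimes w))$ for all $h\in H$, $v,w\in V$. Here one supposes that $\lambda$ respects $\nu$, i.e. $\lambda\circ(\mathrm{Id}_H\otimes\nu)=\varepsilon_H\otimes\nu$. 5. cYBE for $V\otimes V\otimes H^*$ $\iff$ $\delta$ respects the multiplication $\mu$, i.e. $\delta(\mu(v\otimes w))=\mu(v_{(0)}\otimes w_{(0)})\otimes v_{(1)}w_{(1)}$ for all $v,w\in V$. Here one supposes that $\delta$ respects $\nu$, i.e. $\delta\circ\nu=\nu\otimes\nu_H$. 6. If $\nu$ is a (two-sided) unit for $\mu$: cYBE for $V\otimes V\otimes V$ $\iff$ associativity of $\mu$.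
   Context: Notation: $\mu_H,\nu_H,\Delta_H,\varepsilon_H$ are the multiplication, unit, comultiplication and counit of $H$; $\Delta_H(h)=h_{(1)}\otimes h_{(2)}$ (Sweedler's notation without summation sign); $H^*$ is the linear dual of $H$. Structures on $H^*$ are dual to those of $H$ with the "rainbow" convention: $(l_1l_2)(h)=l_1(h_{(2)})\,l_2(h_{(1)})$, the unit of $H^*$ is $\varepsilon_H$, and the comultiplication $l\mapsto l_{(1)}\otimes l_{(2)}$ is determined by $l(hh')=l_{(1)}(h')\,l_{(2)}(h)$. The colored Yang-Baxter equation (cYBE) for $A\otimes B\otimes C$ is the equality of maps $A\otimes B\otimes C\to C\otimes B\otimes A$: $$(\sigma_{B,C}\otimes\mathrm{Id}_A)(\mathrm{Id}_B\otimes\sigma_{A,C})(\sigma_{A,B}\otimes\mathrm{Id}_C)=(\mathrm{Id}_C\otimes\sigma_{A,B})(\sigma_{A,C}\otimes\mathrm{Id}_B)(\mathrm{Id}_A\otimes\sigma_{B,C}).$$ The Yetter-Drinfel'd compatibility condition for $(V,\lambda,\delta)$, writing $hv=\lambda(h\otimes v)$, is: $(h_{(2)}v)_{(0)}\otimes(h_{(2)}v)_{(1)}h_{(1)}=h_{(1)}v_{(0)}\otimes h_{(2)}v_{(1)}$ for all $h\in H$, $v\in V$.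
   Formalization: In items 4 and 5 it is additionally assumed that ν is nonzero unless V = 0; if ν = 0 then σ_{V,V} = 0 and the cYBE holds trivially, while λ (resp. δ) need not respect μ, so the claim as stated fails. *)

theory Defs
  imports "Jordan_Normal_Form.Missing_VectorSpace" "HOL-Algebra.AbelCoset"
begin

text \<open>Vector spaces are those of the locale \<^locale>\<open>vectorspace\<close> (a module record over a field
  record \<open>K\<close>); linear maps are elements of \<^const>\<open>module_hom\<close>. As usual in HOL-Algebra, maps
  matter only on carriers. The ring fields \<open>mult\<close> and \<open>one\<close> of module records are never used.\<close>

section \<open>Tensor products\<close>

definition ground :: "('k, 'r) ring_scheme \<Rightarrow> ('k, 'k) module" where
  "ground K = \<lparr>carrier = carrier K, mult = mult K, one = one K,
     zero = zero K, add = add K, smult = mult K\<rparr>"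

definition free_space :: "('k, 'r) ring_scheme \<Rightarrow> 's set \<Rightarrow> ('k, 's \<Rightarrow> 'k) module" where
  "free_space K S =
     (ring.func_space K S)\<lparr>carrier := {f \<in> S \<rightarrow>\<^sub>E carrier K. finite {s \<in> S. f s \<noteq> \<zero>\<^bsub>K\<^esub>}}\<rparr>"

definition free_gen :: "('k, 'r) ring_scheme \<Rightarrow> 's set \<Rightarrow> 's \<Rightarrow> 's \<Rightarrow> 'k" where
  "free_gen K S s = (\<lambda>t\<in>S. if t = s then \<one>\<^bsub>K\<^esub> else \<zero>\<^bsub>K\<^esub>)"

definition quot_space :: "('k, 'a, 'm) module_scheme \<Rightarrow> 'a set \<Rightarrow> ('k, 'a set) module" where
  "quot_space M N = \<lparr>carrier = a_rcosets\<^bsub>M\<^esub> N, mult = (\<lambda>X Y. N), one = N, zero = N,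
     add = set_add M, smult = (\<lambda>c X. \<Union>x\<in>X. N +>\<^bsub>M\<^esub> (c \<odot>\<^bsub>M\<^esub> x))\<rparr>"

definition tensor_relators ::
  "('k, 'r) ring_scheme \<Rightarrow> ('k, 'a, 'm) module_scheme \<Rightarrow> ('k, 'b, 'n) module_scheme \<Rightarrow> ('a \<times> 'b \<Rightarrow> 'k) set"
  where
  "tensor_relators K M N =
    (let S = carrier M \<times> carrier N; F = free_space K S; g = (\<lambda>a b. free_gen K S (a, b)) in
      {g (a \<oplus>\<^bsub>M\<^esub> a') b \<ominus>\<^bsub>F\<^esub> (g a b \<oplus>\<^bsub>F\<^esub> g a' b) | a a' b.
          a \<in> carrier M \<and> a' \<in> carrier M \<and> b \<in> carrier N} \<union>
      {g a (b \<oplus>\<^bsub>N\<^esub> b') \<ominus>\<^bsub>F\<^esub> (g a b \<oplus>\<^bsub>F\<^esub> g a b') | a b b'.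
          a \<in> carrier M \<and> b \<in> carrier N \<and> b' \<in> carrier N} \<union>
      {g (c \<odot>\<^bsub>M\<^esub> a) b \<ominus>\<^bsub>F\<^esub> (c \<odot>\<^bsub>F\<^esub> g a b) | c a b.
          c \<in> carrier K \<and> a \<in> carrier M \<and> b \<in> carrier N} \<union>
      {g a (c \<odot>\<^bsub>N\<^esub> b) \<ominus>\<^bsub>F\<^esub> (c \<odot>\<^bsub>F\<^esub> g a b) | c a b.
          c \<in> carrier K \<and> a \<in> carrier M \<and> b \<in> carrier N})"

definition tensor_null ::
  "('k, 'r) ring_scheme \<Rightarrow> ('k, 'a, 'm) module_scheme \<Rightarrow> ('k, 'b, 'n) module_scheme \<Rightarrow> ('a \<times> 'b \<Rightarrow> 'k) set"
  where
  "tensor_null K M N =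
     module.span K (free_space K (carrier M \<times> carrier N)) (tensor_relators K M N)"

type_synonym ('k, 'a, 'b) tensor = "('a \<times> 'b \<Rightarrow> 'k) set"

definition tensor ::
  "('k, 'r) ring_scheme \<Rightarrow> ('k, 'a, 'm) module_scheme \<Rightarrow> ('k, 'b, 'n) module_scheme \<Rightarrow>
   ('k, ('k, 'a, 'b) tensor) module"
  where
  "tensor K M N = quot_space (free_space K (carrier M \<times> carrier N)) (tensor_null K M N)"

definition tens ::
  "('k, 'r) ring_scheme \<Rightarrow> ('k, 'a, 'm) module_scheme \<Rightarrow> ('k, 'b, 'n) module_scheme \<Rightarrow>
   'a \<Rightarrow> 'b \<Rightarrow> ('k, 'a, 'b) tensor"
  where
  "tens K M N a b = tensor_null K M N +>\<^bsub>free_space K (carrier M \<times> carrier N)\<^esub>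
     free_gen K (carrier M \<times> carrier N) (a, b)"

text \<open>The linear map \<open>M \<otimes> N \<rightarrow> W\<close> given by \<open>a \<otimes> b \<mapsto> f a b\<close>, for \<open>f\<close> bilinear.\<close>

definition tensor_lift ::
  "('k, 'r) ring_scheme \<Rightarrow> ('k, 'a, 'm) module_scheme \<Rightarrow> ('k, 'b, 'n) module_scheme \<Rightarrow>
   ('k, 'w, 'p) module_scheme \<Rightarrow> ('a \<Rightarrow> 'b \<Rightarrow> 'w) \<Rightarrow> ('k, 'a, 'b) tensor \<Rightarrow> 'w"
  where
  "tensor_lift K M N W f =
     (THE g. g \<in> module_hom K (tensor K M N) W \<and> g \<in> extensional (carrier (tensor K M N)) \<and>
        (\<forall>a\<in>carrier M. \<forall>b\<in>carrier N. g (tens K M N a b) = f a b))"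

text \<open>Sweedler's notation: for \<open>t = t\<^sub>(\<^sub>1\<^sub>) \<otimes> t\<^sub>(\<^sub>2\<^sub>)\<close> in \<open>M \<otimes> N\<close> (implicit sum), an expression
  \<open>f t\<^sub>(\<^sub>1\<^sub>) t\<^sub>(\<^sub>2\<^sub>)\<close> in \<open>W\<close>, bilinear in the two components, is \<open>sweedler K M N W t f\<close>.\<close>

abbreviation sweedler ::
  "('k, 'r) ring_scheme \<Rightarrow> ('k, 'a, 'm) module_scheme \<Rightarrow> ('k, 'b, 'n) module_scheme \<Rightarrow>
   ('k, 'w, 'p) module_scheme \<Rightarrow> ('k, 'a, 'b) tensor \<Rightarrow> ('a \<Rightarrow> 'b \<Rightarrow> 'w) \<Rightarrow> 'w"
  where
  "sweedler K M N W t f \<equiv> tensor_lift K M N W f t"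

definition tensor_map ::
  "('k, 'r) ring_scheme \<Rightarrow> ('k, 'a, 'm) module_scheme \<Rightarrow> ('k, 'b, 'n) module_scheme \<Rightarrow>
   ('k, 'c, 'p) module_scheme \<Rightarrow> ('k, 'd, 'q) module_scheme \<Rightarrow> ('a \<Rightarrow> 'c) \<Rightarrow> ('b \<Rightarrow> 'd) \<Rightarrow>
   ('k, 'a, 'b) tensor \<Rightarrow> ('k, 'c, 'd) tensor"
  where
  "tensor_map K M N M' N' f g =
     tensor_lift K M N (tensor K M' N') (\<lambda>a b. tens K M' N' (f a) (g b))"

definition assoc_r ::
  "('k, 'r) ring_scheme \<Rightarrow> ('k, 'a, 'm) module_scheme \<Rightarrow> ('k, 'b, 'n) module_scheme \<Rightarrow>
   ('k, 'c, 'p) module_scheme \<Rightarrow>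
   ('k, ('k, 'a, 'b) tensor, 'c) tensor \<Rightarrow> ('k, 'a, ('k, 'b, 'c) tensor) tensor"
  where
  "assoc_r K A B C =
     tensor_lift K (tensor K A B) C (tensor K A (tensor K B C)) (\<lambda>x c.
       sweedler K A B (tensor K A (tensor K B C)) x (\<lambda>a b. tens K A (tensor K B C) a (tens K B C b c)))"

definition assoc_l ::
  "('k, 'r) ring_scheme \<Rightarrow> ('k, 'a, 'm) module_scheme \<Rightarrow> ('k, 'b, 'n) module_scheme \<Rightarrow>
   ('k, 'c, 'p) module_scheme \<Rightarrow>
   ('k, 'a, ('k, 'b, 'c) tensor) tensor \<Rightarrow> ('k, ('k, 'a, 'b) tensor, 'c) tensor"
  where
  "assoc_l K A B C =
     tensor_lift K A (tensor K B C) (tensor K (tensor K A B) C) (\<lambda>a y.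
       sweedler K B C (tensor K (tensor K A B) C) y (\<lambda>b c. tens K (tensor K A B) C (tens K A B a b) c))"


section \<open>The colored Yang-Baxter equation\<close>

text \<open>Both sides are maps \<open>(A \<otimes> B) \<otimes> C \<rightarrow> (C \<otimes> B) \<otimes> A\<close>.\<close>

definition cYBE ::
  "('k, 'r) ring_scheme \<Rightarrow> ('k, 'a, 'm) module_scheme \<Rightarrow> ('k, 'b, 'n) module_scheme \<Rightarrow>
   ('k, 'c, 'p) module_scheme \<Rightarrow>
   (('k, 'a, 'b) tensor \<Rightarrow> ('k, 'b, 'a) tensor) \<Rightarrow>
   (('k, 'a, 'c) tensor \<Rightarrow> ('k, 'c, 'a) tensor) \<Rightarrow>
   (('k, 'b, 'c) tensor \<Rightarrow> ('k, 'c, 'b) tensor) \<Rightarrow> bool"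
  where
  "cYBE K A B C \<sigma>AB \<sigma>AC \<sigma>BC \<longleftrightarrow>
    (\<forall>x \<in> carrier (tensor K (tensor K A B) C).
      (tensor_map K (tensor K B C) A (tensor K C B) A \<sigma>BC id \<circ>
       assoc_l K B C A \<circ>
       tensor_map K B (tensor K A C) B (tensor K C A) id \<sigma>AC \<circ>
       assoc_r K B A C \<circ>
       tensor_map K (tensor K A B) C (tensor K B A) C \<sigma>AB id) x
      =
      (assoc_l K C B A \<circ>
       tensor_map K C (tensor K A B) C (tensor K B A) id \<sigma>AB \<circ>
       assoc_r K C A B \<circ>
       tensor_map K (tensor K A C) B (tensor K C A) B \<sigma>AC id \<circ>
       assoc_l K A C B \<circ>
       tensor_map K A (tensor K B C) A (tensor K C B) id \<sigma>BC \<circ>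
       assoc_r K A B C) x)"


section \<open>Bialgebras and their duals\<close>

record ('k, 'h) bialgebra = "('k, 'h) module" +
  mult_map :: "('k, 'h, 'h) tensor \<Rightarrow> 'h"
  unit_map :: "'k \<Rightarrow> 'h"
  comult :: "'h \<Rightarrow> ('k, 'h, 'h) tensor"
  counit :: "'h \<Rightarrow> 'k"

locale bialgebra = vectorspace K H
  for K :: "('k, 'r) ring_scheme" and H :: "('k, 'h, 'z) bialgebra_scheme" +
  assumes mult_hom: "mult_map H \<in> module_hom K (tensor K H H) H"
    and unit_hom: "unit_map H \<in> module_hom K (ground K) H"
    and comult_hom: "comult H \<in> module_hom K H (tensor K H H)"
    and counit_hom: "counit H \<in> module_hom K H (ground K)"
    and mult_assoc: "\<lbrakk>a \<in> carrier H; b \<in> carrier H; c \<in> carrier H\<rbrakk> \<Longrightarrow>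
      mult_map H (tens K H H (mult_map H (tens K H H a b)) c) =
      mult_map H (tens K H H a (mult_map H (tens K H H b c)))"
    and unit_l: "a \<in> carrier H \<Longrightarrow> mult_map H (tens K H H (unit_map H \<one>\<^bsub>K\<^esub>) a) = a"
    and unit_r: "a \<in> carrier H \<Longrightarrow> mult_map H (tens K H H a (unit_map H \<one>\<^bsub>K\<^esub>)) = a"
    and coassoc: "a \<in> carrier H \<Longrightarrow>
      assoc_r K H H H (tensor_map K H H (tensor K H H) H (comult H) id (comult H a)) =
      tensor_map K H H H (tensor K H H) id (comult H) (comult H a)"
    and counit_l: "a \<in> carrier H \<Longrightarrow>
      sweedler K H H H (comult H a) (\<lambda>a1 a2. counit H a1 \<odot>\<^bsub>H\<^esub> a2) = a"
    and counit_r: "a \<in> carrier H \<Longrightarrow>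
      sweedler K H H H (comult H a) (\<lambda>a1 a2. counit H a2 \<odot>\<^bsub>H\<^esub> a1) = a"
    and comult_mult: "\<lbrakk>a \<in> carrier H; b \<in> carrier H\<rbrakk> \<Longrightarrow>
      comult H (mult_map H (tens K H H a b)) =
      sweedler K H H (tensor K H H) (comult H a) (\<lambda>a1 a2.
        sweedler K H H (tensor K H H) (comult H b) (\<lambda>b1 b2.
          tens K H H (mult_map H (tens K H H a1 b1)) (mult_map H (tens K H H a2 b2))))"
    and comult_unit: "comult H (unit_map H \<one>\<^bsub>K\<^esub>) = tens K H H (unit_map H \<one>\<^bsub>K\<^esub>) (unit_map H \<one>\<^bsub>K\<^esub>)"
    and counit_mult: "\<lbrakk>a \<in> carrier H; b \<in> carrier H\<rbrakk> \<Longrightarrow>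
      counit H (mult_map H (tens K H H a b)) = counit H a \<otimes>\<^bsub>K\<^esub> counit H b"
    and counit_unit: "counit H (unit_map H \<one>\<^bsub>K\<^esub>) = \<one>\<^bsub>K\<^esub>"

definition dual :: "('k, 'r) ring_scheme \<Rightarrow> ('k, 'h, 'z) module_scheme \<Rightarrow> ('k, 'h \<Rightarrow> 'k) module" where
  "dual K H = (ring.func_space K (carrier H))
     \<lparr>carrier := module_hom K H (ground K) \<inter> extensional (carrier H)\<rparr>"

text \<open>The dual structures follow the ``rainbow'' convention, in which the two tensor factors are
  paired in reversed order. \<open>dual_comult\<close> is well defined for finite-dimensional \<open>H\<close>.\<close>

definition dual_mult ::
  "('k, 'r) ring_scheme \<Rightarrow> ('k, 'h, 'z) bialgebra_scheme \<Rightarrow>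
   ('k, 'h \<Rightarrow> 'k, 'h \<Rightarrow> 'k) tensor \<Rightarrow> 'h \<Rightarrow> 'k"
  where
  "dual_mult K H = tensor_lift K (dual K H) (dual K H) (dual K H) (\<lambda>l m.
     \<lambda>h\<in>carrier H. sweedler K H H (ground K) (comult H h) (\<lambda>h1 h2. l h2 \<otimes>\<^bsub>K\<^esub> m h1))"

definition dual_one ::
  "('k, 'h, 'z) bialgebra_scheme \<Rightarrow> 'h \<Rightarrow> 'k"
  where
  "dual_one H = restrict (counit H) (carrier H)"

definition dual_comult ::
  "('k, 'r) ring_scheme \<Rightarrow> ('k, 'h, 'z) bialgebra_scheme \<Rightarrow>
   ('h \<Rightarrow> 'k) \<Rightarrow> ('k, 'h \<Rightarrow> 'k, 'h \<Rightarrow> 'k) tensor"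
  where
  "dual_comult K H l = (THE t. t \<in> carrier (tensor K (dual K H) (dual K H)) \<and>
     (\<forall>h\<in>carrier H. \<forall>h'\<in>carrier H.
        l (mult_map H (tens K H H h h')) =
        sweedler K (dual K H) (dual K H) (ground K) t (\<lambda>l1 l2. l1 h' \<otimes>\<^bsub>K\<^esub> l2 h)))"


section \<open>Modules, comodules and Yetter-Drinfeld compatibility\<close>

definition left_module ::
  "('k, 'r) ring_scheme \<Rightarrow> ('k, 'h, 'z) bialgebra_scheme \<Rightarrow> ('k, 'v, 'y) module_scheme \<Rightarrow>
   (('k, 'h, 'v) tensor \<Rightarrow> 'v) \<Rightarrow> bool"
  where
  "left_module K H V lam \<longleftrightarrow>
     lam \<in> module_hom K (tensor K H V) V \<and>
     (\<forall>h\<in>carrier H. \<forall>h'\<in>carrier H. \<forall>v\<in>carrier V.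
        lam (tens K H V (mult_map H (tens K H H h h')) v) =
        lam (tens K H V h (lam (tens K H V h' v)))) \<and>
     (\<forall>v\<in>carrier V. lam (tens K H V (unit_map H \<one>\<^bsub>K\<^esub>) v) = v)"

definition right_comodule ::
  "('k, 'r) ring_scheme \<Rightarrow> ('k, 'h, 'z) bialgebra_scheme \<Rightarrow> ('k, 'v, 'y) module_scheme \<Rightarrow>
   ('v \<Rightarrow> ('k, 'v, 'h) tensor) \<Rightarrow> bool"
  where
  "right_comodule K H V del \<longleftrightarrow>
     del \<in> module_hom K V (tensor K V H) \<and>
     (\<forall>v\<in>carrier V.
        assoc_r K V H H (tensor_map K V H (tensor K V H) H del id (del v)) =
        tensor_map K V H V (tensor K H H) id (comult H) (del v)) \<and>
     (\<forall>v\<in>carrier V. sweedler K V H V (del v) (\<lambda>v0 v1. counit H v1 \<odot>\<^bsub>V\<^esub> v0) = v)"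

definition YD_compatible ::
  "('k, 'r) ring_scheme \<Rightarrow> ('k, 'h, 'z) bialgebra_scheme \<Rightarrow> ('k, 'v, 'y) module_scheme \<Rightarrow>
   (('k, 'h, 'v) tensor \<Rightarrow> 'v) \<Rightarrow> ('v \<Rightarrow> ('k, 'v, 'h) tensor) \<Rightarrow> bool"
  where
  "YD_compatible K H V lam del \<longleftrightarrow>
     (\<forall>h\<in>carrier H. \<forall>v\<in>carrier V.
        sweedler K H H (tensor K V H) (comult H h) (\<lambda>h1 h2.
          sweedler K V H (tensor K V H) (del (lam (tens K H V h2 v))) (\<lambda>x0 x1.
            tens K V H x0 (mult_map H (tens K H H x1 h1)))) =
        sweedler K H H (tensor K V H) (comult H h) (\<lambda>h1 h2.
          sweedler K V H (tensor K V H) (del v) (\<lambda>v0 v1.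
            tens K V H (lam (tens K H V h1 v0)) (mult_map H (tens K H H h2 v1)))))"


section \<open>The braiding components\<close>

text \<open>The letter \<open>D\<close> in a name stands for the dual \<open>H\<^sup>*\<close>. In \<open>\<sigma>_HH\<close> and \<open>\<sigma>_VV\<close> the canonical isomorphisms \<open>H \<otimes> H \<cong> (H \<otimes> H) \<otimes> K\<close> and
  \<open>V \<otimes> V \<cong> K \<otimes> (V \<otimes> V)\<close> are implicit.\<close>

definition \<sigma>_HH ::
  "('k, 'r) ring_scheme \<Rightarrow> ('k, 'h, 'z) bialgebra_scheme \<Rightarrow>
   ('k, 'h, 'h) tensor \<Rightarrow> ('k, 'h, 'h) tensor"
  where
  "\<sigma>_HH K H x = tens K H H (mult_map H x) (unit_map H \<one>\<^bsub>K\<^esub>)"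

definition \<sigma>_DD ::
  "('k, 'r) ring_scheme \<Rightarrow> ('k, 'h, 'z) bialgebra_scheme \<Rightarrow>
   ('k, 'h \<Rightarrow> 'k, 'h \<Rightarrow> 'k) tensor \<Rightarrow> ('k, 'h \<Rightarrow> 'k, 'h \<Rightarrow> 'k) tensor"
  where
  "\<sigma>_DD K H = tensor_lift K (dual K H) (dual K H) (tensor K (dual K H) (dual K H)) (\<lambda>l m.
     tens K (dual K H) (dual K H) (dual_one H)
       (dual_mult K H (tens K (dual K H) (dual K H) l m)))"

definition \<sigma>_HD ::
  "('k, 'r) ring_scheme \<Rightarrow> ('k, 'h, 'z) bialgebra_scheme \<Rightarrow>
   ('k, 'h, 'h \<Rightarrow> 'k) tensor \<Rightarrow> ('k, 'h \<Rightarrow> 'k, 'h) tensor"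
  where
  "\<sigma>_HD K H = tensor_lift K H (dual K H) (tensor K (dual K H) H) (\<lambda>h l.
     sweedler K H H (tensor K (dual K H) H) (comult H h) (\<lambda>h1 h2.
       sweedler K (dual K H) (dual K H) (tensor K (dual K H) H) (dual_comult K H l) (\<lambda>l1 l2.
         tens K (dual K H) H (l1 h2 \<odot>\<^bsub>dual K H\<^esub> l2) h1)))"

definition \<sigma>_VV ::
  "('k, 'r) ring_scheme \<Rightarrow> ('k, 'v, 'y) module_scheme \<Rightarrow> (('k, 'v, 'v) tensor \<Rightarrow> 'v) \<Rightarrow>
   ('k \<Rightarrow> 'v) \<Rightarrow> ('k, 'v, 'v) tensor \<Rightarrow> ('k, 'v, 'v) tensor"
  where
  "\<sigma>_VV K V mu nu x = tens K V V (nu \<one>\<^bsub>K\<^esub>) (mu x)"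

definition \<sigma>_HV ::
  "('k, 'r) ring_scheme \<Rightarrow> ('k, 'h, 'z) bialgebra_scheme \<Rightarrow> ('k, 'v, 'y) module_scheme \<Rightarrow>
   (('k, 'h, 'v) tensor \<Rightarrow> 'v) \<Rightarrow> ('k, 'h, 'v) tensor \<Rightarrow> ('k, 'v, 'h) tensor"
  where
  "\<sigma>_HV K H V lam = tensor_lift K H V (tensor K V H) (\<lambda>h v.
     sweedler K H H (tensor K V H) (comult H h) (\<lambda>h1 h2.
       tens K V H (lam (tens K H V h2 v)) h1))"

definition \<sigma>_VD ::
  "('k, 'r) ring_scheme \<Rightarrow> ('k, 'h, 'z) bialgebra_scheme \<Rightarrow> ('k, 'v, 'y) module_scheme \<Rightarrow>
   ('v \<Rightarrow> ('k, 'v, 'h) tensor) \<Rightarrow> ('k, 'v, 'h \<Rightarrow> 'k) tensor \<Rightarrow> ('k, 'h \<Rightarrow> 'k, 'v) tensor"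
  where
  "\<sigma>_VD K H V del = tensor_lift K V (dual K H) (tensor K (dual K H) V) (\<lambda>v l.
     sweedler K V H (tensor K (dual K H) V) (del v) (\<lambda>v0 v1.
       sweedler K (dual K H) (dual K H) (tensor K (dual K H) V) (dual_comult K H l) (\<lambda>l1 l2.
         tens K (dual K H) V (l1 v1 \<odot>\<^bsub>dual K H\<^esub> l2) v0)))"

end

theory Submission
  imports Defs
begin

text \<open>On pure tensors the Yang-Baxter equation becomes an identity between nested Sweedler sums
  over the values of the three braidings (\<open>cYBE_iff\<close>), and the whole proof consists in comparing
  such sums. Two principles, one for equations with \<open>H\<^sup>*\<close> in the last place and one for equations
  with \<open>H\<close> in the first, settle three of the six cases; they leave the remaining braiding arbitrary.

  If \<open>C = H\<^sup>*\<close> and the braidings with \<open>H\<^sup>*\<close> come from linear maps \<open>A \<rightarrow> A \<otimes> H\<close> and \<open>B \<rightarrow> B \<otimes> H\<close>, the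
  equation says that the braiding of \<open>A\<close> and \<open>B\<close> is colinear (\<open>cYBE_dual_iff\<close>). The point is that
  a functional \<open>l\<close> passing an element \<open>x\<close> turns into its translate \<open>l(_ x\<^sub>(\<^sub>1\<^sub>))\<close>, so both sides
  arise from the two sides of the colinearity identity by applying \<open>l\<close> to the \<open>H\<close>-component; and
  the functionals on a finite-dimensional space separate points. For \<open>H \<otimes> V \<otimes> H\<^sup>*\<close> colinearity of
  the braiding of \<open>H\<close> and \<open>V\<close> is the Yetter-Drinfeld condition, once coassociativity and the
  counit are used to remove a spectator copy of \<open>H\<close>. For \<open>V \<otimes> V \<otimes> H\<^sup>*\<close> it is the compatibility of
  \<open>\<delta>\<close> with \<open>\<mu>\<close>, preceded on both sides by the unit of \<open>V\<close>.

  If \<open>A = H\<close> and the braidings with \<open>H\<close> come from linear maps \<open>H \<otimes> B \<rightarrow> B\<close> and \<open>H \<otimes> C \<rightarrow> C\<close>, the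
  equation says in the same way that the braiding of \<open>B\<close> and \<open>C\<close> is \<open>H\<close>-linear
  (\<open>cYBE_bialgebra_iff\<close>); this settles \<open>H \<otimes> V \<otimes> V\<close>. In the two cases with the unit of \<open>V\<close> in
  front, a functional not vanishing on the unit cancels it; in infinite dimension such a
  functional comes from Zorn's lemma (\<open>functional_exists\<close>).

  The other three cases are computed directly: both sides are an instance of the associativity or
  coassociativity law surrounded by units, which counits, evaluation at the unit of \<open>H\<close>, or
  multiplication remove. The Sweedler calculus rests on the universal property of the tensor
  product.\<close>

section \<open>Quotients and free modules\<close>

lemma module_homI:
  assumes "\<And>x. x \<in> carrier M \<Longrightarrow> f x \<in> carrier N"
    and "\<And>x y. x \<in> carrier M \<Longrightarrow> y \<in> carrier M \<Longrightarrow> f (x \<oplus>\<^bsub>M\<^esub> y) = f x \<oplus>\<^bsub>N\<^esub> f y"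
    and "\<And>c x. c \<in> carrier K \<Longrightarrow> x \<in> carrier M \<Longrightarrow> f (c \<odot>\<^bsub>M\<^esub> x) = c \<odot>\<^bsub>N\<^esub> f x"
  shows "f \<in> module_hom K M N"
  using assms by (auto simp: module_hom_def)

lemma lin_closed:
  "f \<in> module_hom K M N \<Longrightarrow> x \<in> carrier M \<Longrightarrow> f x \<in> carrier N"
  by (auto simp: module_hom_def)

lemma module_hom_zero:
  assumes "module K M" "module K N" "f \<in> module_hom K M N"
  shows "f \<zero>\<^bsub>M\<^esub> = \<zero>\<^bsub>N\<^esub>"
proof -
  interpret mod_hom K M N f
    using assms by (simp add: mod_hom_def mod_hom_axioms_def)
  show ?thesis by (rule f0_is_0)
qed

lemma module_hom_cong:
  assumes "f \<in> module_hom K M N" and "module K M" and "\<And>x. x \<in> carrier M \<Longrightarrow> g x = f x"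
  shows "g \<in> module_hom K M N"
proof -
  interpret module K M by fact
  show ?thesis using assms by (auto simp: module_hom_def)
qed

lemma lin_comp:
  assumes "f \<in> module_hom K M N" "g \<in> module_hom K N P"
  shows "(\<lambda>x. g (f x)) \<in> module_hom K M P"
  using assms by (simp add: module_hom_def Pi_iff)

lemma quot_space_module:
  assumes "module K M" and "submodule K N M"
  shows "module K (quot_space M N)"
    and "(\<lambda>x. N +>\<^bsub>M\<^esub> x) \<in> module_hom K M (quot_space M N)"
    and "carrier (quot_space M N) = (\<lambda>x. N +>\<^bsub>M\<^esub> x) ` carrier M"
    and "\<And>x y. x \<in> carrier M \<Longrightarrow> y \<in> carrier M \<Longrightarrow> x \<ominus>\<^bsub>M\<^esub> y \<in> N \<Longrightarrow>
      N +>\<^bsub>M\<^esub> x = N +>\<^bsub>M\<^esub> y"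
proof -
  interpret module K M by fact
  interpret N: submodule K N M by fact
  have neg: "\<ominus>\<^bsub>M\<^esub> x \<in> N" if "x \<in> N" for x
  proof -
    have "(\<ominus>\<^bsub>K\<^esub> \<one>\<^bsub>K\<^esub>) \<odot>\<^bsub>M\<^esub> x \<in> N" using that by (intro N.smult_closed) auto
    moreover have "x \<in> carrier M" using that N.subset by auto
    ultimately show ?thesis by (simp only: smult_minus_1)
  qed
  have "additive_subgroup N M"
    using neg N.subset N.zero_closed
    by (intro additive_subgroup.intro subgroup.intro) (auto simp: a_inv_def)
  then interpret N: abelian_subgroup N M
    by (rule abelian_subgroupI3) unfold_locales
  have add: "set_add M (N +>\<^bsub>M\<^esub> x) (N +>\<^bsub>M\<^esub> y) = N +>\<^bsub>M\<^esub> (x \<oplus>\<^bsub>M\<^esub> y)"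
    if "x \<in> carrier M" "y \<in> carrier M" for x y
    using that by (rule N.a_rcos_sum)
  have zero: "N +>\<^bsub>M\<^esub> \<zero>\<^bsub>M\<^esub> = N"
    using N.subset by (rule M.a_coset_add_zero)
  have eqI: "N +>\<^bsub>M\<^esub> y = N +>\<^bsub>M\<^esub> x"
    if "x \<in> carrier M" "y \<in> N +>\<^bsub>M\<^esub> x" for x y
    using M.a_repr_independence[OF that(2,1) N.a_subgroup] by simp
  show "N +>\<^bsub>M\<^esub> x = N +>\<^bsub>M\<^esub> y"
    if xy: "x \<in> carrier M" "y \<in> carrier M" and N: "x \<ominus>\<^bsub>M\<^esub> y \<in> N" for x y
  proof (rule eqI[OF xy(2)])
    have "(x \<ominus>\<^bsub>M\<^esub> y) \<oplus>\<^bsub>M\<^esub> y = x" using xy by (simp add: M.minus_eq M.a_assoc M.l_neg)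
    then show "x \<in> N +>\<^bsub>M\<^esub> y" using N by (force simp: a_r_coset_def')
  qed
  have smult: "(\<Union>x'\<in>N +>\<^bsub>M\<^esub> x. N +>\<^bsub>M\<^esub> (c \<odot>\<^bsub>M\<^esub> x')) = N +>\<^bsub>M\<^esub> (c \<odot>\<^bsub>M\<^esub> x)"
    if c: "c \<in> carrier K" and x: "x \<in> carrier M" for c x
  proof -
    have "N +>\<^bsub>M\<^esub> (c \<odot>\<^bsub>M\<^esub> x') = N +>\<^bsub>M\<^esub> (c \<odot>\<^bsub>M\<^esub> x)" if "x' \<in> N +>\<^bsub>M\<^esub> x" for x'
    proof -
      from that obtain n where n: "n \<in> N" "x' = n \<oplus>\<^bsub>M\<^esub> x"
        by (auto simp: a_r_coset_def')
      have "c \<odot>\<^bsub>M\<^esub> x' = c \<odot>\<^bsub>M\<^esub> n \<oplus>\<^bsub>M\<^esub> c \<odot>\<^bsub>M\<^esub> x"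
        using n c x N.subset by (auto simp: smult_r_distr)
      moreover have "c \<odot>\<^bsub>M\<^esub> n \<in> N" using c n by simp
      ultimately have "c \<odot>\<^bsub>M\<^esub> x' \<in> N +>\<^bsub>M\<^esub> (c \<odot>\<^bsub>M\<^esub> x)"
        by (auto simp: a_r_coset_def')
      then show ?thesis using c x by (intro eqI) auto
    qed
    moreover have "x \<in> N +>\<^bsub>M\<^esub> x" using x by (rule N.a_rcos_self)
    ultimately show ?thesis by blast
  qed
  have carr: "carrier (quot_space M N) = (\<lambda>x. N +>\<^bsub>M\<^esub> x) ` carrier M"
    by (auto simp: quot_space_def A_RCOSETS_def')
  then show "carrier (quot_space M N) = (\<lambda>x. N +>\<^bsub>M\<^esub> x) ` carrier M" .
  have qadd: "(N +>\<^bsub>M\<^esub> x) \<oplus>\<^bsub>quot_space M N\<^esub> (N +>\<^bsub>M\<^esub> y) = N +>\<^bsub>M\<^esub> (x \<oplus>\<^bsub>M\<^esub> y)"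
    if "x \<in> carrier M" "y \<in> carrier M" for x y
    using add[OF that] by (simp add: quot_space_def)
  have qsmult: "c \<odot>\<^bsub>quot_space M N\<^esub> (N +>\<^bsub>M\<^esub> x) = N +>\<^bsub>M\<^esub> (c \<odot>\<^bsub>M\<^esub> x)"
    if "c \<in> carrier K" "x \<in> carrier M" for c x
    using smult[OF that] by (simp add: quot_space_def)
  have qzero: "\<zero>\<^bsub>quot_space M N\<^esub> = N +>\<^bsub>M\<^esub> \<zero>\<^bsub>M\<^esub>"
    using zero by (simp add: quot_space_def)
  note q = qadd qsmult qzero
  show "(\<lambda>x. N +>\<^bsub>M\<^esub> x) \<in> module_hom K M (quot_space M N)"
    by (rule module_homI) (simp_all add: carr q)
  show "module K (quot_space M N)"
  proof (rule module_criteria)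
    show "cring K" by unfold_locales
    show "\<forall>v\<in>carrier (quot_space M N). \<exists>neg_v\<in>carrier (quot_space M N).
        v \<oplus>\<^bsub>quot_space M N\<^esub> neg_v = \<zero>\<^bsub>quot_space M N\<^esub>"
    proof
      fix v assume "v \<in> carrier (quot_space M N)"
      then obtain x where x: "x \<in> carrier M" "v = N +>\<^bsub>M\<^esub> x" by (auto simp: carr)
      then have "v \<oplus>\<^bsub>quot_space M N\<^esub> (N +>\<^bsub>M\<^esub> (\<ominus>\<^bsub>M\<^esub> x)) = \<zero>\<^bsub>quot_space M N\<^esub>"
        by (simp add: q M.r_neg)
      then show "\<exists>neg_v\<in>carrier (quot_space M N). v \<oplus>\<^bsub>quot_space M N\<^esub> neg_v = \<zero>\<^bsub>quot_space M N\<^esub>"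
        using x by (intro bexI[of _ "N +>\<^bsub>M\<^esub> (\<ominus>\<^bsub>M\<^esub> x)"]) (simp_all add: carr)
    qed
  qed (simp add: q carr, unfold carr, (clarify, simp add: q smult_l_distr smult_r_distr
    smult_assoc1 M.a_ac)+)
qed

context
  fixes K :: "('k, 'r) ring_scheme" and S :: "'s set"
  assumes K: "cring K"
begin

interpretation cring K by (rule K)

lemma free_space_simps:
  "carrier (free_space K S) = {f \<in> S \<rightarrow>\<^sub>E carrier K. finite {s \<in> S. f s \<noteq> \<zero>\<^bsub>K\<^esub>}}"
  "\<zero>\<^bsub>free_space K S\<^esub> = (\<lambda>s\<in>S. \<zero>\<^bsub>K\<^esub>)"
  "f \<oplus>\<^bsub>free_space K S\<^esub> g = (\<lambda>s\<in>S. f s \<oplus>\<^bsub>K\<^esub> g s)"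
  "c \<odot>\<^bsub>free_space K S\<^esub> f = (\<lambda>s\<in>S. c \<otimes>\<^bsub>K\<^esub> f s)"
  by (auto simp: free_space_def func_space_def)

lemma free_space_module: "module K (free_space K S)"
proof -
  interpret F: module K "func_space S" by (rule func_space_is_module)
  let ?C = "{f \<in> S \<rightarrow>\<^sub>E carrier K. finite {s \<in> S. f s \<noteq> \<zero>\<^bsub>K\<^esub>}}"
  have "submodule K ?C (func_space S)"
  proof (rule submodule.intro)
    show "module K (func_space S)" by (rule F.module_axioms)
    show "?C \<subseteq> carrier (func_space S)" by (auto simp: func_space_def)
    show "\<zero>\<^bsub>func_space S\<^esub> \<in> ?C" by (auto simp: func_space_def)
  next
    fix v w assume v: "v \<in> ?C" and w: "w \<in> ?C"
    have "{s \<in> S. v s \<oplus>\<^bsub>K\<^esub> w s \<noteq> \<zero>\<^bsub>K\<^esub>} \<subseteq> {s \<in> S. v s \<noteq> \<zero>\<^bsub>K\<^esub>} \<union> {s \<in> S. w s \<noteq> \<zero>\<^bsub>K\<^esub>}"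
      by auto
    from finite_subset[OF this] v w have "finite {s \<in> S. v s \<oplus>\<^bsub>K\<^esub> w s \<noteq> \<zero>\<^bsub>K\<^esub>}" by auto
    with v w show "v \<oplus>\<^bsub>func_space S\<^esub> w \<in> ?C"
      by (auto simp: func_space_def PiE_mem cong: conj_cong)
  next
    fix c v assume c: "c \<in> carrier K" and v: "v \<in> ?C"
    have "{s \<in> S. c \<otimes>\<^bsub>K\<^esub> v s \<noteq> \<zero>\<^bsub>K\<^esub>} \<subseteq> {s \<in> S. v s \<noteq> \<zero>\<^bsub>K\<^esub>}"
      using c by auto
    from finite_subset[OF this] v have "finite {s \<in> S. c \<otimes>\<^bsub>K\<^esub> v s \<noteq> \<zero>\<^bsub>K\<^esub>}" by auto
    with c v show "c \<odot>\<^bsub>func_space S\<^esub> v \<in> ?C"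
      by (auto simp: func_space_def PiE_mem cong: conj_cong)
  qed
  from F.submodule_is_module[OF this] show ?thesis
    by (simp add: free_space_def)
qed

lemma free_gen_carrier: "s \<in> S \<Longrightarrow> free_gen K S s \<in> carrier (free_space K S)"
  by (auto simp: free_space_simps free_gen_def)

text \<open>Peeling off one generator at a time reduces finitely supported functions to zero.\<close>

lemma free_space_induct [consumes 1, case_names zero add]:
  assumes f: "f \<in> carrier (free_space K S)"
    and zero: "P \<zero>\<^bsub>free_space K S\<^esub>"
    and add: "\<And>g c s. g \<in> carrier (free_space K S) \<Longrightarrow> c \<in> carrier K \<Longrightarrow> s \<in> S \<Longrightarrow> P g \<Longrightarrow>
      P (g \<oplus>\<^bsub>free_space K S\<^esub> c \<odot>\<^bsub>free_space K S\<^esub> free_gen K S s)"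
  shows "P f"
proof -
  have "P f" if "finite T" "f \<in> carrier (free_space K S)" "{s \<in> S. f s \<noteq> \<zero>\<^bsub>K\<^esub>} \<subseteq> T" for T f
    using that
  proof (induction T arbitrary: f rule: finite_induct)
    case empty
    then have "f = \<zero>\<^bsub>free_space K S\<^esub>"
      by (auto simp: free_space_simps fun_eq_iff extensional_def PiE_def)
    then show ?case using zero by simp
  next
    case (insert t T)
    show ?case
    proof (cases "t \<in> S")
      case False
      with insert.prems show ?thesis by (intro insert.IH) auto
    next
      case t: True
      define g where "g = f(t := \<zero>\<^bsub>K\<^esub>)"
      have sub: "{s \<in> S. g s \<noteq> \<zero>\<^bsub>K\<^esub>} \<subseteq> T" "{s \<in> S. g s \<noteq> \<zero>\<^bsub>K\<^esub>} \<subseteq> {s \<in> S. f s \<noteq> \<zero>\<^bsub>K\<^esub>}"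
        using insert.prems by (auto simp: g_def)
      have fC: "f \<in> S \<rightarrow>\<^sub>E carrier K" "finite {s \<in> S. f s \<noteq> \<zero>\<^bsub>K\<^esub>}"
        using insert.prems by (auto simp: free_space_simps)
      have "g \<in> S \<rightarrow>\<^sub>E carrier K" using fC t by (auto simp: g_def PiE_def extensional_def)
      then have g: "g \<in> carrier (free_space K S)"
        using sub fC finite_subset by (auto simp: free_space_simps)
      have "f = g \<oplus>\<^bsub>free_space K S\<^esub> f t \<odot>\<^bsub>free_space K S\<^esub> free_gen K S t"
      proof
        fix s
        have "f s \<in> carrier K" if "s \<in> S" by (rule PiE_mem[OF fC(1) that])
        moreover have "f s = undefined" if "s \<notin> S" by (rule PiE_arb[OF fC(1) that])
        moreover have "f t \<in> carrier K" by (rule PiE_mem[OF fC(1) t])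
        ultimately show "f s = (g \<oplus>\<^bsub>free_space K S\<^esub> f t \<odot>\<^bsub>free_space K S\<^esub> free_gen K S t) s"
          using t by (cases "s \<in> S"; cases "s = t") (simp_all add: free_space_simps g_def
          free_gen_def)
      qed
      moreover have "P (g \<oplus>\<^bsub>free_space K S\<^esub> f t \<odot>\<^bsub>free_space K S\<^esub> free_gen K S t)"
        using fC t g sub by (intro add insert.IH) (auto simp: PiE_mem)
      ultimately show ?thesis by simp
    qed
  qed
  from this[of "{s \<in> S. f s \<noteq> \<zero>\<^bsub>K\<^esub>}"] f show ?thesis
    by (auto simp: free_space_simps)
qed

text \<open>The extension sums over the support. The support changes under addition, so the sums are
  first spread over a common finite set.\<close>

lemma free_space_extend:
  assumes W: "module K W" and f: "f \<in> S \<rightarrow> carrier W"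
  obtains g where "g \<in> module_hom K (free_space K S) W"
    and "\<And>s. s \<in> S \<Longrightarrow> g (free_gen K S s) = f s"
proof -
  interpret W: module K W by fact
  have FK: "\<phi> s \<in> carrier K" if "\<phi> \<in> S \<rightarrow>\<^sub>E carrier K" "s \<in> S" for \<phi> s
    using that by (rule PiE_mem)
  have fW: "f s \<in> carrier W" if "s \<in> S" for s using f that by (rule Pi_mem)
  define g where "g \<phi> = (\<Oplus>\<^bsub>W\<^esub>s\<in>{s \<in> S. \<phi> s \<noteq> \<zero>\<^bsub>K\<^esub>}. \<phi> s \<odot>\<^bsub>W\<^esub> f s)" for \<phi>
  have g_sup: "g \<phi> = (\<Oplus>\<^bsub>W\<^esub>s\<in>T. \<phi> s \<odot>\<^bsub>W\<^esub> f s)"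
    if "\<phi> \<in> S \<rightarrow>\<^sub>E carrier K" "finite T" "T \<subseteq> S" "{s \<in> S. \<phi> s \<noteq> \<zero>\<^bsub>K\<^esub>} \<subseteq> T" for \<phi> T
  proof -
    have "f s \<in> carrier W" "\<phi> s \<in> carrier K" if "s \<in> T" for s
      using that \<open>T \<subseteq> S\<close> \<open>\<phi> \<in> S \<rightarrow>\<^sub>E carrier K\<close> f by (auto simp: FK fW)
    with that show ?thesis
      unfolding g_def by (intro W.M.add.finprod_mono_neutral_cong_left) auto
  qed
  have g_closed: "(\<Oplus>\<^bsub>W\<^esub>s\<in>T. \<phi> s \<odot>\<^bsub>W\<^esub> f s) \<in> carrier W"
    if "\<phi> \<in> S \<rightarrow>\<^sub>E carrier K" "T \<subseteq> S" for \<phi> T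
    using that by (intro W.M.finsum_closed) (auto intro!: W.smult_closed fW elim!: FK)
  have hom: "g \<in> module_hom K (free_space K S) W"
  proof (rule module_homI)
    fix \<phi> assume "\<phi> \<in> carrier (free_space K S)"
    then show "g \<phi> \<in> carrier W" unfolding g_def by (intro g_closed) (auto simp: free_space_simps)
  next
    fix \<phi> \<psi> assume asm: "\<phi> \<in> carrier (free_space K S)" "\<psi> \<in> carrier (free_space K S)"
    let ?T = "{s \<in> S. \<phi> s \<noteq> \<zero>\<^bsub>K\<^esub>} \<union> {s \<in> S. \<psi> s \<noteq> \<zero>\<^bsub>K\<^esub>}"
    have fin: "finite ?T" and F: "\<phi> \<in> S \<rightarrow>\<^sub>E carrier K" "\<psi> \<in> S \<rightarrow>\<^sub>E carrier K"
      using asm by (auto simp: free_space_simps)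
    have "g (\<phi> \<oplus>\<^bsub>free_space K S\<^esub> \<psi>)
        = (\<Oplus>\<^bsub>W\<^esub>s\<in>?T. (\<phi> \<oplus>\<^bsub>free_space K S\<^esub> \<psi>) s \<odot>\<^bsub>W\<^esub> f s)"
      using fin F by (intro g_sup) (auto simp: free_space_simps FK fW)
    also have "\<dots> = (\<Oplus>\<^bsub>W\<^esub>s\<in>?T. \<phi> s \<odot>\<^bsub>W\<^esub> f s \<oplus>\<^bsub>W\<^esub> \<psi> s \<odot>\<^bsub>W\<^esub> f s)"
      using F f by (intro W.M.finsum_cong') (auto simp: free_space_simps FK fW W.smult_l_distr)
    also have "\<dots> = (\<Oplus>\<^bsub>W\<^esub>s\<in>?T. \<phi> s \<odot>\<^bsub>W\<^esub> f s) \<oplus>\<^bsub>W\<^esub> (\<Oplus>\<^bsub>W\<^esub>s\<in>?T. \<psi> s \<odot>\<^bsub>W\<^esub> f s)"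
      using F f by (intro W.M.finsum_addf) (auto simp: FK fW)
    also have "\<dots> = g \<phi> \<oplus>\<^bsub>W\<^esub> g \<psi>"
      using g_sup[OF F(1) fin] g_sup[OF F(2) fin] by auto
    finally show "g (\<phi> \<oplus>\<^bsub>free_space K S\<^esub> \<psi>) = g \<phi> \<oplus>\<^bsub>W\<^esub> g \<psi>" .
  next
    fix c \<phi> assume asm: "c \<in> carrier K" "\<phi> \<in> carrier (free_space K S)"
    let ?T = "{s \<in> S. \<phi> s \<noteq> \<zero>\<^bsub>K\<^esub>}"
    have fin: "finite ?T" and F: "\<phi> \<in> S \<rightarrow>\<^sub>E carrier K"
      using asm by (auto simp: free_space_simps)
    have "g (c \<odot>\<^bsub>free_space K S\<^esub> \<phi>) = (\<Oplus>\<^bsub>W\<^esub>s\<in>?T. (c \<odot>\<^bsub>free_space K S\<^esub> \<phi>) s \<odot>\<^bsub>W\<^esub> f s)"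
      using asm fin F by (intro g_sup) (auto simp: free_space_simps FK fW)
    also have "\<dots> = (\<Oplus>\<^bsub>W\<^esub>s\<in>?T. c \<odot>\<^bsub>W\<^esub> (\<phi> s \<odot>\<^bsub>W\<^esub> f s))"
      using asm F f by (intro W.M.finsum_cong') (auto simp: free_space_simps FK fW W.smult_assoc1)
    also have "\<dots> = c \<odot>\<^bsub>W\<^esub> g \<phi>"
      unfolding g_def using asm F f fin by (intro W.finsum_smult[symmetric]) (auto simp: FK fW)
    finally show "g (c \<odot>\<^bsub>free_space K S\<^esub> \<phi>) = c \<odot>\<^bsub>W\<^esub> g \<phi>" .
  qed
  have "g (free_gen K S s) = f s" if s: "s \<in> S" for s
  proof -
    have "g (free_gen K S s) = (\<Oplus>\<^bsub>W\<^esub>t\<in>{s}. free_gen K S s t \<odot>\<^bsub>W\<^esub> f t)"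
      using s by (intro g_sup) (auto simp: free_gen_def split: if_splits)
    also have "\<dots> = f s" using s f by (auto simp: free_gen_def fW)
    finally show ?thesis .
  qed
  with hom show ?thesis by (rule that)
qed

end

section \<open>The tensor product and its universal property\<close>

definition bilinear ::
  "('k, 'r) ring_scheme \<Rightarrow> ('k, 'a, 'm) module_scheme \<Rightarrow> ('k, 'b, 'n) module_scheme \<Rightarrow>
   ('k, 'w, 'p) module_scheme \<Rightarrow> ('a \<Rightarrow> 'b \<Rightarrow> 'w) \<Rightarrow> bool"
  where
  "bilinear K A B W F \<longleftrightarrow>
     (\<forall>a\<in>carrier A. (\<lambda>b. F a b) \<in> module_hom K B W) \<and>
     (\<forall>b\<in>carrier B. (\<lambda>a. F a b) \<in> module_hom K A W)"

lemma bilinearI: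
  assumes "\<And>a. a \<in> carrier A \<Longrightarrow> (\<lambda>b. F a b) \<in> module_hom K B W"
    and "\<And>b. b \<in> carrier B \<Longrightarrow> (\<lambda>a. F a b) \<in> module_hom K A W"
  shows "bilinear K A B W F"
  using assms by (auto simp: bilinear_def)

lemma bilinear_homs:
  assumes "bilinear K A B W F"
  shows "a \<in> carrier A \<Longrightarrow> F a \<in> module_hom K B W"
    and "b \<in> carrier B \<Longrightarrow> (\<lambda>a. F a b) \<in> module_hom K A W"
    and "a \<in> carrier A \<Longrightarrow> b \<in> carrier B \<Longrightarrow> F a b \<in> carrier W"
  using assms by (auto simp: bilinear_def intro: lin_closed)

context
  fixes K :: "('k, 'r) ring_scheme" and A :: "('k, 'a, 'm) module_scheme"
    and B :: "('k, 'b, 'n) module_scheme"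
  assumes A: "module K A" and B: "module K B"
begin

interpretation A: module K A by (rule A)
interpretation B: module K B by (rule B)

private abbreviation "S \<equiv> carrier A \<times> carrier B"
private abbreviation "F \<equiv> free_space K S"
private abbreviation "N \<equiv> tensor_null K A B"
private abbreviation "gen a b \<equiv> free_gen K S (a, b)"

private lemma F: "module K F"
  by (rule free_space_module) (rule A.R.cring_axioms)

interpretation F: module K F by (rule F)

private lemma gen: "a \<in> carrier A \<Longrightarrow> b \<in> carrier B \<Longrightarrow> gen a b \<in> carrier F"
  by (rule free_gen_carrier) (auto simp: A.R.cring_axioms)

private lemma relators: "tensor_relators K A B \<subseteq> carrier F"
  unfolding tensor_relators_def Let_def
  by (intro Un_least subsetI; elim CollectE exE conjE; hypsubst;
      intro F.M.minus_closed F.M.add.m_closed F.smult_closed gen A.M.add.m_closed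
        B.M.add.m_closed A.smult_closed B.smult_closed; assumption)

private lemma relator_mem:
  assumes "a \<in> carrier A" "b \<in> carrier B"
  shows "a' \<in> carrier A \<Longrightarrow>
      gen (a \<oplus>\<^bsub>A\<^esub> a') b \<ominus>\<^bsub>F\<^esub> (gen a b \<oplus>\<^bsub>F\<^esub> gen a' b) \<in> tensor_relators K A B"
    and "b' \<in> carrier B \<Longrightarrow>
      gen a (b \<oplus>\<^bsub>B\<^esub> b') \<ominus>\<^bsub>F\<^esub> (gen a b \<oplus>\<^bsub>F\<^esub> gen a b') \<in> tensor_relators K A B"
    and "c \<in> carrier K \<Longrightarrow>
      gen (c \<odot>\<^bsub>A\<^esub> a) b \<ominus>\<^bsub>F\<^esub> (c \<odot>\<^bsub>F\<^esub> gen a b) \<in> tensor_relators K A B"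
    and "c \<in> carrier K \<Longrightarrow>
      gen a (c \<odot>\<^bsub>B\<^esub> b) \<ominus>\<^bsub>F\<^esub> (c \<odot>\<^bsub>F\<^esub> gen a b) \<in> tensor_relators K A B"
  using assms unfolding tensor_relators_def Let_def by blast+

private lemma null: "submodule K N F"
  unfolding tensor_null_def by (rule F.span_is_submodule) (rule relators)

private lemma relator_null: "x \<in> tensor_relators K A B \<Longrightarrow> x \<in> N"
  unfolding tensor_null_def using F.in_own_span[OF relators] by auto

lemma tensor_module: "module K (tensor K A B)"
  unfolding tensor_def by (rule quot_space_module(1)[OF F null])

private lemma proj: "(\<lambda>x. N +>\<^bsub>F\<^esub> x) \<in> module_hom K F (tensor K A B)"
  unfolding tensor_def by (rule quot_space_module(2)[OF F null])

private lemma surj: "carrier (tensor K A B) = (\<lambda>x. N +>\<^bsub>F\<^esub> x) ` carrier F"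
  unfolding tensor_def by (rule quot_space_module(3)[OF F null])

lemma tens_carrier: "a \<in> carrier A \<Longrightarrow> b \<in> carrier B \<Longrightarrow> tens K A B a b \<in> carrier (tensor K A B)"
  unfolding surj tens_def using gen by auto

private lemma tens_add:
  assumes "x \<ominus>\<^bsub>F\<^esub> (gen a b \<oplus>\<^bsub>F\<^esub> gen a' b') \<in> tensor_relators K A B" "x \<in> carrier F"
    "a \<in> carrier A" "a' \<in> carrier A" "b \<in> carrier B" "b' \<in> carrier B"
  shows "N +>\<^bsub>F\<^esub> x = tens K A B a b \<oplus>\<^bsub>tensor K A B\<^esub> tens K A B a' b'"
proof -
  have "N +>\<^bsub>F\<^esub> x = N +>\<^bsub>F\<^esub> (gen a b \<oplus>\<^bsub>F\<^esub> gen a' b')"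
    using assms gen by (intro quot_space_module(4)[OF F null] relator_null) auto
  also have "\<dots> = tens K A B a b \<oplus>\<^bsub>tensor K A B\<^esub> tens K A B a' b'"
    using assms gen unfolding tens_def by (intro module_hom_add[OF proj]) auto
  finally show ?thesis .
qed

private lemma tens_smult:
  assumes "x \<ominus>\<^bsub>F\<^esub> (c \<odot>\<^bsub>F\<^esub> gen a b) \<in> tensor_relators K A B" "x \<in> carrier F"
    "c \<in> carrier K" "a \<in> carrier A" "b \<in> carrier B"
  shows "N +>\<^bsub>F\<^esub> x = c \<odot>\<^bsub>tensor K A B\<^esub> tens K A B a b"
proof -
  have "N +>\<^bsub>F\<^esub> x = N +>\<^bsub>F\<^esub> (c \<odot>\<^bsub>F\<^esub> gen a b)"
    using assms gen by (intro quot_space_module(4)[OF F null] relator_null) auto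
  also have "\<dots> = c \<odot>\<^bsub>tensor K A B\<^esub> tens K A B a b"
    using assms gen unfolding tens_def by (intro module_hom_smult[OF proj]) auto
  finally show ?thesis .
qed

lemma tens_bilinear: "bilinear K A B (tensor K A B) (tens K A B)"
proof (rule bilinearI; rule module_homI)
  fix a b b' assume "a \<in> carrier A" "b \<in> carrier B" "b' \<in> carrier B"
  then show "tens K A B a (b \<oplus>\<^bsub>B\<^esub> b') = tens K A B a b \<oplus>\<^bsub>tensor K A B\<^esub> tens K A B a b'"
    unfolding tens_def[of K A B a "b \<oplus>\<^bsub>B\<^esub> b'"]
    by (intro tens_add gen relator_mem) auto
next
  fix a a' b assume "a \<in> carrier A" "a' \<in> carrier A" "b \<in> carrier B"
  then show "tens K A B (a \<oplus>\<^bsub>A\<^esub> a') b = tens K A B a b \<oplus>\<^bsub>tensor K A B\<^esub> tens K A B a' b"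
    unfolding tens_def[of K A B "a \<oplus>\<^bsub>A\<^esub> a'" b]
    by (intro tens_add gen relator_mem) auto
next
  fix a c b assume "a \<in> carrier A" "c \<in> carrier K" "b \<in> carrier B"
  then show "tens K A B a (c \<odot>\<^bsub>B\<^esub> b) = c \<odot>\<^bsub>tensor K A B\<^esub> tens K A B a b"
    unfolding tens_def[of K A B a "c \<odot>\<^bsub>B\<^esub> b"]
    by (intro tens_smult gen relator_mem) auto
next
  fix b c a assume "b \<in> carrier B" "c \<in> carrier K" "a \<in> carrier A"
  then show "tens K A B (c \<odot>\<^bsub>A\<^esub> a) b = c \<odot>\<^bsub>tensor K A B\<^esub> tens K A B a b"
    unfolding tens_def[of K A B "c \<odot>\<^bsub>A\<^esub> a" b]
    by (intro tens_smult gen relator_mem) auto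
qed (auto intro: tens_carrier)

text \<open>Every element of the tensor product is the class of a finite combination of generators, and
  the class of a generator is a pure tensor.\<close>

lemma tensor_hom_eqI:
  assumes W: "module K W" and f: "f \<in> module_hom K (tensor K A B) W"
    and g: "g \<in> module_hom K (tensor K A B) W"
    and eq: "\<And>a b. a \<in> carrier A \<Longrightarrow> b \<in> carrier B \<Longrightarrow> f (tens K A B a b) = g (tens K A B a b)"
    and t: "t \<in> carrier (tensor K A B)"
  shows "f t = g t"
proof -
  let ?f = "\<lambda>x. f (N +>\<^bsub>F\<^esub> x)" and ?g = "\<lambda>x. g (N +>\<^bsub>F\<^esub> x)"
  have f': "?f \<in> module_hom K F W" using proj f by (rule lin_comp)
  have g': "?g \<in> module_hom K F W" using proj g by (rule lin_comp)
  obtain x where x: "x \<in> carrier F" "t = N +>\<^bsub>F\<^esub> x" using t by (auto simp: surj)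
  from x(1) have "?f x = ?g x"
  proof (induction x rule: free_space_induct[OF A.R.cring_axioms, consumes 1, case_names zero add])
    case zero
    show ?case using module_hom_zero[OF F W f'] module_hom_zero[OF F W g'] by simp
  next
    case (add u c s)
    obtain a b where s: "s = (a, b)" "a \<in> carrier A" "b \<in> carrier B" using add by (cases s) auto
    have "?f (gen a b) = ?g (gen a b)" using eq[OF s(2,3)] by (simp add: tens_def)
    then show ?case
      using add s gen[OF s(2,3)] module_hom_add[OF f'] module_hom_add[OF g']
        module_hom_smult[OF f'] module_hom_smult[OF g'] by simp
  qed
  with x show ?thesis by simp
qed

text \<open>The linear extension to the free space kills the relators, because the map is bilinear;
  hence it kills their span, and its value on a coset does not depend on the representative.\<close>

lemma tensor_lift_exists:
  assumes W: "module K W" and f: "bilinear K A B W f"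
  obtains g where "g \<in> module_hom K (tensor K A B) W"
    and "\<And>a b. a \<in> carrier A \<Longrightarrow> b \<in> carrier B \<Longrightarrow> g (tens K A B a b) = f a b"
proof -
  interpret W: module K W by (rule W)
  have "(\<lambda>(a, b). f a b) \<in> S \<rightarrow> carrier W" using bilinear_homs(3)[OF f] by auto
  from free_space_extend[OF A.R.cring_axioms W this]
  obtain h where h: "h \<in> module_hom K F W"
    and h_gen: "\<And>s. s \<in> S \<Longrightarrow> h (free_gen K S s) = (\<lambda>(a, b). f a b) s"
    by blast
  interpret h: mod_hom K F W h using h by unfold_locales
  have hg: "h (gen a b) = f a b" if "a \<in> carrier A" "b \<in> carrier B" for a b
    using h_gen[of "(a, b)"] that by simp
  have rel: "tensor_relators K A B \<subseteq> h.ker"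
  proof
    fix x assume x: "x \<in> tensor_relators K A B"
    have "h x = \<zero>\<^bsub>W\<^esub>"
      using x unfolding tensor_relators_def Let_def
      by (elim UnE CollectE exE conjE; hypsubst)
        (simp_all add: gen hg bilinear_homs[OF f] module_hom_add[OF bilinear_homs(1)[OF f]]
          module_hom_add[OF bilinear_homs(2)[OF f]] module_hom_smult[OF bilinear_homs(1)[OF f]]
          module_hom_smult[OF bilinear_homs(2)[OF f]])
    with x relators show "x \<in> h.ker" by (auto simp: h.ker_def)
  qed
  have "N \<subseteq> h.ker"
    unfolding tensor_null_def using rel h.ker_is_submodule by (rule F.span_is_subset)
  then have hN: "h n = \<zero>\<^bsub>W\<^esub>" "n \<in> carrier F" if "n \<in> N" for n
    using that by (auto simp: h.ker_def)
  define g where "g X = h (SOME x. x \<in> X)" for X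
  have g: "g (N +>\<^bsub>F\<^esub> x) = h x" if x: "x \<in> carrier F" for x
  proof -
    have "\<zero>\<^bsub>F\<^esub> \<in> N" by (rule submodule.zero_closed[OF null])
    then have "\<zero>\<^bsub>F\<^esub> \<oplus>\<^bsub>F\<^esub> x \<in> N +>\<^bsub>F\<^esub> x" unfolding a_r_coset_def' by blast
    then have "(SOME y. y \<in> N +>\<^bsub>F\<^esub> x) \<in> N +>\<^bsub>F\<^esub> x"
      by (rule someI[where P = "\<lambda>y. y \<in> N +>\<^bsub>F\<^esub> x"])
    then obtain n where "n \<in> N" "(SOME y. y \<in> N +>\<^bsub>F\<^esub> x) = n \<oplus>\<^bsub>F\<^esub> x"
      unfolding a_r_coset_def' by blast
    then show ?thesis using hN[of n] x by (simp add: g_def)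
  qed
  have "g \<in> module_hom K (tensor K A B) W"
  proof (rule module_homI)
    fix X assume "X \<in> carrier (tensor K A B)"
    then show "g X \<in> carrier W" by (auto simp: surj g)
  next
    fix X Y assume "X \<in> carrier (tensor K A B)" "Y \<in> carrier (tensor K A B)"
    then obtain x y where xy: "x \<in> carrier F" "X = N +>\<^bsub>F\<^esub> x" "y \<in> carrier F" "Y = N +>\<^bsub>F\<^esub> y"
      by (auto simp: surj)
    then have "X \<oplus>\<^bsub>tensor K A B\<^esub> Y = N +>\<^bsub>F\<^esub> (x \<oplus>\<^bsub>F\<^esub> y)"
      using module_hom_add[OF proj] by simp
    then show "g (X \<oplus>\<^bsub>tensor K A B\<^esub> Y) = g X \<oplus>\<^bsub>W\<^esub> g Y" using xy by (simp add: g)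
  next
    fix c X assume c: "c \<in> carrier K" and "X \<in> carrier (tensor K A B)"
    then obtain x where x: "x \<in> carrier F" "X = N +>\<^bsub>F\<^esub> x" by (auto simp: surj)
    then have "c \<odot>\<^bsub>tensor K A B\<^esub> X = N +>\<^bsub>F\<^esub> (c \<odot>\<^bsub>F\<^esub> x)"
      using c module_hom_smult[OF proj] by simp
    then show "g (c \<odot>\<^bsub>tensor K A B\<^esub> X) = c \<odot>\<^bsub>W\<^esub> g X" using c x by (simp add: g)
  qed
  moreover have "g (tens K A B a b) = f a b" if "a \<in> carrier A" "b \<in> carrier B" for a b
    unfolding tens_def using that by (simp add: g gen hg)
  ultimately show ?thesis by (rule that)
qed

lemma tensor_lift:
  assumes W: "module K W" and f: "bilinear K A B W f"
  shows tensor_lift_hom: "tensor_lift K A B W f \<in> module_hom K (tensor K A B) W"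
    and lift_tens: "\<And>a b. a \<in> carrier A \<Longrightarrow> b \<in> carrier B \<Longrightarrow>
      tensor_lift K A B W f (tens K A B a b) = f a b"
proof -
  interpret T: module K "tensor K A B" by (rule tensor_module)
  let ?P = "\<lambda>g. g \<in> module_hom K (tensor K A B) W \<and> g \<in> extensional (carrier (tensor K A B)) \<and>
        (\<forall>a\<in>carrier A. \<forall>b\<in>carrier B. g (tens K A B a b) = f a b)"
  obtain g where g: "g \<in> module_hom K (tensor K A B) W"
    "\<And>a b. a \<in> carrier A \<Longrightarrow> b \<in> carrier B \<Longrightarrow> g (tens K A B a b) = f a b"
    using tensor_lift_exists[OF W f] by blast
  define r where "r = restrict g (carrier (tensor K A B))"
  have r: "r \<in> module_hom K (tensor K A B) W" "r \<in> extensional (carrier (tensor K A B))"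
    by (simp_all add: r_def module_hom_cong[OF g(1) tensor_module])
  have r_tens: "r (tens K A B a b) = f a b" if "a \<in> carrier A" "b \<in> carrier B" for a b
    using g(2) that by (simp add: r_def tens_carrier)
  have "?P r" using r r_tens by simp
  then have "?P (THE g. ?P g)"
  proof (rule theI[where P = ?P])
    fix g' assume g': "?P g'"
    show "g' = r"
    proof (rule extensionalityI)
      show "g' \<in> extensional (carrier (tensor K A B))" using g' by simp
      show "r \<in> extensional (carrier (tensor K A B))" by (rule r)
      fix t assume "t \<in> carrier (tensor K A B)"
      from _ _ _ this show "g' t = r t"
        by (rule tensor_hom_eqI[OF W]) (simp_all add: g' r r_tens)
    qed
  qed
  then show "tensor_lift K A B W f \<in> module_hom K (tensor K A B) W"
    "\<And>a b. a \<in> carrier A \<Longrightarrow> b \<in> carrier B \<Longrightarrow> tensor_lift K A B W f (tens K A B a b) = f a b"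
    unfolding tensor_lift_def by blast+
qed

end

section \<open>Calculus of Sweedler sums\<close>

lemma ground_module: "cring K \<Longrightarrow> module K (ground K)"
proof -
  assume "cring K"
  then interpret cring K .
  have "abelian_group (ground K)"
    by (rule abelian_groupI) (auto simp: ground_def a_ac intro: l_neg)
  then show ?thesis
    by (rule moduleI[OF is_cring]) (auto simp: ground_def l_distr r_distr m_assoc)
qed

lemma ground_simps [simp]:
  "carrier (ground K) = carrier K" "add (ground K) = add K" "smult (ground K) = mult K"
  "zero (ground K) = zero K"
  by (simp_all add: ground_def)

subsection \<open>Linearity of composite expressions\<close>

lemma hom_id: "(\<lambda>x. x) \<in> module_hom K M M"
  by (auto simp: module_hom_def)

lemma hom_smult_right:
  assumes "module K W" "c \<in> carrier K" "f \<in> module_hom K X W"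
  shows "(\<lambda>x. c \<odot>\<^bsub>W\<^esub> f x) \<in> module_hom K X W"
proof -
  interpret module K W by fact
  show ?thesis
    using assms(2,3)
    by (intro module_homI) (simp_all add: module_hom_def Pi_iff smult_r_distr R.m_comm
        flip: smult_assoc1)
qed

lemma hom_smult_left:
  assumes "module K W" "w \<in> carrier W" "f \<in> module_hom K X (ground K)"
  shows "(\<lambda>x. f x \<odot>\<^bsub>W\<^esub> w) \<in> module_hom K X W"
proof -
  interpret module K W by fact
  show ?thesis
    using assms(2,3)
    by (intro module_homI) (simp_all add: module_hom_def Pi_iff smult_l_distr smult_assoc1)
qed

lemma hom_sum:
  assumes "module K W" "f \<in> module_hom K X W" "g \<in> module_hom K X W"
  shows "(\<lambda>x. f x \<oplus>\<^bsub>W\<^esub> g x) \<in> module_hom K X W"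
proof -
  interpret module K W by fact
  show ?thesis
    using assms(2,3) by (intro module_homI) (simp_all add: module_hom_def Pi_iff smult_r_distr
      M.a_ac)
qed

lemma hom_tens_left:
  assumes "module K A" "module K B" "f \<in> module_hom K X A" "b \<in> carrier B"
  shows "(\<lambda>x. tens K A B (f x) b) \<in> module_hom K X (tensor K A B)"
  by (rule lin_comp[OF assms(3) bilinear_homs(2)[OF tens_bilinear[OF assms(1,2)] assms(4)]])

lemma hom_tens_right:
  assumes "module K A" "module K B" "a \<in> carrier A" "f \<in> module_hom K X B"
  shows "(\<lambda>x. tens K A B a (f x)) \<in> module_hom K X (tensor K A B)"
  by (rule lin_comp[OF assms(4) bilinear_homs(1)[OF tens_bilinear[OF assms(1,2)] assms(3)]])

lemma hom_lift_arg:
  assumes "module K A" "module K B" "module K W" "bilinear K A B W F"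
    "t \<in> module_hom K X (tensor K A B)"
  shows "(\<lambda>x. tensor_lift K A B W F (t x)) \<in> module_hom K X W"
  by (rule lin_comp[OF assms(5) tensor_lift_hom[OF assms(1-4)]])

lemma lift_carrier:
  assumes "module K A" "module K B" "module K W" "bilinear K A B W F" "t \<in> carrier (tensor K A B)"
  shows "tensor_lift K A B W F t \<in> carrier W"
  by (rule lin_closed[OF tensor_lift_hom[OF assms(1-4)] assms(5)])

text \<open>On a pure tensor the Sweedler sum is its summand, which depends linearly on the parameter;
  pure tensors suffice to compare the sums for \<open>x + y\<close> and \<open>c x\<close>.\<close>

lemma hom_lift_fun:
  assumes A: "module K A" and B: "module K B" and W: "module K W" and X: "module K X"
    and t: "t \<in> carrier (tensor K A B)"
    and F: "\<And>x. x \<in> carrier X \<Longrightarrow> bilinear K A B W (F x)"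
    and hom: "\<And>a b. a \<in> carrier A \<Longrightarrow> b \<in> carrier B \<Longrightarrow> (\<lambda>x. F x a b) \<in> module_hom K X W"
  shows "(\<lambda>x. tensor_lift K A B W (F x) t) \<in> module_hom K X W"
proof -
  interpret X: module K X by (rule X)
  have lh: "(\<lambda>t. tensor_lift K A B W (F x) t) \<in> module_hom K (tensor K A B) W" if "x \<in> carrier X"
    for x
    using A B W F that by (intro tensor_lift_hom)
  show ?thesis
  proof (rule module_homI)
    fix x assume "x \<in> carrier X"
    then show "tensor_lift K A B W (F x) t \<in> carrier W"
      using A B W F t by (intro lift_carrier) auto
  next
    fix x y assume xy: "x \<in> carrier X" "y \<in> carrier X"
    show "tensor_lift K A B W (F (x \<oplus>\<^bsub>X\<^esub> y)) t =
      tensor_lift K A B W (F x) t \<oplus>\<^bsub>W\<^esub> tensor_lift K A B W (F y) t"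
    proof (rule tensor_hom_eqI[OF A B W _ _ _ t])
      fix a b assume "a \<in> carrier A" "b \<in> carrier B"
      then show "tensor_lift K A B W (F (x \<oplus>\<^bsub>X\<^esub> y)) (tens K A B a b) =
        tensor_lift K A B W (F x) (tens K A B a b) \<oplus>\<^bsub>W\<^esub> tensor_lift K A B W (F y) (tens K A B a b)"
        using xy by (simp add: lift_tens[OF A B W F] module_hom_add[OF hom])
    qed (use xy in \<open>simp_all add: hom_sum[OF W] lh\<close>)
  next
    fix c x assume cx: "c \<in> carrier K" "x \<in> carrier X"
    show "tensor_lift K A B W (F (c \<odot>\<^bsub>X\<^esub> x)) t = c \<odot>\<^bsub>W\<^esub> tensor_lift K A B W (F x) t"
    proof (rule tensor_hom_eqI[OF A B W _ _ _ t])
      fix a b assume "a \<in> carrier A" "b \<in> carrier B"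
      then show "tensor_lift K A B W (F (c \<odot>\<^bsub>X\<^esub> x)) (tens K A B a b) =
        c \<odot>\<^bsub>W\<^esub> tensor_lift K A B W (F x) (tens K A B a b)"
        using cx by (simp add: lift_tens[OF A B W F] module_hom_smult[OF hom])
    qed (use cx in \<open>simp_all add: hom_smult_right[OF W] lh\<close>)
  qed
qed

lemma smult_carrier: "module K W \<Longrightarrow> c \<in> carrier K \<Longrightarrow> w \<in> carrier W \<Longrightarrow> c \<odot>\<^bsub>W\<^esub> w \<in> carrier W"
  by (rule module.smult_closed)

text \<open>Linearity and membership of a composite expression follow its syntax: these rules decide
  them by descending into the expression.\<close>

lemmas lin_intros = bilinearI hom_id hom_smult_right hom_smult_left hom_tens_left hom_tens_right
  hom_lift_arg hom_lift_fun lift_carrier tens_carrier tensor_module smult_carrier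

subsection \<open>Rewriting rules\<close>

lemma tensor_lift_cong [cong]:
  assumes "\<And>a b. a \<in> carrier A \<Longrightarrow> b \<in> carrier B \<Longrightarrow> F a b = G a b" and "t = s"
  shows "tensor_lift K A B W F t = tensor_lift K A B W G s"
proof -
  have "tensor_lift K A B W F = tensor_lift K A B W G"
    unfolding tensor_lift_def using assms(1) by (simp cong: ball_cong)
  then show ?thesis using assms(2) by simp
qed

lemmas lift_cong = tensor_lift_cong[OF _ refl]

lemma hom_lift:
  assumes "module K A" "module K B" "module K W" "module K W'" "g \<in> module_hom K W W'"
    "bilinear K A B W F" "t \<in> carrier (tensor K A B)"
  shows "g (tensor_lift K A B W F t) = tensor_lift K A B W' (\<lambda>a b. g (F a b)) t"
proof (rule tensor_hom_eqI[OF assms(1,2,4) _ _ _ assms(7)])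
  have gF: "bilinear K A B W' (\<lambda>a b. g (F a b))"
    by (intro bilinearI lin_comp[OF _ assms(5)] bilinear_homs[OF assms(6)])
  show "(\<lambda>t. g (tensor_lift K A B W F t)) \<in> module_hom K (tensor K A B) W'"
    by (rule lin_comp[OF tensor_lift_hom[OF assms(1-3,6)] assms(5)])
  show "tensor_lift K A B W' (\<lambda>a b. g (F a b)) \<in> module_hom K (tensor K A B) W'"
    by (rule tensor_lift_hom[OF assms(1,2,4) gF])
  show "g (tensor_lift K A B W F (tens K A B a b)) =
      tensor_lift K A B W' (\<lambda>a b. g (F a b)) (tens K A B a b)"
    if "a \<in> carrier A" "b \<in> carrier B" for a b
    by (simp only: lift_tens[OF assms(1-3,6) that] lift_tens[OF assms(1,2,4) gF that])
qed

text \<open>A linear map is pushed through one Sweedler sum and evaluated on the summand; repetition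
  reaches summands under several binders.\<close>

lemma hom_lift_eq:
  assumes "g \<in> module_hom K W W'" "module K A" "module K B" "module K W" "module K W'"
    "t \<in> carrier (tensor K A B)" "bilinear K A B W F"
    "\<And>a b. a \<in> carrier A \<Longrightarrow> b \<in> carrier B \<Longrightarrow> g (F a b) = G a b"
  shows "g (tensor_lift K A B W F t) = tensor_lift K A B W' G t"
  by (subst hom_lift[OF assms(2-5,1,7,6)]) (rule tensor_lift_cong[OF assms(8) refl])

lemma lift_lift:
  assumes "module K A" "module K B" "module K C" "module K D" "module K W"
    "bilinear K C D W G" "bilinear K A B (tensor K C D) F" "t \<in> carrier (tensor K A B)"
  shows "tensor_lift K C D W G (tensor_lift K A B (tensor K C D) F t) =
    tensor_lift K A B W (\<lambda>a b. tensor_lift K C D W G (F a b)) t"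
  using assms by (intro hom_lift tensor_lift_hom tensor_module)

lemma tens_lift_left:
  assumes "module K A" "module K B" "module K C" "module K D"
    "bilinear K A B C F" "t \<in> carrier (tensor K A B)" "d \<in> carrier D"
  shows "tens K C D (tensor_lift K A B C F t) d =
    tensor_lift K A B (tensor K C D) (\<lambda>a b. tens K C D (F a b) d) t"
  by (rule hom_lift[OF assms(1-3) tensor_module[OF assms(3,4)]
        hom_tens_left[OF assms(3,4) hom_id assms(7)] assms(5,6)])

lemma tens_lift_right:
  assumes "module K A" "module K B" "module K C" "module K D"
    "bilinear K A B D F" "t \<in> carrier (tensor K A B)" "c \<in> carrier C"
  shows "tens K C D c (tensor_lift K A B D F t) =
    tensor_lift K A B (tensor K C D) (\<lambda>a b. tens K C D c (F a b)) t"
  by (rule hom_lift[OF assms(1,2,4) tensor_module[OF assms(3,4)]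
        hom_tens_right[OF assms(3,4,7) hom_id] assms(5,6)])

lemma smult_lift:
  assumes "module K A" "module K B" "module K W"
    "bilinear K A B W F" "t \<in> carrier (tensor K A B)" "c \<in> carrier K"
  shows "c \<odot>\<^bsub>W\<^esub> tensor_lift K A B W F t = tensor_lift K A B W (\<lambda>a b. c \<odot>\<^bsub>W\<^esub> F a b) t"
  by (rule hom_lift[OF assms(1-3,3) hom_smult_right[OF assms(3,6) hom_id] assms(4,5)])

lemma lift_tens_id:
  assumes "module K A" "module K B" "t \<in> carrier (tensor K A B)"
  shows "tensor_lift K A B (tensor K A B) (tens K A B) t = t"
  by (rule tensor_hom_eqI[OF assms(1,2) tensor_module[OF assms(1,2)] _ hom_id _ assms(3)])
    (simp_all add: assms tensor_module tens_bilinear tensor_lift_hom lift_tens)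

lemma bilinear_lift_fun:
  assumes "module K A" "module K B" "module K C" "module K D" "module K W"
    and "s \<in> carrier (tensor K C D)"
    and "\<And>a b. a \<in> carrier A \<Longrightarrow> b \<in> carrier B \<Longrightarrow> bilinear K C D W (F a b)"
    and "\<And>c d. c \<in> carrier C \<Longrightarrow> d \<in> carrier D \<Longrightarrow> bilinear K A B W (\<lambda>a b. F a b c d)"
  shows "bilinear K A B W (\<lambda>a b. tensor_lift K C D W (F a b) s)"
  by (rule bilinearI; rule hom_lift_fun[OF assms(3,4,5) _ assms(6)])
    (simp_all add: assms bilinear_homs[OF assms(8)])

text \<open>Both sides are linear in \<open>s\<close>, and for a pure tensor \<open>s\<close> they are the same sum over \<open>t\<close>.\<close>

lemma lift_swap:
  assumes A: "module K A" and B: "module K B" and C: "module K C" and D: "module K D"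
    and W: "module K W"
    and t: "t \<in> carrier (tensor K A B)" and s: "s \<in> carrier (tensor K C D)"
    and 1: "\<And>a b. a \<in> carrier A \<Longrightarrow> b \<in> carrier B \<Longrightarrow> bilinear K C D W (F a b)"
    and 2: "\<And>c d. c \<in> carrier C \<Longrightarrow> d \<in> carrier D \<Longrightarrow> bilinear K A B W (\<lambda>a b. F a b c d)"
  shows "tensor_lift K A B W (\<lambda>a b. tensor_lift K C D W (F a b) s) t =
    tensor_lift K C D W (\<lambda>c d. tensor_lift K A B W (\<lambda>a b. F a b c d) t) s"
proof (rule tensor_hom_eqI[OF C D W _ _ _ s])
  have b: "bilinear K C D W (\<lambda>c d. tensor_lift K A B W (\<lambda>a b. F a b c d) t)"
    by (rule bilinear_lift_fun[OF C D A B W t 2 1])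
  show "(\<lambda>s. tensor_lift K A B W (\<lambda>a b. tensor_lift K C D W (F a b) s) t)
      \<in> module_hom K (tensor K C D) W"
    by (rule hom_lift_fun[OF A B W tensor_module[OF C D] t bilinear_lift_fun[OF A B C D W _ 1 2]])
      (simp_all add: tensor_lift_hom[OF C D W 1])
  show "tensor_lift K C D W (\<lambda>c d. tensor_lift K A B W (\<lambda>a b. F a b c d) t)
      \<in> module_hom K (tensor K C D) W"
    by (rule tensor_lift_hom[OF C D W b])
  fix c d assume cd: "c \<in> carrier C" "d \<in> carrier D"
  show "tensor_lift K A B W (\<lambda>a b. tensor_lift K C D W (F a b) (tens K C D c d)) t =
     tensor_lift K C D W (\<lambda>c d. tensor_lift K A B W (\<lambda>a b. F a b c d) t) (tens K C D c d)"
    by (simp add: lift_tens[OF C D W 1 cd] lift_tens[OF C D W b cd])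
qed

abbreviation tens3 where
  "tens3 K A B C a b c \<equiv> tens K (tensor K A B) C (tens K A B a b) c"

abbreviation tensor3 where
  "tensor3 K A B C \<equiv> tensor K (tensor K A B) C"

lemma tensor3_hom_eqI:
  assumes A: "module K A" and B: "module K B" and C: "module K C" and W: "module K W"
    and f: "f \<in> module_hom K (tensor3 K A B C) W"
    and g: "g \<in> module_hom K (tensor3 K A B C) W"
    and eq: "\<And>a b c. a \<in> carrier A \<Longrightarrow> b \<in> carrier B \<Longrightarrow> c \<in> carrier C \<Longrightarrow>
      f (tens3 K A B C a b c) = g (tens3 K A B C a b c)"
    and x: "x \<in> carrier (tensor3 K A B C)"
  shows "f x = g x"
proof (rule tensor_hom_eqI[OF tensor_module[OF A B] C W f g _ x])
  fix t c assume t: "t \<in> carrier (tensor K A B)" and c: "c \<in> carrier C"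
  have *: "(\<lambda>t. tens K (tensor K A B) C t c) \<in> module_hom K (tensor K A B) (tensor3 K A B C)"
    by (rule hom_tens_left[OF tensor_module[OF A B] C hom_id c])
  show "f (tens K (tensor K A B) C t c) = g (tens K (tensor K A B) C t c)"
    by (rule tensor_hom_eqI[OF A B W lin_comp[OF * f] lin_comp[OF * g] _ t])
      (simp add: eq c)
qed

lemma tensor_map_hom:
  assumes "module K A" "module K B" "module K C" "module K D"
    "f \<in> module_hom K A C" "g \<in> module_hom K B D"
  shows "tensor_map K A B C D f g \<in> module_hom K (tensor K A B) (tensor K C D)"
    and "\<And>a b. a \<in> carrier A \<Longrightarrow> b \<in> carrier B \<Longrightarrow>
      tensor_map K A B C D f g (tens K A B a b) = tens K C D (f a) (g b)"
proof -
  note CD = tensor_module[OF assms(3,4)]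
  have *: "bilinear K A B (tensor K C D) (\<lambda>a b. tens K C D (f a) (g b))"
    by (intro bilinearI hom_tens_left hom_tens_right assms)
      (simp_all add: lin_closed[OF assms(5)] lin_closed[OF assms(6)])
  show "tensor_map K A B C D f g \<in> module_hom K (tensor K A B) (tensor K C D)"
    unfolding tensor_map_def by (rule tensor_lift_hom[OF assms(1,2) CD *])
  show "tensor_map K A B C D f g (tens K A B a b) = tens K C D (f a) (g b)"
    if "a \<in> carrier A" "b \<in> carrier B" for a b
    unfolding tensor_map_def by (rule lift_tens[OF assms(1,2) CD * that])
qed

section \<open>The colored Yang-Baxter equation on pure tensors\<close>

lemma lin_compose:
  "f \<in> module_hom K M N \<Longrightarrow> g \<in> module_hom K N P \<Longrightarrow> g \<circ> f \<in> module_hom K M P"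
  unfolding comp_def by (rule lin_comp)

context
  fixes K :: "('k, 'r) ring_scheme" and A :: "('k, 'a, 'm) module_scheme"
    and B :: "('k, 'b, 'n) module_scheme" and C :: "('k, 'c, 'p) module_scheme"
  assumes modules [simp]: "module K A" "module K B" "module K C"
begin

lemma assoc_r:
  shows assoc_r_hom: "assoc_r K A B C \<in> module_hom K (tensor3 K A B C) (tensor K A (tensor K B C))"
    and assoc_r_tens: "t \<in> carrier (tensor K A B) \<Longrightarrow> c \<in> carrier C \<Longrightarrow>
      assoc_r K A B C (tens K (tensor K A B) C t c) =
      tensor_lift K A B (tensor K A (tensor K B C)) (\<lambda>a b. tens K A (tensor K B C) a (tens K B C b
        c)) t"
  unfolding assoc_r_def by (simp_all add: lin_intros tensor_lift_hom lift_tens)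

lemma assoc_l:
  shows assoc_l_hom: "assoc_l K A B C \<in> module_hom K (tensor K A (tensor K B C)) (tensor3 K A B C)"
    and assoc_l_tens: "a \<in> carrier A \<Longrightarrow> t \<in> carrier (tensor K B C) \<Longrightarrow>
      assoc_l K A B C (tens K A (tensor K B C) a t) =
      tensor_lift K B C (tensor3 K A B C) (\<lambda>b c. tens3 K A B C a b c) t"
  unfolding assoc_l_def by (simp_all add: lin_intros tensor_lift_hom lift_tens)

end

lemma module_hom_id: "id \<in> module_hom K M M"
  unfolding id_def by (rule hom_id)

text \<open>Both composites are linear, so pure tensors suffice. There the associators disappear, since
  each of them meets a pure tensor or the summand of a Sweedler sum.\<close>

lemma cYBE_iff:
  fixes K :: "('k, 'r) ring_scheme" and A :: "('k, 'a, 'm) module_scheme"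
    and B :: "('k, 'b, 'n) module_scheme" and C :: "('k, 'c, 'p) module_scheme"
  assumes modules [simp]: "module K A" "module K B" "module K C"
    and AB: "\<sigma>AB \<in> module_hom K (tensor K A B) (tensor K B A)"
    and AC: "\<sigma>AC \<in> module_hom K (tensor K A C) (tensor K C A)"
    and BC: "\<sigma>BC \<in> module_hom K (tensor K B C) (tensor K C B)"
  shows "cYBE K A B C \<sigma>AB \<sigma>AC \<sigma>BC \<longleftrightarrow>
    (\<forall>a\<in>carrier A. \<forall>b\<in>carrier B. \<forall>c\<in>carrier C.
      sweedler K B A (tensor3 K C B A) (\<sigma>AB (tens K A B a b)) (\<lambda>b' a'.
        sweedler K C A (tensor3 K C B A) (\<sigma>AC (tens K A C a' c)) (\<lambda>c' a''.
          tens K (tensor K C B) A (\<sigma>BC (tens K B C b' c')) a'')) =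
      sweedler K C B (tensor3 K C B A) (\<sigma>BC (tens K B C b c)) (\<lambda>c' b'.
        sweedler K C A (tensor3 K C B A) (\<sigma>AC (tens K A C a c')) (\<lambda>c'' a'.
          sweedler K B A (tensor3 K C B A) (\<sigma>AB (tens K A B a' b')) (\<lambda>b'' a''.
            tens3 K C B A c'' b'' a''))))"
proof -
  note [simp] = lin_closed[OF AB] lin_closed[OF AC] lin_closed[OF BC]
  note homs = lin_comp[OF _ AB] lin_comp[OF _ AC] lin_comp[OF _ BC]
  let ?W = "tensor3 K C B A" and ?T = "tensor3 K A B C"
  define L where "L = tensor_map K (tensor K B C) A (tensor K C B) A \<sigma>BC id \<circ>
       (assoc_l K B C A \<circ>
       (tensor_map K B (tensor K A C) B (tensor K C A) id \<sigma>AC \<circ>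
       (assoc_r K B A C \<circ>
       tensor_map K (tensor K A B) C (tensor K B A) C \<sigma>AB id)))"
  define R where "R = assoc_l K C B A \<circ>
       (tensor_map K C (tensor K A B) C (tensor K B A) id \<sigma>AB \<circ>
       (assoc_r K C A B \<circ>
       (tensor_map K (tensor K A C) B (tensor K C A) B \<sigma>AC id \<circ>
       (assoc_l K A C B \<circ>
       (tensor_map K A (tensor K B C) A (tensor K C B) id \<sigma>BC \<circ>
       assoc_r K A B C)))))"
  have L: "L \<in> module_hom K ?T ?W" and R: "R \<in> module_hom K ?T ?W"
    unfolding L_def R_def
    by (rule lin_compose assoc_r_hom assoc_l_hom tensor_map_hom(1) module_hom_id AB AC BC
        tensor_module modules)+
  have "cYBE K A B C \<sigma>AB \<sigma>AC \<sigma>BC \<longleftrightarrow> (\<forall>x\<in>carrier ?T. L x = R x)"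
    by (simp add: cYBE_def L_def R_def o_assoc)
  also have "\<dots> \<longleftrightarrow> (\<forall>a\<in>carrier A. \<forall>b\<in>carrier B. \<forall>c\<in>carrier C.
      L (tens3 K A B C a b c) = R (tens3 K A B C a b c))"
    using tensor3_hom_eqI[OF modules tensor_module[OF tensor_module[OF modules(3,2)] modules(1)] L
      R]
    by (auto intro!: tens_carrier tensor_module modules)
  finally show ?thesis
  proof (rule trans, intro ball_cong refl arg_cong2[of _ _ _ _ "(=)"])
    fix a b c assume carr [simp]: "a \<in> carrier A" "b \<in> carrier B" "c \<in> carrier C"
    note L = lin_intros homs tensor_map_hom(1) module_hom_id AB AC BC modules assoc_l_hom
      assoc_r_hom
      lin_closed[OF AB] lin_closed[OF AC] lin_closed[OF BC] carr refl
    note h = tensor_map_hom(1)[OF modules(2) tensor_module[OF modules(1,3)] modules(2)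
      tensor_module[OF modules(3,1)] module_hom_id AC]
      assoc_l_hom[OF modules(2,3,1)]
      tensor_map_hom(1)[OF tensor_module[OF modules(2,3)] modules(1) tensor_module[OF
        modules(3,2)] modules(1) BC module_hom_id]
      tensor_map_hom(1)[OF tensor_module[OF modules(1,3)] modules(2) tensor_module[OF
        modules(3,1)] modules(2) AC module_hom_id]
      assoc_r_hom[OF modules(3,1,2)]
      tensor_map_hom(1)[OF modules(3) tensor_module[OF modules(1,2)] modules(3) tensor_module[OF
        modules(2,1)] module_hom_id AB]
      assoc_l_hom[OF modules(3,2,1)]
    let ?s1 = "sweedler K B A (tensor K B (tensor K A C)) (\<sigma>AB (tens K A B a b))
        (\<lambda>b a. tens K B (tensor K A C) b (tens K A C a c))"
    have e1: "assoc_r K B A C (tensor_map K (tensor K A B) C (tensor K B A) C \<sigma>AB id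
        (tens3 K A B C a b c)) = ?s1"
      by (subst tensor_map_hom(2), (rule L|assumption)+, subst id_apply, subst assoc_r_tens, (rule
        L|assumption)+)
    let ?s2 = "sweedler K B A (tensor K B (tensor K C A)) (\<sigma>AB (tens K A B a b))
        (\<lambda>b a. tens K B (tensor K C A) b (\<sigma>AC (tens K A C a c)))"
    have e2: "tensor_map K B (tensor K A C) B (tensor K C A) id \<sigma>AC ?s1 = ?s2"
      by (rule hom_lift_eq[OF h(1)], (rule L|assumption)+, subst tensor_map_hom(2), (rule
        L|assumption)+, subst id_apply, rule refl)
    let ?s3 = "sweedler K B A (tensor3 K B C A) (\<sigma>AB (tens K A B a b))
        (\<lambda>b' a'. sweedler K C A (tensor3 K B C A) (\<sigma>AC (tens K A C a' c)) (\<lambda>c' a''.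
          tens3 K B C A b' c' a''))"
    have e3: "assoc_l K B C A ?s2 = ?s3"
      by (rule hom_lift_eq[OF h(2)], (rule L|assumption)+, subst assoc_l_tens, (rule L|assumption)+)
    let ?s4 = "sweedler K B A ?W (\<sigma>AB (tens K A B a b))
        (\<lambda>b' a'. sweedler K C A ?W (\<sigma>AC (tens K A C a' c)) (\<lambda>c' a''.
          tens K (tensor K C B) A (\<sigma>BC (tens K B C b' c')) a''))"
    have e4: "tensor_map K (tensor K B C) A (tensor K C B) A \<sigma>BC id ?s3 = ?s4"
      by (rule hom_lift_eq[OF h(3)], (rule L|assumption)+, rule hom_lift_eq[OF h(3)], (rule
        L|assumption)+, subst tensor_map_hom(2), (rule L|assumption)+, subst id_apply, rule refl)
    show "L (tens3 K A B C a b c) = ?s4"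
      unfolding L_def o_apply e1 e2 e3 e4 by (rule refl)
    let ?s5 = "sweedler K C B (tensor3 K A C B) (\<sigma>BC (tens K B C b c))
        (\<lambda>c b. tens3 K A C B a c b)"
    have e5: "assoc_l K A C B (tensor_map K A (tensor K B C) A (tensor K C B) id \<sigma>BC
        (assoc_r K A B C (tens3 K A B C a b c))) = ?s5"
      by (subst assoc_r_tens, (rule L|assumption)+, subst lift_tens, (rule L|assumption)+,
          subst tensor_map_hom(2), (rule L|assumption)+, subst id_apply,
          subst assoc_l_tens, (rule L|assumption)+)
    let ?s6 = "sweedler K C B (tensor3 K C A B) (\<sigma>BC (tens K B C b c))
        (\<lambda>c b. tens K (tensor K C A) B (\<sigma>AC (tens K A C a c)) b)"
    have e6: "tensor_map K (tensor K A C) B (tensor K C A) B \<sigma>AC id ?s5 = ?s6"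
      by (rule hom_lift_eq[OF h(4)], (rule L|assumption)+, subst tensor_map_hom(2), (rule
        L|assumption)+, subst id_apply, rule refl)
    let ?s7 = "sweedler K C B (tensor K C (tensor K A B)) (\<sigma>BC (tens K B C b c)) (\<lambda>c' b'.
        sweedler K C A (tensor K C (tensor K A B)) (\<sigma>AC (tens K A C a c')) (\<lambda>c'' a'.
          tens K C (tensor K A B) c'' (tens K A B a' b')))"
    have e7: "assoc_r K C A B ?s6 = ?s7"
      by (rule hom_lift_eq[OF h(5)], (rule L|assumption)+, subst assoc_r_tens, (rule L|assumption)+)
    let ?s8 = "sweedler K C B (tensor K C (tensor K B A)) (\<sigma>BC (tens K B C b c)) (\<lambda>c' b'.
        sweedler K C A (tensor K C (tensor K B A)) (\<sigma>AC (tens K A C a c')) (\<lambda>c'' a'.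
          tens K C (tensor K B A) c'' (\<sigma>AB (tens K A B a' b'))))"
    have e8: "tensor_map K C (tensor K A B) C (tensor K B A) id \<sigma>AB ?s7 = ?s8"
      by (rule hom_lift_eq[OF h(6)], (rule L|assumption)+, rule hom_lift_eq[OF h(6)], (rule
        L|assumption)+, subst tensor_map_hom(2), (rule L|assumption)+, subst id_apply, rule refl)
    let ?s9 = "sweedler K C B ?W (\<sigma>BC (tens K B C b c)) (\<lambda>c' b'.
        sweedler K C A ?W (\<sigma>AC (tens K A C a c')) (\<lambda>c'' a'.
          sweedler K B A ?W (\<sigma>AB (tens K A B a' b')) (\<lambda>b'' a''.
            tens3 K C B A c'' b'' a'')))"
    have e9: "assoc_l K C B A ?s8 = ?s9"
      by (rule hom_lift_eq[OF h(7)], (rule L|assumption)+, rule hom_lift_eq[OF h(7)], (rule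
        L|assumption)+, subst assoc_l_tens, (rule L|assumption)+)
    show "R (tens3 K A B C a b c) = ?s9"
      unfolding R_def o_apply e5 e6 e7 e8 e9 by (rule refl)
  qed
qed

section \<open>The dual of a finite-dimensional space\<close>

text \<open>Evaluation is named so that it is a bilinear operation like the others, with linearity rules
  of its own.\<close>

definition ev :: "('h \<Rightarrow> 'k) \<Rightarrow> 'h \<Rightarrow> 'k" where
  "ev l h = l h"

lemma hom_mult_right:
  "cring K \<Longrightarrow> c \<in> carrier K \<Longrightarrow> f \<in> module_hom K X (ground K) \<Longrightarrow>
    (\<lambda>x. c \<otimes>\<^bsub>K\<^esub> f x) \<in> module_hom K X (ground K)"
  using hom_smult_right[OF ground_module] by simp

lemma hom_mult_left:
  "cring K \<Longrightarrow> c \<in> carrier K \<Longrightarrow> f \<in> module_hom K X (ground K) \<Longrightarrow>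
    (\<lambda>x. f x \<otimes>\<^bsub>K\<^esub> c) \<in> module_hom K X (ground K)"
  using hom_smult_left[OF ground_module] by simp

lemma hom_finsum:
  assumes "module K M" "module K W" "g \<in> module_hom K M W" "finite I" "f \<in> I \<rightarrow> carrier M"
  shows "g (\<Oplus>\<^bsub>M\<^esub>i\<in>I. f i) = (\<Oplus>\<^bsub>W\<^esub>i\<in>I. g (f i))"
proof -
  interpret M: module K M by fact
  interpret W: module K W by fact
  note gc = lin_closed[OF assms(3)]
  from assms(4,5) show ?thesis
  proof (induction I rule: finite_induct)
    case empty
    show ?case using module_hom_zero[OF assms(1-3)] by simp
  next
    case (insert i I)
    then have *: "f \<in> I \<rightarrow> carrier M" "f i \<in> carrier M" "(\<lambda>i. g (f i)) \<in> I \<rightarrow> carrier W" "g (f i) \<in>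
      carrier W"
      using gc by auto
    have "g (\<Oplus>\<^bsub>M\<^esub>i\<in>insert i I. f i) = g (f i \<oplus>\<^bsub>M\<^esub> (\<Oplus>\<^bsub>M\<^esub>i\<in>I. f i))"
      using insert.hyps * by (simp add: M.M.finsum_insert)
    also have "\<dots> = g (f i) \<oplus>\<^bsub>W\<^esub> (\<Oplus>\<^bsub>W\<^esub>i\<in>I. g (f i))"
      using * insert.IH by (simp add: module_hom_add[OF assms(3)] M.M.finsum_closed)
    also have "\<dots> = (\<Oplus>\<^bsub>W\<^esub>i\<in>insert i I. g (f i))"
      using insert.hyps * by (simp add: W.M.finsum_insert)
    finally show ?case .
  qed
qed

context module
begin

lemma dual_simps:
  "carrier (dual R M) = module_hom R M (ground R) \<inter> extensional (carrier M)"
  "f \<oplus>\<^bsub>dual R M\<^esub> g = (\<lambda>h\<in>carrier M. f h \<oplus>\<^bsub>R\<^esub> g h)"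
  "c \<odot>\<^bsub>dual R M\<^esub> f = (\<lambda>h\<in>carrier M. c \<otimes>\<^bsub>R\<^esub> f h)"
  by (simp_all add: dual_def R.func_space_def)

lemma dual_module: "module R (dual R M)"
proof -
  interpret F: module R "R.func_space (carrier M)" by (rule R.func_space_is_module)
  interpret G: module R "ground R" by (rule ground_module) (rule R.cring_axioms)
  have "submodule R (module_hom R M (ground R) \<inter> extensional (carrier M)) (R.func_space (carrier
    M))"
  proof (rule submodule.intro)
    show "module R (R.func_space (carrier M))" by (rule F.module_axioms)
    show "module_hom R M (ground R) \<inter> extensional (carrier M) \<subseteq> carrier (R.func_space (carrier M))"
      by (auto simp: R.func_space_def PiE_def module_hom_def)
    have "(\<lambda>x. \<zero>\<^bsub>R\<^esub>) \<in> module_hom R M (ground R)" by (auto simp: module_hom_def)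
    then show "\<zero>\<^bsub>R.func_space (carrier M)\<^esub> \<in> module_hom R M (ground R) \<inter> extensional (carrier M)"
      by (auto simp: R.func_space_def intro: module_hom_cong[OF _ module_axioms])
  next
    fix v w assume v: "v \<in> module_hom R M (ground R) \<inter> extensional (carrier M)"
      and w: "w \<in> module_hom R M (ground R) \<inter> extensional (carrier M)"
    have "(\<lambda>x. v x \<oplus>\<^bsub>ground R\<^esub> w x) \<in> module_hom R M (ground R)"
      using v w by (intro hom_sum[OF G.module_axioms]) auto
    then show "v \<oplus>\<^bsub>R.func_space (carrier M)\<^esub> w \<in> module_hom R M (ground R) \<inter> extensional (carrier
      M)"
      by (auto simp: R.func_space_def intro: module_hom_cong[OF _ module_axioms])
  next
    fix c v assume c: "c \<in> carrier R" and v: "v \<in> module_hom R M (ground R) \<inter> extensional (carrier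
      M)"
    have "(\<lambda>x. c \<odot>\<^bsub>ground R\<^esub> v x) \<in> module_hom R M (ground R)"
      using c v by (intro hom_smult_right[OF G.module_axioms]) auto
    then show "c \<odot>\<^bsub>R.func_space (carrier M)\<^esub> v \<in> module_hom R M (ground R) \<inter> extensional (carrier
      M)"
      by (auto simp: R.func_space_def intro: module_hom_cong[OF _ module_axioms])
  qed
  from F.submodule_is_module[OF this] show ?thesis by (simp add: dual_def)
qed

lemma dual_eqI:
  assumes "l \<in> carrier (dual R M)" "m \<in> carrier (dual R M)"
    and "\<And>h. h \<in> carrier M \<Longrightarrow> ev l h = ev m h"
  shows "l = m"
  using assms by (auto simp: dual_simps ev_def intro: extensionalityI)

lemma ev_closed: "l \<in> carrier (dual R M) \<Longrightarrow> h \<in> carrier M \<Longrightarrow> ev l h \<in> carrier R"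
  by (auto simp: dual_simps ev_def module_hom_def)

lemma hom_ev_right:
  assumes "l \<in> carrier (dual R M)" "f \<in> module_hom R X M"
  shows "(\<lambda>x. ev l (f x)) \<in> module_hom R X (ground R)"
  using assms unfolding ev_def by (auto simp: dual_simps intro: lin_comp)

lemma hom_ev_left:
  assumes "h \<in> carrier M" "f \<in> module_hom R X (dual R M)"
  shows "(\<lambda>x. ev (f x) h) \<in> module_hom R X (ground R)"
proof -
  have "(\<lambda>l. ev l h) \<in> module_hom R (dual R M) (ground R)"
    using assms(1) by (intro module_homI) (auto simp: ev_closed, auto simp: dual_simps ev_def)
  from lin_comp[OF assms(2) this] show ?thesis .
qed

lemma restrict_dual:
  assumes "f \<in> module_hom R M (ground R)"
  shows "restrict f (carrier M) \<in> carrier (dual R M)"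
  using assms by (auto simp: dual_simps intro: module_hom_cong[OF _ module_axioms])

end

text \<open>The canonical element is the sum of \<open>e\<^sub>i\<^sup>* \<otimes> e\<^sub>i\<close> over a basis; it corresponds to the
  identity map.\<close>

definition canonical_element :: "('k, 'r) ring_scheme \<Rightarrow> ('k, 'h, 'z) module_scheme \<Rightarrow>
    ('k, 'h \<Rightarrow> 'k, 'h) tensor \<Rightarrow> bool"
  where "canonical_element K H c \<longleftrightarrow> c \<in> carrier (tensor K (dual K H) H) \<and>
    (\<forall>h\<in>carrier H. sweedler K (dual K H) H H c (\<lambda>l x. ev l h \<odot>\<^bsub>H\<^esub> x) = h)"

text \<open>The coordinates with respect to a finite basis are linear by uniqueness, and the defining
  identity of the canonical element is the expansion in that basis.\<close>

lemma (in vectorspace) canonical_element_exists: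
  assumes "fin_dim"
  obtains c where "canonical_element K V c"
proof -
  interpret D: module K "dual K V" by (rule dual_module)
  have T: "module K (tensor K (dual K V) V)" by (rule tensor_module[OF D.module_axioms
    module_axioms])
  interpret T: module K "tensor K (dual K V) V" by (rule T)
  obtain E where E: "finite E" "basis E" using finite_basis_exists[OF assms] by blast
  then have EV: "E \<subseteq> carrier V" by (simp add: basis_def)
  have uniq: "\<exists>!a. a \<in> E \<rightarrow>\<^sub>E carrier K \<and> lincomb a E = v" if "v \<in> carrier V" for v
    using basis_criterion[OF E(1) EV] E(2) that by simp
  define co where "co v = (THE a. a \<in> E \<rightarrow>\<^sub>E carrier K \<and> lincomb a E = v)" for v
  have co: "co v \<in> E \<rightarrow>\<^sub>E carrier K" "lincomb (co v) E = v" if "v \<in> carrier V" for v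
    using theI'[OF uniq[OF that]] unfolding co_def by auto
  have co_eq: "a e = co v e" if "a \<in> E \<rightarrow> carrier K" "lincomb a E = v" "e \<in> E" for a v e
  proof -
    have v: "v \<in> carrier V" using that EV by auto
    have "lincomb (restrict a E) E = v"
      using that EV by (subst lincomb_cong[of E E "restrict a E" a]) auto
    then have "restrict a E = co v"
      using uniq[OF v] co[OF v] that by (metis restrict_PiE)
    then show ?thesis using that by (metis restrict_apply')
  qed
  have coK: "co v e \<in> carrier K" if "v \<in> carrier V" "e \<in> E" for v e
    using co(1)[OF that(1)] that(2) by (rule PiE_mem)
  have coPi: "co v \<in> E \<rightarrow> carrier K" if "v \<in> carrier V" for v using coK that by auto
  define d where "d e = (\<lambda>v\<in>carrier V. co v e)" for e
  have d: "d e \<in> carrier (dual K V)" if e: "e \<in> E" for e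
    unfolding d_def
  proof (intro restrict_dual module_homI)
    fix v w assume vw: "v \<in> carrier V" "w \<in> carrier V"
    have "lincomb (\<lambda>e. co v e \<oplus>\<^bsub>K\<^esub> co w e) E = v \<oplus>\<^bsub>V\<^esub> w"
      using lincomb_sum[OF E(1) EV coPi coPi] co vw by simp
    then show "co (v \<oplus>\<^bsub>V\<^esub> w) e = co v e \<oplus>\<^bsub>ground K\<^esub> co w e"
      using vw coK e co_eq[of "\<lambda>e. co v e \<oplus>\<^bsub>K\<^esub> co w e" "v \<oplus>\<^bsub>V\<^esub> w" e] by simp
  next
    fix c v assume cv: "c \<in> carrier K" "v \<in> carrier V"
    have "lincomb (\<lambda>e. c \<otimes>\<^bsub>K\<^esub> co v e) E = c \<odot>\<^bsub>V\<^esub> v"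
      using lincomb_smult[OF EV coPi] co cv by simp
    then show "co (c \<odot>\<^bsub>V\<^esub> v) e = c \<odot>\<^bsub>ground K\<^esub> co v e"
      using cv coK e co_eq[of "\<lambda>e. c \<otimes>\<^bsub>K\<^esub> co v e" "c \<odot>\<^bsub>V\<^esub> v" e] by simp
  qed (use coK e in auto)
  define t where "t e = tens K (dual K V) V (d e) e" for e
  have t: "t \<in> E \<rightarrow> carrier (tensor K (dual K V) V)"
    using d EV by (auto simp: t_def intro!: tens_carrier D.module_axioms module_axioms)
  have "sweedler K (dual K V) V V (\<Oplus>\<^bsub>tensor K (dual K V) V\<^esub>e\<in>E. t e) (\<lambda>l x. ev l h \<odot>\<^bsub>V\<^esub> x) = h"
    if h: "h \<in> carrier V" for h
  proof -
    have b: "bilinear K (dual K V) V V (\<lambda>l x. ev l h \<odot>\<^bsub>V\<^esub> x)"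
      using h by (intro bilinearI hom_smult_right hom_smult_left hom_ev_left hom_id module_axioms
        ev_closed)
    have "sweedler K (dual K V) V V (\<Oplus>\<^bsub>tensor K (dual K V) V\<^esub>e\<in>E. t e) (\<lambda>l x. ev l h \<odot>\<^bsub>V\<^esub> x) =
      (\<Oplus>\<^bsub>V\<^esub>e\<in>E. sweedler K (dual K V) V V (t e) (\<lambda>l x. ev l h \<odot>\<^bsub>V\<^esub> x))"
      by (rule hom_finsum[OF T module_axioms tensor_lift_hom[OF D.module_axioms module_axioms
        module_axioms b]
            E(1) t])
    also have "\<dots> = (\<Oplus>\<^bsub>V\<^esub>e\<in>E. co h e \<odot>\<^bsub>V\<^esub> e)"
    proof (rule M.finsum_cong')
      show "(\<lambda>e. co h e \<odot>\<^bsub>V\<^esub> e) \<in> E \<rightarrow> carrier V" using coK[OF h] EV by auto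
      fix e assume e: "e \<in> E"
      then have eV: "e \<in> carrier V" using EV by auto
      show "sweedler K (dual K V) V V (t e) (\<lambda>l x. ev l h \<odot>\<^bsub>V\<^esub> x) = co h e \<odot>\<^bsub>V\<^esub> e"
        unfolding t_def lift_tens[OF D.module_axioms module_axioms module_axioms b d[OF e] eV]
        using h by (simp add: ev_def d_def)
    qed simp
    also have "\<dots> = h" using co(2)[OF h] by (simp add: lincomb_def)
    finally show ?thesis .
  qed
  moreover have "(\<Oplus>\<^bsub>tensor K (dual K V) V\<^esub>e\<in>E. t e) \<in> carrier (tensor K (dual K V) V)"
    using t by (rule T.M.finsum_closed)
  ultimately show ?thesis using that unfolding canonical_element_def by blast
qed

section \<open>Finite-dimensional bialgebras in Sweedler notation\<close>

lemma tens_smult_left: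
  "module K A \<Longrightarrow> module K B \<Longrightarrow> k \<in> carrier K \<Longrightarrow> a \<in> carrier A \<Longrightarrow> b \<in> carrier B \<Longrightarrow>
    tens K A B (k \<odot>\<^bsub>A\<^esub> a) b = k \<odot>\<^bsub>tensor K A B\<^esub> tens K A B a b"
  by (rule module_hom_smult[OF bilinear_homs(2)[OF tens_bilinear]])

lemma tens_smult_right:
  "module K A \<Longrightarrow> module K B \<Longrightarrow> k \<in> carrier K \<Longrightarrow> a \<in> carrier A \<Longrightarrow> b \<in> carrier B \<Longrightarrow>
    tens K A B a (k \<odot>\<^bsub>B\<^esub> b) = k \<odot>\<^bsub>tensor K A B\<^esub> tens K A B a b"
  by (rule module_hom_smult[OF bilinear_homs(1)[OF tens_bilinear]])

lemma assoc_l_assoc_r: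
  assumes "module K A" "module K B" "module K C" and x: "x \<in> carrier (tensor3 K A B C)"
  shows "assoc_l K A B C (assoc_r K A B C x) = x"
proof (rule tensor3_hom_eqI[OF assms(1-3) _ _ hom_id _ x])
  note L = lin_intros assms(1-3) assoc_l_hom assoc_r_hom
  show "module K (tensor3 K A B C)" by (rule L)+
  show "(\<lambda>x. assoc_l K A B C (assoc_r K A B C x)) \<in>
      module_hom K (tensor3 K A B C) (tensor3 K A B C)"
    by (rule lin_comp, (rule L)+)
  fix a b c assume abc: "a \<in> carrier A" "b \<in> carrier B" "c \<in> carrier C"
  note L = L abc
  show "assoc_l K A B C (assoc_r K A B C (tens3 K A B C a b c)) =
      tens3 K A B C a b c"
    by (subst assoc_r_tens, (rule L|assumption)+, subst lift_tens, (rule L|assumption)+,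
        subst assoc_l_tens, (rule L|assumption)+, subst lift_tens, (rule L refl | assumption)+)
qed

lemma (in module) hom_dualI:
  assumes "\<And>x. x \<in> carrier X \<Longrightarrow> g x \<in> carrier (dual R M)" "module R X"
    and "\<And>h. h \<in> carrier M \<Longrightarrow> (\<lambda>x. ev (g x) h) \<in> module_hom R X (ground R)"
  shows "g \<in> module_hom R X (dual R M)"
proof (rule module_homI)
  interpret X: module R X by fact
  interpret D: module R "dual R M" by (rule dual_module)
  note hom = assms(3) and ev = hom_ev_left[OF _ hom_id]
  show "g x \<in> carrier (dual R M)" if "x \<in> carrier X" for x using that by (rule assms(1))
  show "g (x \<oplus>\<^bsub>X\<^esub> y) = g x \<oplus>\<^bsub>dual R M\<^esub> g y" if "x \<in> carrier X" "y \<in> carrier X" for x y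
    using that by (intro dual_eqI) (simp_all add: assms(1) module_hom_add[OF hom]
      module_hom_add[OF ev])
  show "g (c \<odot>\<^bsub>X\<^esub> x) = c \<odot>\<^bsub>dual R M\<^esub> g x" if "c \<in> carrier R" "x \<in> carrier X" for c x
    using that by (intro dual_eqI) (simp_all add: assms(1) module_hom_smult[OF hom]
      module_hom_smult[OF ev])
qed

context bialgebra
begin

abbreviation D where "D \<equiv> dual K H"
abbreviation prod_H (infixl "\<cdot>" 70) where "x \<cdot> y \<equiv> mult_map H (tens K H H x y)"
abbreviation sw where "sw A B W t F \<equiv> sweedler K A B W t F"
abbreviation delta_sum where "delta_sum W h F \<equiv> sw H H W (comult H h) F"
abbreviation unit_H ("1\<^sub>H") where "1\<^sub>H \<equiv> unit_map H \<one>\<^bsub>K\<^esub>"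

text \<open>For a comultiplication of the dual this functional is \<open>l\<^sub>(\<^sub>1\<^sub>)(x) l\<^sub>(\<^sub>2\<^sub>)\<close> in the rainbow
  convention, the only form in which that comultiplication enters the braidings.\<close>

definition translate :: "('h \<Rightarrow> 'k) \<Rightarrow> 'h \<Rightarrow> 'h \<Rightarrow> 'k" where
  "translate l x = (\<lambda>h\<in>carrier H. ev l (h \<cdot> x))"

lemma ground_K: "module K (ground K)"
  by (rule ground_module) (rule cring_axioms)

lemma unit_closed: "1\<^sub>H \<in> carrier H"
  using lin_closed[OF unit_hom] by simp

lemma counit_closed: "h \<in> carrier H \<Longrightarrow> counit H h \<in> carrier K"
  using lin_closed[OF counit_hom] by simp

lemma carrier_groundI: "k \<in> carrier K \<Longrightarrow> k \<in> carrier (ground K)"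
  by simp

lemma ev_translate: "h \<in> carrier H \<Longrightarrow> ev (translate l x) h = ev l (h \<cdot> x)"
  by (simp add: translate_def ev_def)

lemmas bialgebra_intros =
  lin_intros module_axioms dual_module ground_K cring_axioms unit_closed counit_closed
  hom_mult_left hom_mult_right hom_ev_left hom_ev_right ev_closed m_closed carrier_groundI
  lin_comp[OF _ mult_hom] lin_comp[OF _ comult_hom] lin_comp[OF _ counit_hom]
  lin_closed[OF mult_hom] lin_closed[OF comult_hom]

lemma translate_closed: "l \<in> carrier D \<Longrightarrow> x \<in> carrier H \<Longrightarrow> translate l x \<in> carrier D"
  unfolding translate_def by (rule restrict_dual) (rule bialgebra_intros | assumption)+

lemma hom_translate_left:
  assumes "module K X" "f \<in> module_hom K X D" "x \<in> carrier H"
  shows "(\<lambda>y. translate (f y) x) \<in> module_hom K X D"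
proof (rule hom_dualI[OF _ assms(1)])
  show "translate (f y) x \<in> carrier D" if "y \<in> carrier X" for y
    using assms lin_closed[OF assms(2) that] by (intro translate_closed)
  show "(\<lambda>y. ev (translate (f y) x) h) \<in> module_hom K X (ground K)" if "h \<in> carrier H" for h
    unfolding ev_translate[OF that] by (rule bialgebra_intros assms that)+
qed

lemma hom_translate_right:
  assumes "module K X" "l \<in> carrier D" "f \<in> module_hom K X H"
  shows "(\<lambda>y. translate l (f y)) \<in> module_hom K X D"
proof (rule hom_dualI[OF _ assms(1)])
  show "translate l (f y) \<in> carrier D" if "y \<in> carrier X" for y
    using assms lin_closed[OF assms(3) that] by (intro translate_closed)
  show "(\<lambda>y. ev (translate l (f y)) h) \<in> module_hom K X (ground K)" if "h \<in> carrier H" for h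
    unfolding ev_translate[OF that] by (rule bialgebra_intros assms that)+
qed

lemma translate_translate:
  assumes "l \<in> carrier D" "x \<in> carrier H" "y \<in> carrier H"
  shows "translate (translate l x) y = translate l (y \<cdot> x)"
proof (rule dual_eqI)
  note L = bialgebra_intros translate_closed assms
  show "translate (translate l x) y \<in> carrier D" "translate l (y \<cdot> x) \<in> carrier D" by (rule L)+
  fix h assume h: "h \<in> carrier H"
  have "h \<cdot> y \<in> carrier H" by (rule L h)+
  then show "ev (translate (translate l x) y) h = ev (translate l (y \<cdot> x)) h"
    using h assms by (simp add: ev_translate mult_assoc)
qed

lemma ev_translate_unit:
  "x \<in> carrier H \<Longrightarrow> ev (translate l x) 1\<^sub>H = ev l x"
  by (simp add: ev_translate unit_closed unit_l)

lemma dual_mult: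
  shows dual_mult_closed: "l \<in> carrier D \<Longrightarrow> m \<in> carrier D \<Longrightarrow>
      dual_mult K H (tens K D D l m) \<in> carrier D"
    and ev_dual_mult: "l \<in> carrier D \<Longrightarrow> m \<in> carrier D \<Longrightarrow> h \<in> carrier H \<Longrightarrow> ev (dual_mult K H (tens K D
      D l m)) h =
      delta_sum (ground K) h (\<lambda>h1 h2. ev l h2 \<otimes>\<^bsub>K\<^esub> ev m h1)"
    and dual_mult_hom: "dual_mult K H \<in> module_hom K (tensor K D D) D"
proof -
  define G where "G l m = (\<lambda>h\<in>carrier H. delta_sum (ground K) h
    (\<lambda>h1 h2. ev l h2 \<otimes>\<^bsub>K\<^esub> ev m h1))" for l m :: "'h \<Rightarrow> 'k"
  note L = bialgebra_intros
  have G: "G l m \<in> carrier D" if "l \<in> carrier D" "m \<in> carrier D" for l m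
    unfolding G_def by (rule restrict_dual) (rule L that | assumption)+
  have ev_G: "ev (G l m) h = delta_sum (ground K) h (\<lambda>h1 h2. ev l h2 \<otimes>\<^bsub>K\<^esub> ev m h1)"
    if "h \<in> carrier H" for l m h
    using that by (simp add: G_def ev_def)
  have b: "bilinear K D D D G"
  proof (rule bilinearI; rule hom_dualI[OF _ dual_module])
    show "(\<lambda>m. ev (G l m) h) \<in> module_hom K D (ground K)" if "l \<in> carrier D" "h \<in> carrier H" for l h
      unfolding ev_G[OF that(2)] by (rule L that | assumption)+
    show "(\<lambda>l. ev (G l m) h) \<in> module_hom K D (ground K)" if "m \<in> carrier D" "h \<in> carrier H" for m h
      unfolding ev_G[OF that(2)] by (rule L that | assumption)+
  qed (use G in auto)
  have eq: "dual_mult K H = tensor_lift K D D D G"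
    by (simp add: dual_mult_def G_def[abs_def] ev_def)
  show "dual_mult K H \<in> module_hom K (tensor K D D) D"
    unfolding eq by (rule tensor_lift_hom[OF dual_module dual_module dual_module b])
  have eq': "dual_mult K H (tens K D D l m) = G l m" if "l \<in> carrier D" "m \<in> carrier D" for l m
    unfolding eq by (rule lift_tens[OF dual_module dual_module dual_module b that])
  show "dual_mult K H (tens K D D l m) \<in> carrier D" if "l \<in> carrier D" "m \<in> carrier D"
    unfolding eq'[OF that] using that by (rule G)
  show "ev (dual_mult K H (tens K D D l m)) h =
      delta_sum (ground K) h (\<lambda>h1 h2. ev l h2 \<otimes>\<^bsub>K\<^esub> ev m h1)"
    if "l \<in> carrier D" "m \<in> carrier D" "h \<in> carrier H"
    unfolding eq'[OF that(1,2)] using that(3) by (rule ev_G)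
qed

text \<open>Both bracketings are brought to the left, so that a map out of \<open>(H \<otimes> H) \<otimes> H\<close> can be applied
  to the law.\<close>

lemma coassoc_left:
  assumes "h \<in> carrier H"
  shows "delta_sum (tensor3 K H H H) h (\<lambda>h1 h2.
      tens K (tensor K H H) H (comult H h1) h2) =
    delta_sum (tensor3 K H H H) h (\<lambda>h1 h2.
      delta_sum (tensor3 K H H H) h2 (\<lambda>a b.
        tens3 K H H H h1 a b))"
    (is "?P = ?Q")
proof -
  note L = bialgebra_intros assms
  have P: "?P \<in> carrier (tensor3 K H H H)" by (rule L|assumption)+
  have "assoc_r K H H H ?P =
      tensor_map K H H H (tensor K H H) id (comult H) (comult H h)"
    using coassoc[OF assms] by (simp only: tensor_map_def id_apply)
  also have "\<dots> = delta_sum (tensor K H (tensor K H H)) h (\<lambda>h1 h2.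
      tens K H (tensor K H H) h1 (comult H h2))"
    by (simp only: tensor_map_def id_apply)
  finally have "assoc_l K H H H (assoc_r K H H H ?P) =
      assoc_l K H H H (delta_sum (tensor K H (tensor K H H)) h (\<lambda>h1 h2.
      tens K H (tensor K H H) h1 (comult H h2)))"
    by (rule arg_cong)
  also have "\<dots> = ?Q"
    by (rule hom_lift_eq[OF assoc_l_hom], (rule L|assumption)+, rule assoc_l_tens, (rule
      L|assumption)+)
  finally show ?thesis
    by (simp only: assoc_l_assoc_r[OF module_axioms module_axioms module_axioms P])
qed

text \<open>A trilinear expression is a linear map out of \<open>(H \<otimes> H) \<otimes> H\<close>, applied here to the previous
  identity.\<close>

lemma sweedler_coassoc:
  assumes W: "module K W" and h: "h \<in> carrier H"
    and 1: "\<And>b c. b \<in> carrier H \<Longrightarrow> c \<in> carrier H \<Longrightarrow> (\<lambda>a. F a b c) \<in> module_hom K H W"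
    and 2: "\<And>a c. a \<in> carrier H \<Longrightarrow> c \<in> carrier H \<Longrightarrow> (\<lambda>b. F a b c) \<in> module_hom K H W"
    and 3: "\<And>a b. a \<in> carrier H \<Longrightarrow> b \<in> carrier H \<Longrightarrow> (\<lambda>c. F a b c) \<in> module_hom K H W"
  shows "delta_sum W h (\<lambda>h1 h2. delta_sum W h1 (\<lambda>a b. F a b h2)) =
    delta_sum W h (\<lambda>h1 h2. delta_sum W h2 (\<lambda>a b. F h1 a b))"
proof -
  note L = bialgebra_intros W h 1 2 3
  define G where "G = (\<lambda>t. sw (tensor K H H) H W t (\<lambda>s c. sw H H W s (\<lambda>a b. F a b c)))"
  have b: "bilinear K (tensor K H H) H W (\<lambda>s c. sw H H W s (\<lambda>a b. F a b c))"
    by (rule L|assumption)+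
  have G: "G \<in> module_hom K (tensor3 K H H H) W"
    unfolding G_def by (rule tensor_lift_hom, (rule L b)+)
  have G_tens: "G (tens K (tensor K H H) H s c) = sw H H W s (\<lambda>a b. F a b c)"
    if "s \<in> carrier (tensor K H H)" "c \<in> carrier H" for s c
    unfolding G_def by (rule lift_tens[OF _ _ _ b], (rule L that)+)
  have "delta_sum W h (\<lambda>h1 h2. delta_sum W h1 (\<lambda>a b. F a b h2)) =
    G (delta_sum (tensor3 K H H H) h (\<lambda>h1 h2.
      tens K (tensor K H H) H (comult H h1) h2))"
    by (rule sym, rule hom_lift_eq[OF G], (rule L|assumption)+, rule G_tens, (rule L|assumption)+)
  also have "\<dots> = G (delta_sum (tensor3 K H H H) h (\<lambda>h1 h2.
      delta_sum (tensor3 K H H H) h2 (\<lambda>a b.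
        tens3 K H H H h1 a b)))"
    by (simp only: coassoc_left[OF h])
  also have "\<dots> = delta_sum W h (\<lambda>h1 h2. delta_sum W h2 (\<lambda>a b. F h1 a b))"
    by (rule hom_lift_eq[OF G], (rule L|assumption)+, rule hom_lift_eq[OF G], (rule L|assumption)+,
        subst G_tens, (rule L|assumption)+, rule lift_tens, (rule L|assumption)+)
  finally show ?thesis .
qed

lemma sweedler_counit_left:
  assumes "module K W" "h \<in> carrier H" "g \<in> module_hom K H W"
  shows "delta_sum W h (\<lambda>h1 h2. counit H h1 \<odot>\<^bsub>W\<^esub> g h2) = g h"
proof -
  note L = bialgebra_intros assms counit_hom
  have "g (delta_sum H h (\<lambda>h1 h2. counit H h1 \<odot>\<^bsub>H\<^esub> h2)) =
    delta_sum W h (\<lambda>h1 h2. counit H h1 \<odot>\<^bsub>W\<^esub> g h2)"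
    by (rule hom_lift_eq[OF assms(3)], (rule L|assumption)+, rule module_hom_smult[OF assms(3)],
        (rule L|assumption)+)
  then show ?thesis by (simp only: counit_l[OF assms(2)])
qed

lemma sweedler_counit_right:
  assumes "module K W" "h \<in> carrier H" "g \<in> module_hom K H W"
  shows "delta_sum W h (\<lambda>h1 h2. counit H h2 \<odot>\<^bsub>W\<^esub> g h1) = g h"
proof -
  note L = bialgebra_intros assms counit_hom
  have "g (delta_sum H h (\<lambda>h1 h2. counit H h2 \<odot>\<^bsub>H\<^esub> h1)) =
    delta_sum W h (\<lambda>h1 h2. counit H h2 \<odot>\<^bsub>W\<^esub> g h1)"
    by (rule hom_lift_eq[OF assms(3)], (rule L|assumption)+, rule module_hom_smult[OF assms(3)],
        (rule L|assumption)+)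
  then show ?thesis by (simp only: counit_r[OF assms(2)])
qed

lemma sweedler_mult:
  assumes W: "module K W" and g: "bilinear K H H W g" and xy: "x \<in> carrier H" "y \<in> carrier H"
  shows "delta_sum W (x \<cdot> y) g =
    delta_sum W x (\<lambda>x1 x2. delta_sum W y (\<lambda>y1 y2.
      g (x1 \<cdot> y1) (x2 \<cdot> y2)))"
proof -
  note L = bialgebra_intros W xy
  have hom: "(\<lambda>t. sw H H W t g) \<in> module_hom K (tensor K H H) W"
    by (rule tensor_lift_hom[OF module_axioms module_axioms W g])
  show ?thesis
    unfolding comult_mult[OF xy]
    by (rule hom_lift_eq[OF hom], (rule L|assumption)+, rule hom_lift_eq[OF hom], (rule
      L|assumption)+,
        rule lift_tens[OF module_axioms module_axioms W g], (rule L|assumption)+)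
qed

end

section \<open>Braidings with the dual\<close>

text \<open>A canonical element exists exactly in finite dimension; having it as a parameter lets every
  use of a basis be a Sweedler sum over it.\<close>

locale finite_bialgebra = bialgebra K H
  for K :: "('k, 'r) ring_scheme" and H :: "('k, 'h, 'z) bialgebra_scheme" +
  fixes c :: "('k, 'h \<Rightarrow> 'k, 'h) tensor"
  assumes canonical: "canonical_element K H c"
begin

lemma c: "c \<in> carrier (tensor K D H)"
  and c_sweedler: "h \<in> carrier H \<Longrightarrow> sw D H H c (\<lambda>l x. ev l h \<odot>\<^bsub>H\<^esub> x) = h"
  using canonical by (auto simp: canonical_element_def)

lemmas dual_intros = bialgebra_intros c translate_closed hom_translate_left hom_translate_right

text \<open>On a pure tensor \<open>x \<otimes> h\<close> this is the expansion of \<open>h\<close> in a basis.\<close>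

lemma expand_right:
  assumes X: "module K X" and t: "t \<in> carrier (tensor K X H)"
  shows "t = sw D H (tensor K X H) c (\<lambda>l e.
    tens K X H (sw X H X t (\<lambda>x h. ev l h \<odot>\<^bsub>X\<^esub> x)) e)"
proof (rule tensor_hom_eqI[OF X module_axioms tensor_module[OF X module_axioms] hom_id _ _ t])
  note L = dual_intros X
  show "(\<lambda>t. sw D H (tensor K X H) c (\<lambda>l e. tens K X H (sw X H X t (\<lambda>x h. ev l h \<odot>\<^bsub>X\<^esub> x)) e))
      \<in> module_hom K (tensor K X H) (tensor K X H)"
    by (rule L|assumption)+
  fix x h assume xh: "x \<in> carrier X" "h \<in> carrier H"
  note L = L xh
  have g: "(\<lambda>e. tens K X H x e) \<in> module_hom K H (tensor K X H)" by (rule L)+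
  have "tens K X H x h = tens K X H x (sw D H H c (\<lambda>l e. ev l h \<odot>\<^bsub>H\<^esub> e))"
    by (simp only: c_sweedler[OF xh(2)])
  also have "\<dots> = sw D H (tensor K X H) c (\<lambda>l e. tens K X H (ev l h \<odot>\<^bsub>X\<^esub> x) e)"
    by (rule hom_lift_eq[OF g], (rule L|assumption)+, subst tens_smult_left, (rule L|assumption)+,
        rule tens_smult_right, (rule L|assumption)+)
  also have "\<dots> = sw D H (tensor K X H) c (\<lambda>l e.
      tens K X H (sw X H X (tens K X H x h) (\<lambda>x h. ev l h \<odot>\<^bsub>X\<^esub> x)) e)"
    by (rule lift_cong, subst lift_tens, (rule L refl | assumption)+)
  finally show "tens K X H x h = sw D H (tensor K X H) c (\<lambda>l e.
      tens K X H (sw X H X (tens K X H x h) (\<lambda>x h. ev l h \<odot>\<^bsub>X\<^esub> x)) e)" .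
qed

lemma functionals_separate:
  assumes X: "module K X" and t: "t \<in> carrier (tensor K X H)" and s: "s \<in> carrier (tensor K X H)"
    and eq: "\<And>l. l \<in> carrier D \<Longrightarrow>
      sw X H X t (\<lambda>x h. ev l h \<odot>\<^bsub>X\<^esub> x) = sw X H X s (\<lambda>x h. ev l h \<odot>\<^bsub>X\<^esub> x)"
  shows "t = s"
  by (subst expand_right[OF X t], subst expand_right[OF X s],
      rule lift_cong) (simp only: eq)

lemma c_sweedler_dual:
  assumes p: "p \<in> carrier D"
  shows "sw D H D c (\<lambda>m e. ev p e \<odot>\<^bsub>D\<^esub> m) = p"
proof (rule dual_eqI[OF _ p])
  note L = dual_intros p
  show "sw D H D c (\<lambda>m e. ev p e \<odot>\<^bsub>D\<^esub> m) \<in> carrier D" by (rule L|assumption)+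
  fix h assume h: "h \<in> carrier H"
  note L = L h
  have g1: "(\<lambda>m. ev m h) \<in> module_hom K D (ground K)" by (rule L)+
  have g2: "(\<lambda>e. ev p e) \<in> module_hom K H (ground K)" by (rule L)+
  have "ev (sw D H D c (\<lambda>m e. ev p e \<odot>\<^bsub>D\<^esub> m)) h =
      sw D H (ground K) c (\<lambda>m e. ev p e \<otimes>\<^bsub>K\<^esub> ev m h)"
    by (rule hom_lift_eq[OF g1], (rule L|assumption)+, subst module_hom_smult[OF g1],
        (rule L|assumption)+, simp only: ground_simps)
  also have "\<dots> = ev p (sw D H H c (\<lambda>m e. ev m h \<odot>\<^bsub>H\<^esub> e))"
    by (rule sym, rule hom_lift_eq[OF g2], (rule L|assumption)+, subst module_hom_smult[OF g2],
        (rule L|assumption)+, subst m_comm, (rule L|assumption)+, simp only: ground_simps)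
  finally show "ev (sw D H D c (\<lambda>m e. ev p e \<odot>\<^bsub>D\<^esub> m)) h = ev p h"
    by (simp only: c_sweedler[OF h])
qed

text \<open>On a pure tensor \<open>p \<otimes> q\<close> this is the expansion of \<open>p\<close> in the dual basis.\<close>

lemma expand_left:
  assumes X: "module K X" and t: "t \<in> carrier (tensor K D X)"
  shows "t = sw D H (tensor K D X) c (\<lambda>m e.
    tens K D X m (sw D X X t (\<lambda>p q. ev p e \<odot>\<^bsub>X\<^esub> q)))"
proof (rule tensor_hom_eqI[OF dual_module X tensor_module[OF dual_module X] hom_id _ _ t])
  note L = dual_intros X
  show "(\<lambda>t. sw D H (tensor K D X) c (\<lambda>m e.
      tens K D X m (sw D X X t (\<lambda>p q. ev p e \<odot>\<^bsub>X\<^esub> q)))) \<in> module_hom K (tensor K D X) (tensor K D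
        X)"
    by (rule L|assumption)+
  fix p q assume pq: "p \<in> carrier D" "q \<in> carrier X"
  note L = L pq
  have g: "(\<lambda>m. tens K D X m q) \<in> module_hom K D (tensor K D X)" by (rule L)+
  have "tens K D X p q = tens K D X (sw D H D c (\<lambda>m e. ev p e \<odot>\<^bsub>D\<^esub> m)) q"
    by (simp only: c_sweedler_dual[OF pq(1)])
  also have "\<dots> = sw D H (tensor K D X) c (\<lambda>m e. tens K D X m (ev p e \<odot>\<^bsub>X\<^esub> q))"
    by (rule hom_lift_eq[OF g], (rule L|assumption)+, subst tens_smult_left, (rule L|assumption)+,
        rule tens_smult_right[symmetric], (rule L|assumption)+)
  also have "\<dots> = sw D H (tensor K D X) c (\<lambda>m e.
      tens K D X m (sw D X X (tens K D X p q) (\<lambda>p q. ev p e \<odot>\<^bsub>X\<^esub> q)))"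
    by (rule lift_cong, subst lift_tens, (rule L refl | assumption)+)
  finally show "tens K D X p q = sw D H (tensor K D X) c (\<lambda>m e.
      tens K D X m (sw D X X (tens K D X p q) (\<lambda>p q. ev p e \<odot>\<^bsub>X\<^esub> q)))" .
qed

text \<open>The sum satisfies the pairing law by the defining property of \<open>c\<close>. A solution of the pairing
  law is determined by it, since \<open>expand_left\<close> writes the solution in terms of its pairings.\<close>

lemma dual_comult_eq:
  assumes l: "l \<in> carrier D"
  shows "dual_comult K H l = sw D H (tensor K D D) c (\<lambda>m x. tens K D D m (translate l x))"
    (is "_ = ?t")
  unfolding dual_comult_def
proof (rule the_equality, intro conjI ballI)
  note L = dual_intros l
  show "?t \<in> carrier (tensor K D D)" by (rule L|assumption)+
  {
    fix h h' assume hh: "h \<in> carrier H" "h' \<in> carrier H"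
    note L = L hh
    have g: "(\<lambda>t. sw D D (ground K) t (\<lambda>l1 l2. ev l1 h' \<otimes>\<^bsub>K\<^esub> ev l2 h))
        \<in> module_hom K (tensor K D D) (ground K)"
      by (rule L|assumption)+
    have g2: "(\<lambda>x. ev l (h \<cdot> x)) \<in> module_hom K H (ground K)" by (rule L)+
    have "sw D D (ground K) ?t (\<lambda>l1 l2. ev l1 h' \<otimes>\<^bsub>K\<^esub> ev l2 h) =
      sw D H (ground K) c (\<lambda>m x. ev m h' \<otimes>\<^bsub>K\<^esub> ev l (h \<cdot> x))"
      by (rule hom_lift_eq[OF g], (rule L|assumption)+, subst lift_tens, (rule L|assumption)+,
          simp only: ev_translate[OF hh(1)])
    also have "\<dots> = ev l (h \<cdot> sw D H H c (\<lambda>m x. ev m h' \<odot>\<^bsub>H\<^esub> x))"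
      by (rule sym, rule hom_lift_eq[OF g2], (rule L|assumption)+, subst module_hom_smult[OF g2],
          (rule L|assumption)+, simp only: ground_simps)
    finally have "sw D D (ground K) ?t (\<lambda>l1 l2. ev l1 h' \<otimes>\<^bsub>K\<^esub> ev l2 h) = ev l (h \<cdot> h')"
      by (simp only: c_sweedler[OF hh(2)])
    then show "l (h \<cdot> h') = sw D D (ground K) ?t (\<lambda>l1 l2. l1 h' \<otimes>\<^bsub>K\<^esub> l2 h)"
      by (simp only: ev_def)
  }
  fix t assume "t \<in> carrier (tensor K D D) \<and> (\<forall>h\<in>carrier H. \<forall>h'\<in>carrier H.
      l (h \<cdot> h') = sw D D (ground K) t (\<lambda>l1 l2. l1 h' \<otimes>\<^bsub>K\<^esub> l2 h))"
  then have t: "t \<in> carrier (tensor K D D)"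
    and pair: "\<And>h h'. h \<in> carrier H \<Longrightarrow> h' \<in> carrier H \<Longrightarrow>
      sw D D (ground K) t (\<lambda>l1 l2. ev l1 h' \<otimes>\<^bsub>K\<^esub> ev l2 h) = ev l (h \<cdot> h')"
    by (simp_all add: ev_def)
  note L = L t
  have "sw D D D t (\<lambda>p q. ev p e \<odot>\<^bsub>D\<^esub> q) = translate l e" if e: "e \<in> carrier H" for e
  proof (rule dual_eqI)
    note L = L e
    show "sw D D D t (\<lambda>p q. ev p e \<odot>\<^bsub>D\<^esub> q) \<in> carrier D" "translate l e \<in> carrier D"
      by (rule L|assumption)+
    fix h assume h: "h \<in> carrier H"
    note L = L h
    have g: "(\<lambda>m. ev m h) \<in> module_hom K D (ground K)" by (rule L)+
    have "ev (sw D D D t (\<lambda>p q. ev p e \<odot>\<^bsub>D\<^esub> q)) h =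
      sw D D (ground K) t (\<lambda>p q. ev p e \<otimes>\<^bsub>K\<^esub> ev q h)"
      by (rule hom_lift_eq[OF g], (rule L|assumption)+, subst module_hom_smult[OF g],
          (rule L|assumption)+, simp only: ground_simps)
    then show "ev (sw D D D t (\<lambda>p q. ev p e \<odot>\<^bsub>D\<^esub> q)) h = ev (translate l e) h"
      by (simp only: pair[OF h e] ev_translate[OF h])
  qed
  then show "t = ?t"
    by (subst expand_left[OF dual_module t]) (rule lift_cong, simp only:)
qed

text \<open>Inserting \<open>dual_comult_eq\<close>, the sum over the canonical element collapses to the translate.\<close>

lemma \<sigma>_VD:
  assumes X: "module K X" and \<rho>: "\<rho> \<in> module_hom K X (tensor K X H)"
  shows \<sigma>_VD_hom: "\<sigma>_VD K H X \<rho> \<in> module_hom K (tensor K X D) (tensor K D X)"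
    and \<sigma>_VD_tens: "\<And>x l. x \<in> carrier X \<Longrightarrow> l \<in> carrier D \<Longrightarrow> \<sigma>_VD K H X \<rho> (tens K X D x l) =
      sw X H (tensor K D X) (\<rho> x) (\<lambda>x0 x1. tens K D X (translate l x1) x0)"
proof -
  note L = dual_intros X lin_comp[OF _ \<rho>] lin_closed[OF \<rho>]
  let ?F = "\<lambda>x l. sw X H (tensor K D X) (\<rho> x) (\<lambda>x0 x1. tens K D X (translate l x1) x0)"
  have inner: "sw D D (tensor K D X) (dual_comult K H l) (\<lambda>l1 l2. tens K D X (l1 x1 \<odot>\<^bsub>D\<^esub> l2) x0) =
      tens K D X (translate l x1) x0"
    if asm: "l \<in> carrier D" "x1 \<in> carrier H" "x0 \<in> carrier X" for l x1 x0
  proof -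
    note L = L asm
    have g: "(\<lambda>t. sw D D (tensor K D X) t (\<lambda>l1 l2. tens K D X (ev l1 x1 \<odot>\<^bsub>D\<^esub> l2) x0))
      \<in> module_hom K (tensor K D D) (tensor K D X)"
      by (rule L|assumption)+
    have g1: "(\<lambda>y. translate l y) \<in> module_hom K H D" by (rule L)+
    have g2: "(\<lambda>y. tens K D X (translate l y) x0) \<in> module_hom K H (tensor K D X)" by (rule L)+
    have "sw D D (tensor K D X) (dual_comult K H l) (\<lambda>l1 l2. tens K D X (ev l1 x1 \<odot>\<^bsub>D\<^esub> l2) x0) =
      sw D H (tensor K D X) c (\<lambda>m e. tens K D X (ev m x1 \<odot>\<^bsub>D\<^esub> translate l e) x0)"
      unfolding dual_comult_eq[OF asm(1)]
      by (rule hom_lift_eq[OF g], (rule L|assumption)+, rule lift_tens, (rule L|assumption)+)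
    also have "\<dots> = tens K D X (translate l (sw D H H c (\<lambda>m e. ev m x1 \<odot>\<^bsub>H\<^esub> e))) x0"
      by (rule sym, rule hom_lift_eq[OF g2], (rule L|assumption)+, subst module_hom_smult[OF g1],
          (rule L refl | assumption)+)
    also have "\<dots> = tens K D X (translate l x1) x0" by (simp only: c_sweedler[OF asm(2)])
    finally show ?thesis by (simp only: ev_def)
  qed
  have eq: "\<sigma>_VD K H X \<rho> t = tensor_lift K X D (tensor K D X) ?F t" for t
    unfolding \<sigma>_VD_def
    by (rule tensor_lift_cong[OF tensor_lift_cong[OF inner refl] refl])
  have b: "bilinear K X D (tensor K D X) ?F" by (rule L|assumption)+
  show "\<sigma>_VD K H X \<rho> \<in> module_hom K (tensor K X D) (tensor K D X)"
    unfolding eq[abs_def] by (rule L b)+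
  show "\<sigma>_VD K H X \<rho> (tens K X D x l) = ?F x l" if "x \<in> carrier X" "l \<in> carrier D" for x l
    unfolding eq by (rule lift_tens[OF X dual_module _ b that]) (rule L)+
qed

text \<open>On \<open>a \<otimes> b \<otimes> l\<close> the two sides of the Yang-Baxter equation are the images of the two sides of
  the colinearity identity under \<open>(b \<otimes> a) \<otimes> h \<mapsto> (l(_ h) \<otimes> b) \<otimes> a\<close>. Evaluating the translate at the
  unit gives \<open>l h\<close>, so these maps, taken for all \<open>l\<close>, are jointly injective.\<close>

lemma cYBE_dual_iff:
  assumes A: "module K A" and B: "module K B"
    and \<rho>A: "\<rho>A \<in> module_hom K A (tensor K A H)" and \<rho>B: "\<rho>B \<in> module_hom K B (tensor K B H)"
    and \<sigma>: "\<sigma> \<in> module_hom K (tensor K A B) (tensor K B A)"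
  shows "cYBE K A B D \<sigma> (\<sigma>_VD K H A \<rho>A) (\<sigma>_VD K H B \<rho>B) \<longleftrightarrow>
    (\<forall>a\<in>carrier A. \<forall>b\<in>carrier B.
      sw B A (tensor3 K B A H) (\<sigma> (tens K A B a b)) (\<lambda>b' a'.
        sw A H (tensor3 K B A H) (\<rho>A a') (\<lambda>a0 a1.
          sw B H (tensor3 K B A H) (\<rho>B b') (\<lambda>b0 b1.
            tens3 K B A H b0 a0 (b1 \<cdot> a1)))) =
      sw A H (tensor3 K B A H) (\<rho>A a) (\<lambda>a0 a1.
        sw B H (tensor3 K B A H) (\<rho>B b) (\<lambda>b0 b1.
          tens K (tensor K B A) H (\<sigma> (tens K A B a0 b0)) (a1 \<cdot> b1))))"
    (is "_ \<longleftrightarrow> (\<forall>a\<in>_. \<forall>b\<in>_. ?P a b = ?Q a b)")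
proof -
  let ?W = "tensor3 K D B A"
  let ?AD = "\<sigma>_VD K H A \<rho>A" and ?BD = "\<sigma>_VD K H B \<rho>B"
  note homs = \<rho>A \<rho>B \<sigma> \<sigma>_VD_hom[OF A \<rho>A] \<sigma>_VD_hom[OF B \<rho>B]
  note L = dual_intros A B homs[THEN lin_closed] lin_comp[OF _ \<rho>A] lin_comp[OF _ \<rho>B]
    lin_comp[OF _ \<sigma>] homs(4,5)[THEN lin_comp[rotated]]
  define M where "M l t = sw (tensor K B A) H ?W t (\<lambda>s h.
      sw B A ?W s (\<lambda>b a. tens3 K D B A (translate l h) b a))" for l t
  have M: "M l \<in> module_hom K (tensor3 K B A H) ?W" if "l \<in> carrier D" for l
    unfolding M_def[abs_def] by (rule L that | assumption)+
  have M_tens: "M l (tens K (tensor K B A) H s h) = sw B A ?W s (\<lambda>b a.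
      tens3 K D B A (translate l h) b a)"
    if "l \<in> carrier D" "s \<in> carrier (tensor K B A)" "h \<in> carrier H" for l s h
    unfolding M_def by (rule lift_tens, (rule L that | assumption)+)
  have inner_left: "sw D A ?W (?AD (tens K A D a' l)) (\<lambda>l' a''.
        tens K (tensor K D B) A (?BD (tens K B D b' l')) a'') =
      sw A H ?W (\<rho>A a') (\<lambda>a0 a1. sw B H ?W (\<rho>B b') (\<lambda>b0 b1.
        tens3 K D B A (translate l (b1 \<cdot> a1)) b0 a0))"
    if asm: "a' \<in> carrier A" "b' \<in> carrier B" "l \<in> carrier D" for a' b' l
    unfolding \<sigma>_VD_tens[OF A \<rho>A asm(1,3)]
  proof (subst lift_lift, (rule L asm | assumption)+, rule lift_cong)
    fix a0 a1 assume a01: "a0 \<in> carrier A" "a1 \<in> carrier H"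
    note L = L asm a01
    have "sw D A ?W (tens K D A (translate l a1) a0) (\<lambda>l' a''.
        tens K (tensor K D B) A (?BD (tens K B D b' l')) a'') =
      tens K (tensor K D B) A (?BD (tens K B D b' (translate l a1))) a0"
      by (rule lift_tens, (rule L|assumption)+)
    also have "\<dots> = tens K (tensor K D B) A
      (sw B H (tensor K D B) (\<rho>B b') (\<lambda>b0 b1. tens K D B (translate (translate l a1) b1) b0)) a0"
      by (subst \<sigma>_VD_tens[OF B \<rho>B], (rule L refl)+)
    also have "\<dots> = sw B H ?W (\<rho>B b') (\<lambda>b0 b1.
        tens3 K D B A (translate (translate l a1) b1) b0 a0)"
      by (rule tens_lift_left, (rule L|assumption)+)
    also have "\<dots> = sw B H ?W (\<rho>B b') (\<lambda>b0 b1.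
        tens3 K D B A (translate l (b1 \<cdot> a1)) b0 a0)"
      by (rule lift_cong) (simp only: translate_translate[OF asm(3) a01(2)])
    finally show "sw D A ?W (tens K D A (translate l a1) a0) (\<lambda>l' a''.
        tens K (tensor K D B) A (?BD (tens K B D b' l')) a'') = \<dots>" .
  qed
  have left: "sw B A ?W (\<sigma> (tens K A B a b)) (\<lambda>b' a'.
      sw D A ?W (?AD (tens K A D a' l)) (\<lambda>l' a''.
        tens K (tensor K D B) A (?BD (tens K B D b' l')) a'')) = M l (?P a b)"
    if asm: "a \<in> carrier A" "b \<in> carrier B" "l \<in> carrier D" for a b l
  proof -
    note L = L asm
    have "M l (?P a b) = sw B A ?W (\<sigma> (tens K A B a b)) (\<lambda>b' a'.
        sw A H ?W (\<rho>A a') (\<lambda>a0 a1. sw B H ?W (\<rho>B b') (\<lambda>b0 b1.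
        tens3 K D B A (translate l (b1 \<cdot> a1)) b0 a0)))"
      by (rule hom_lift_eq[OF M[OF asm(3)]], (rule L|assumption)+,
          rule hom_lift_eq[OF M[OF asm(3)]], (rule L|assumption)+,
          rule hom_lift_eq[OF M[OF asm(3)]], (rule L|assumption)+,
          subst M_tens, (rule L|assumption)+, rule lift_tens, (rule L|assumption)+)
    also have "\<dots> = sw B A ?W (\<sigma> (tens K A B a b)) (\<lambda>b' a'.
      sw D A ?W (?AD (tens K A D a' l)) (\<lambda>l' a''.
        tens K (tensor K D B) A (?BD (tens K B D b' l')) a''))"
      by (rule tensor_lift_cong[OF inner_left[symmetric, OF _ _ asm(3)] refl])
    finally show ?thesis by (rule sym)
  qed
  have right: "sw D B ?W (?BD (tens K B D b l)) (\<lambda>l' b'.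
      sw D A ?W (?AD (tens K A D a l')) (\<lambda>l'' a'.
        sw B A ?W (\<sigma> (tens K A B a' b')) (\<lambda>b'' a''.
          tens3 K D B A l'' b'' a''))) = M l (?Q a b)" (is "?right = _")
    if asm: "a \<in> carrier A" "b \<in> carrier B" "l \<in> carrier D" for a b l
  proof -
    note L = L asm
    have inner: "sw D A ?W (?AD (tens K A D a (translate l b1))) (\<lambda>l'' a'.
        sw B A ?W (\<sigma> (tens K A B a' b0)) (\<lambda>b'' a''.
          tens3 K D B A l'' b'' a'')) =
      sw A H ?W (\<rho>A a) (\<lambda>a0 a1. sw B A ?W (\<sigma> (tens K A B a0 b0)) (\<lambda>b'' a''.
          tens3 K D B A (translate l (a1 \<cdot> b1)) b'' a''))"
      if b01: "b0 \<in> carrier B" "b1 \<in> carrier H" for b0 b1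
    proof -
      note L = L b01
      show ?thesis
        by (subst \<sigma>_VD_tens[OF A \<rho>A], (rule L)+, subst lift_lift, (rule L|assumption)+,
            rule lift_cong, subst lift_tens, (rule L|assumption)+,
            subst translate_translate, (rule L refl | assumption)+)
    qed
    have "?right =
      sw B H ?W (\<rho>B b) (\<lambda>b0 b1. sw A H ?W (\<rho>A a) (\<lambda>a0 a1.
        sw B A ?W (\<sigma> (tens K A B a0 b0)) (\<lambda>b'' a''.
          tens3 K D B A (translate l (a1 \<cdot> b1)) b'' a'')))"
      by (subst \<sigma>_VD_tens[OF B \<rho>B], (rule L)+, subst lift_lift, (rule L|assumption)+,
          rule lift_cong, subst lift_tens, (rule L|assumption)+,
          rule inner)
    also have "\<dots> = sw A H ?W (\<rho>A a) (\<lambda>a0 a1. sw B H ?W (\<rho>B b) (\<lambda>b0 b1.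
        sw B A ?W (\<sigma> (tens K A B a0 b0)) (\<lambda>b'' a''.
          tens3 K D B A (translate l (a1 \<cdot> b1)) b'' a'')))"
      by (rule lift_swap, (rule L|assumption)+)
    also have "\<dots> = M l (?Q a b)"
      by (rule sym, rule hom_lift_eq[OF M[OF asm(3)]], (rule L|assumption)+,
          rule hom_lift_eq[OF M[OF asm(3)]], (rule L|assumption)+,
          rule M_tens, (rule L|assumption)+)
    finally show ?thesis .
  qed
  \<comment> \<open>evaluation of the dual factor at the unit\<close>
  define E where "E t = sw (tensor K D B) A (tensor K B A) t (\<lambda>s a.
    sw D B (tensor K B A) s (\<lambda>m b. ev m 1\<^sub>H \<odot>\<^bsub>tensor K B A\<^esub> tens K B A b a))" for t
  have E: "E \<in> module_hom K ?W (tensor K B A)"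
    unfolding E_def[abs_def] by (rule L|assumption)+
  have EM: "E (M l t) = sw (tensor K B A) H (tensor K B A) t (\<lambda>s h. ev l h \<odot>\<^bsub>tensor K B A\<^esub> s)"
    if l: "l \<in> carrier D" and t: "t \<in> carrier (tensor3 K B A H)" for l t
  proof (rule tensor3_hom_eqI[OF B A module_axioms _ _ _ _ t])
    note L = L l
    show "module K (tensor K B A)" by (rule L)+
    show "(\<lambda>t. E (M l t)) \<in> module_hom K (tensor3 K B A H) (tensor K B A)"
      by (rule lin_comp[OF M[OF l] E])
    show "(\<lambda>t. sw (tensor K B A) H (tensor K B A) t (\<lambda>s h. ev l h \<odot>\<^bsub>tensor K B A\<^esub> s))
        \<in> module_hom K (tensor3 K B A H) (tensor K B A)"
      by (rule L|assumption)+
    fix b a h assume bah: "b \<in> carrier B" "a \<in> carrier A" "h \<in> carrier H"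
    note L = L bah
    have "M l (tens3 K B A H b a h) =
        tens3 K D B A (translate l h) b a"
      by (subst M_tens, (rule L)+, rule lift_tens, (rule L|assumption)+)
    then have "E (M l (tens3 K B A H b a h)) =
        E (tens3 K D B A (translate l h) b a)" by (rule arg_cong)
    also have "\<dots> = ev (translate l h) 1\<^sub>H \<odot>\<^bsub>tensor K B A\<^esub> tens K B A b a"
      unfolding E_def by (subst lift_tens, (rule L|assumption)+, rule lift_tens, (rule
        L|assumption)+)
    also have "\<dots> = ev l h \<odot>\<^bsub>tensor K B A\<^esub> tens K B A b a"
      by (simp only: ev_translate_unit[OF bah(3)])
    also have "\<dots> = sw (tensor K B A) H (tensor K B A) (tens3 K B A H b a h)
        (\<lambda>s h. ev l h \<odot>\<^bsub>tensor K B A\<^esub> s)"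
      by (rule sym, rule lift_tens, (rule L|assumption)+)
    finally show "E (M l (tens3 K B A H b a h)) = \<dots>" .
  qed
  have "cYBE K A B D \<sigma> ?AD ?BD \<longleftrightarrow>
      (\<forall>a\<in>carrier A. \<forall>b\<in>carrier B. \<forall>l\<in>carrier D. M l (?P a b) = M l (?Q a b))"
    by (rule trans[OF cYBE_iff[OF A B dual_module homs(3,4,5)]],
        intro ball_cong refl arg_cong2[of _ _ _ _ "(=)"] left right)
  also have "\<dots> \<longleftrightarrow> (\<forall>a\<in>carrier A. \<forall>b\<in>carrier B. ?P a b = ?Q a b)"
  proof (intro ball_cong refl iffI)
    fix a b assume ab: "a \<in> carrier A" "b \<in> carrier B"
      and eq: "\<forall>l\<in>carrier D. M l (?P a b) = M l (?Q a b)"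
    note L = L ab
    have PQ: "?P a b \<in> carrier (tensor3 K B A H)" "?Q a b \<in> carrier (tensor3 K B A H)"
      by (rule L|assumption)+
    show "?P a b = ?Q a b"
    proof (rule functionals_separate[OF _ PQ])
      show "module K (tensor K B A)" by (rule L)+
      fix l assume l: "l \<in> carrier D"
      show "sw (tensor K B A) H (tensor K B A) (?P a b) (\<lambda>s h. ev l h \<odot>\<^bsub>tensor K B A\<^esub> s) =
        sw (tensor K B A) H (tensor K B A) (?Q a b) (\<lambda>s h. ev l h \<odot>\<^bsub>tensor K B A\<^esub> s)"
        by (simp only: EM[OF l PQ(1), symmetric] EM[OF l PQ(2), symmetric] bspec[OF eq l])
    qed
  qed (rule ballI, simp only:)
  finally show ?thesis .
qed

end

section \<open>Cancelling the unit\<close>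

text \<open>A maximal subspace \<open>N\<close> avoiding \<open>e\<close> is a complement of the line through \<open>e\<close>: adjoining any
  \<open>x\<close> outside \<open>N\<close> captures \<open>e\<close>, which expresses \<open>x\<close> modulo \<open>N\<close> as a multiple of \<open>e\<close>. The
  functional is the coordinate along \<open>e\<close>.\<close>

lemma (in vectorspace) functional_exists:
  assumes e: "e \<in> carrier V" "e \<noteq> \<zero>\<^bsub>V\<^esub>"
  obtains g where "g \<in> module_hom K V (ground K)" "g e = \<one>\<^bsub>K\<^esub>"
proof -
  let ?S = "{N. submodule K N V \<and> e \<notin> N}"
  have "\<exists>M\<in>?S. \<forall>X\<in>?S. M \<subseteq> X \<longrightarrow> X = M"
  proof (rule subset_Zorn_nonempty)
    have "submodule K {\<zero>\<^bsub>V\<^esub>} V"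
      by (rule submodule.intro) (use module_axioms in auto)
    then show "?S \<noteq> {}" using e by auto
    fix C assume C: "C \<noteq> {}" "subset.chain ?S C"
    have "submodule K (\<Union>N\<in>C. N) V"
    proof (rule nested_union_vs[where I = C and N = "\<lambda>N. N"])
      show "submodule K N V" if "N \<in> C" for N
        using C(2) that by (auto simp: subset_chain_def)
      show "\<exists>k. k \<in> C \<and> i \<subseteq> k \<and> j \<subseteq> k" if "i \<in> C" "j \<in> C" for i j
        using C(2) that unfolding subset_chain_def by (metis order_refl)
    qed (use C in auto)
    then show "\<Union> C \<in> ?S" using C(2) by (auto simp: subset_chain_def)
  qed
  then obtain N where N: "submodule K N V" "e \<notin> N"
    and max: "\<And>X. submodule K X V \<Longrightarrow> e \<notin> X \<Longrightarrow> N \<subseteq> X \<Longrightarrow> X = N"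
    by blast
  interpret N: submodule K N V by (rule N)
  have NV: "n \<in> carrier V" if "n \<in> N" for n using that N.subset by auto
  have smult_cancel: "k = \<zero>\<^bsub>K\<^esub>" if k: "k \<in> carrier K" "k \<odot>\<^bsub>V\<^esub> e \<in> N" for k
  proof (rule ccontr)
    assume nz: "k \<noteq> \<zero>\<^bsub>K\<^esub>"
    then have inv: "inv\<^bsub>K\<^esub> k \<in> carrier K" "inv\<^bsub>K\<^esub> k \<otimes>\<^bsub>K\<^esub> k = \<one>\<^bsub>K\<^esub>"
      using k(1) field_Units by auto
    have "inv\<^bsub>K\<^esub> k \<odot>\<^bsub>V\<^esub> (k \<odot>\<^bsub>V\<^esub> e) \<in> N" by (rule N.smult_closed[OF inv(1) k(2)])
    also have "inv\<^bsub>K\<^esub> k \<odot>\<^bsub>V\<^esub> (k \<odot>\<^bsub>V\<^esub> e) = e"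
      using smult_assoc1[OF inv(1) k(1) e(1)] inv(2) e(1) by (simp only: smult_one)
    finally show False using N(2) by simp
  qed
  have ex: "\<exists>k n. k \<in> carrier K \<and> n \<in> N \<and> x = n \<oplus>\<^bsub>V\<^esub> k \<odot>\<^bsub>V\<^esub> e" if x: "x \<in> carrier V" for x
  proof (cases "x \<in> N")
    case True
    then show ?thesis using x e NV by (intro exI[of _ "\<zero>\<^bsub>K\<^esub>"] exI[of _ x]) auto
  next
    case False
    define X where "X = submodule_sum N (span {x})"
    have spx: "submodule K (span {x}) V" using x by (intro span_is_submodule) auto
    have X: "submodule K X V" unfolding X_def by (rule sum_is_submodule[OF N(1) spx])
    have NX: "N \<subseteq> X" unfolding X_def by (rule in_sum[OF N(1) spx])
    have "x \<in> span {x}" using in_own_span[of "{x}"] x by auto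
    then have "x \<in> X"
      unfolding X_def using in_sum[OF spx N(1)] msum_comm[OF N(1) spx] by auto
    with False have "X \<noteq> N" by auto
    with max[OF X _ NX] have "e \<in> X" by auto
    then obtain n y where ny: "n \<in> N" "y \<in> span {x}" "e = n \<oplus>\<^bsub>V\<^esub> y"
      by (auto simp: X_def submodule_sum_def)
    from ny(2) x obtain a where a: "a \<in> {x} \<rightarrow> carrier K" "lincomb a {x} = y"
      using finite_in_span[of "{x}" y] by auto
    then have y: "y = a x \<odot>\<^bsub>V\<^esub> x" "a x \<in> carrier K" using x by (auto simp: lincomb_def)
    have nz: "a x \<noteq> \<zero>\<^bsub>K\<^esub>"
    proof
      assume "a x = \<zero>\<^bsub>K\<^esub>"
      then have "e = n" using ny y x NV by simp
      then show False using ny(1) N(2) by simp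
    qed
    \<comment> \<open>solve \<open>e = n + (a x) x\<close> for \<open>x\<close>\<close>
    define i where "i = inv\<^bsub>K\<^esub> (a x)"
    have i: "i \<in> carrier K" "i \<otimes>\<^bsub>K\<^esub> a x = \<one>\<^bsub>K\<^esub>"
      using nz y(2) field_Units by (auto simp: i_def)
    have n: "n \<in> carrier V" using ny(1) by (rule NV)
    have "i \<odot>\<^bsub>V\<^esub> e = i \<odot>\<^bsub>V\<^esub> n \<oplus>\<^bsub>V\<^esub> x"
      using i ny(3) y x n by (simp add: smult_r_distr flip: smult_assoc1)
    then have "x = (\<ominus>\<^bsub>K\<^esub> i) \<odot>\<^bsub>V\<^esub> n \<oplus>\<^bsub>V\<^esub> i \<odot>\<^bsub>V\<^esub> e"
      using i n x by (simp add: smult_l_minus M.r_neg1)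
    moreover have "(\<ominus>\<^bsub>K\<^esub> i) \<odot>\<^bsub>V\<^esub> n \<in> N" using i ny(1) by (intro N.smult_closed) auto
    ultimately show ?thesis using i(1) by blast
  qed
  have uniq: "k = k'"
    if "k \<in> carrier K" "n \<in> N" "k' \<in> carrier K" "n' \<in> N" "n \<oplus>\<^bsub>V\<^esub> k \<odot>\<^bsub>V\<^esub> e = n' \<oplus>\<^bsub>V\<^esub> k' \<odot>\<^bsub>V\<^esub> e" for
      k k' n n'
  proof -
    have nn: "n \<in> carrier V" "n' \<in> carrier V" using that NV by auto
    have "(k \<ominus>\<^bsub>K\<^esub> k') \<odot>\<^bsub>V\<^esub> e = n' \<oplus>\<^bsub>V\<^esub> (\<ominus>\<^bsub>K\<^esub> \<one>\<^bsub>K\<^esub>) \<odot>\<^bsub>V\<^esub> n"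
    proof -
      have "(k \<ominus>\<^bsub>K\<^esub> k') \<odot>\<^bsub>V\<^esub> e = k \<odot>\<^bsub>V\<^esub> e \<ominus>\<^bsub>V\<^esub> k' \<odot>\<^bsub>V\<^esub> e"
        using that(1,3) e by (simp add: R.minus_eq M.minus_eq smult_l_distr smult_l_minus)
      also have "k \<odot>\<^bsub>V\<^esub> e = \<ominus>\<^bsub>V\<^esub> n \<oplus>\<^bsub>V\<^esub> (n \<oplus>\<^bsub>V\<^esub> k \<odot>\<^bsub>V\<^esub> e)"
        using that(1) e nn by (simp add: M.r_neg1)
      also have "\<dots> = \<ominus>\<^bsub>V\<^esub> n \<oplus>\<^bsub>V\<^esub> (n' \<oplus>\<^bsub>V\<^esub> k' \<odot>\<^bsub>V\<^esub> e)" by (simp only: that(5))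
      also have "\<dots> \<ominus>\<^bsub>V\<^esub> k' \<odot>\<^bsub>V\<^esub> e = n' \<oplus>\<^bsub>V\<^esub> \<ominus>\<^bsub>V\<^esub> n"
        using that(3) e nn by (simp add: M.minus_eq M.a_ac M.r_neg)
      also have "\<ominus>\<^bsub>V\<^esub> n = (\<ominus>\<^bsub>K\<^esub> \<one>\<^bsub>K\<^esub>) \<odot>\<^bsub>V\<^esub> n" using nn by (simp add: smult_minus_1)
      finally show ?thesis .
    qed
    also have "\<dots> \<in> N" using that by (intro N.m_closed N.smult_closed) auto
    finally have "k \<ominus>\<^bsub>K\<^esub> k' = \<zero>\<^bsub>K\<^esub>" using that by (intro smult_cancel) auto
    then show ?thesis using that by simp
  qed
  define g where "g x = (THE k. k \<in> carrier K \<and> (\<exists>n\<in>N. x = n \<oplus>\<^bsub>V\<^esub> k \<odot>\<^bsub>V\<^esub> e))" for x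
  have g_eq: "g (n \<oplus>\<^bsub>V\<^esub> k \<odot>\<^bsub>V\<^esub> e) = k" if "n \<in> N" "k \<in> carrier K" for n k
    unfolding g_def
  proof (rule the_equality)
    show "k \<in> carrier K \<and> (\<exists>n'\<in>N. n \<oplus>\<^bsub>V\<^esub> k \<odot>\<^bsub>V\<^esub> e = n' \<oplus>\<^bsub>V\<^esub> k \<odot>\<^bsub>V\<^esub> e)" using that by blast
    show "k' = k" if "k' \<in> carrier K \<and> (\<exists>n'\<in>N. n \<oplus>\<^bsub>V\<^esub> k \<odot>\<^bsub>V\<^esub> e = n' \<oplus>\<^bsub>V\<^esub> k' \<odot>\<^bsub>V\<^esub> e)" for k'
      using that uniq[of k n k'] \<open>n \<in> N\<close> \<open>k \<in> carrier K\<close> by blast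
  qed
  have "g \<in> module_hom K V (ground K)"
  proof (rule module_homI)
    fix x assume "x \<in> carrier V"
    with ex obtain k n where "k \<in> carrier K" "n \<in> N" "x = n \<oplus>\<^bsub>V\<^esub> k \<odot>\<^bsub>V\<^esub> e" by blast
    then show "g x \<in> carrier (ground K)" by (simp add: g_eq)
  next
    fix x y assume "x \<in> carrier V" "y \<in> carrier V"
    with ex obtain k n k' n' where kn: "k \<in> carrier K" "n \<in> N" "x = n \<oplus>\<^bsub>V\<^esub> k \<odot>\<^bsub>V\<^esub> e"
      "k' \<in> carrier K" "n' \<in> N" "y = n' \<oplus>\<^bsub>V\<^esub> k' \<odot>\<^bsub>V\<^esub> e" by meson
    then have "x \<oplus>\<^bsub>V\<^esub> y = (n \<oplus>\<^bsub>V\<^esub> n') \<oplus>\<^bsub>V\<^esub> (k \<oplus>\<^bsub>K\<^esub> k') \<odot>\<^bsub>V\<^esub> e"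
      using e NV by (simp add: smult_l_distr M.a_ac)
    then show "g (x \<oplus>\<^bsub>V\<^esub> y) = g x \<oplus>\<^bsub>ground K\<^esub> g y"
      using kn g_eq[of "n \<oplus>\<^bsub>V\<^esub> n'" "k \<oplus>\<^bsub>K\<^esub> k'"] by (simp add: g_eq)
  next
    fix c x assume c: "c \<in> carrier K" and "x \<in> carrier V"
    with ex obtain k n where kn: "k \<in> carrier K" "n \<in> N" "x = n \<oplus>\<^bsub>V\<^esub> k \<odot>\<^bsub>V\<^esub> e" by blast
    then have "c \<odot>\<^bsub>V\<^esub> x = c \<odot>\<^bsub>V\<^esub> n \<oplus>\<^bsub>V\<^esub> (c \<otimes>\<^bsub>K\<^esub> k) \<odot>\<^bsub>V\<^esub> e"
      using e c NV by (simp add: smult_r_distr smult_assoc1)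
    then show "g (c \<odot>\<^bsub>V\<^esub> x) = c \<odot>\<^bsub>ground K\<^esub> g x"
      using kn c g_eq[of "c \<odot>\<^bsub>V\<^esub> n" "c \<otimes>\<^bsub>K\<^esub> k"] by (simp add: g_eq)
  qed
  moreover have "g e = \<one>\<^bsub>K\<^esub>"
    using g_eq[of "\<zero>\<^bsub>V\<^esub>" "\<one>\<^bsub>K\<^esub>"] e by simp
  ultimately show ?thesis by (rule that)
qed

text \<open>The form of the conclusion covers the zero space, where the zero functional has the
  property.\<close>

lemma (in vectorspace) unit_functional:
  assumes "e \<in> carrier V" "e = \<zero>\<^bsub>V\<^esub> \<longrightarrow> carrier V = {\<zero>\<^bsub>V\<^esub>}"
  obtains g where "g \<in> module_hom K V (ground K)" "\<And>x. x \<in> carrier V \<Longrightarrow> g e \<odot>\<^bsub>V\<^esub> x = x"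
proof (cases "e = \<zero>\<^bsub>V\<^esub>")
  case True
  have "(\<lambda>x. \<zero>\<^bsub>K\<^esub>) \<in> module_hom K V (ground K)" by (auto simp: module_hom_def)
  moreover have "\<zero>\<^bsub>K\<^esub> \<odot>\<^bsub>V\<^esub> x = x" if "x \<in> carrier V" for x
    using assms True that by simp
  ultimately show ?thesis by (rule that)
next
  case False
  from functional_exists[OF assms(1) False] obtain g where "g \<in> module_hom K V (ground K)" "g e =
    \<one>\<^bsub>K\<^esub>" .
  then show ?thesis by (intro that[of g]) auto
qed

section \<open>Braidings with the bialgebra\<close>

context bialgebra
begin

lemma \<sigma>_HV:
  assumes V: "module K V" and lam: "lam \<in> module_hom K (tensor K H V) V"
  shows \<sigma>_HV_hom: "\<sigma>_HV K H V lam \<in> module_hom K (tensor K H V) (tensor K V H)"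
    and \<sigma>_HV_tens: "\<And>h v. h \<in> carrier H \<Longrightarrow> v \<in> carrier V \<Longrightarrow> \<sigma>_HV K H V lam (tens K H V h v) =
      delta_sum (tensor K V H) h (\<lambda>h1 h2. tens K V H (lam (tens K H V h2 v)) h1)"
proof -
  note L = bialgebra_intros V lin_comp[OF _ lam] lin_closed[OF lam]
  have b: "bilinear K H V (tensor K V H) (\<lambda>h v. delta_sum (tensor K V H) h
      (\<lambda>h1 h2. tens K V H (lam (tens K H V h2 v)) h1))"
    by (rule L|assumption)+
  show "\<sigma>_HV K H V lam \<in> module_hom K (tensor K H V) (tensor K V H)"
    unfolding \<sigma>_HV_def by (rule L b)+
  show "\<sigma>_HV K H V lam (tens K H V h v) =
      delta_sum (tensor K V H) h (\<lambda>h1 h2. tens K V H (lam (tens K H V h2 v)) h1)"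
    if "h \<in> carrier H" "v \<in> carrier V" for h v
    unfolding \<sigma>_HV_def by (rule lift_tens[OF module_axioms V _ b that]) (rule L)+
qed

text \<open>Applying the counit to the last factor leaves the counit law.\<close>

lemma coinduced_cancel:
  assumes X: "module K X" and Y: "Y \<in> module_hom K H X" and h: "h \<in> carrier H"
  shows "sw X H X (delta_sum (tensor K X H) h (\<lambda>h1 h2. tens K X H (Y h2) h1))
    (\<lambda>x a. counit H a \<odot>\<^bsub>X\<^esub> x) = Y h"
proof -
  note L = bialgebra_intros counit_hom X h lin_comp[OF _ Y] lin_closed[OF Y]
  have "sw X H X (delta_sum (tensor K X H) h (\<lambda>h1 h2. tens K X H (Y h2) h1))
      (\<lambda>x a. counit H a \<odot>\<^bsub>X\<^esub> x) = delta_sum X h (\<lambda>h1 h2. counit H h1 \<odot>\<^bsub>X\<^esub> Y h2)"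
    by (subst lift_lift, (rule L|assumption)+, rule lift_cong,
        rule lift_tens, (rule L|assumption)+)
  also have "\<dots> = Y h" by (rule sweedler_counit_left[OF X h Y])
  finally show ?thesis .
qed

text \<open>By coassociativity, the two sides of the Yang-Baxter equation on \<open>h \<otimes> b \<otimes> c\<close> are \<open>Y(h\<^sub>(\<^sub>2\<^sub>))
  \<otimes> h\<^sub>(\<^sub>1\<^sub>)\<close>, where \<open>Y\<close> is one of the two sides of the linearity identity; and \<open>Y\<close> is recovered by
  \<open>coinduced_cancel\<close>.\<close>

lemma cYBE_bialgebra_iff:
  assumes B: "module K B" and C: "module K C"
    and lB: "lB \<in> module_hom K (tensor K H B) B" and lC: "lC \<in> module_hom K (tensor K H C) C"
    and \<sigma>: "\<sigma> \<in> module_hom K (tensor K B C) (tensor K C B)"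
  shows "cYBE K H B C (\<sigma>_HV K H B lB) (\<sigma>_HV K H C lC) \<sigma> \<longleftrightarrow>
    (\<forall>h\<in>carrier H. \<forall>b\<in>carrier B. \<forall>c\<in>carrier C.
      delta_sum (tensor K C B) h (\<lambda>h1 h2.
        \<sigma> (tens K B C (lB (tens K H B h2 b)) (lC (tens K H C h1 c)))) =
      sw C B (tensor K C B) (\<sigma> (tens K B C b c)) (\<lambda>c' b'.
        delta_sum (tensor K C B) h (\<lambda>h1 h2.
          tens K C B (lC (tens K H C h2 c')) (lB (tens K H B h1 b')))))"
    (is "_ \<longleftrightarrow> (\<forall>h\<in>_. \<forall>b\<in>_. \<forall>c\<in>_. ?P b c h = ?Q b c h)")
proof -
  let ?W = "tensor3 K C B H"
  let ?HB = "\<sigma>_HV K H B lB" and ?HC = "\<sigma>_HV K H C lC"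
  define I where "I Y h = delta_sum ?W h (\<lambda>h1 h2. tens K (tensor K C B) H (Y h2) h1)" for Y h
  note homs = lB lC \<sigma> \<sigma>_HV_hom[OF B lB] \<sigma>_HV_hom[OF C lC]
  note L = bialgebra_intros B C homs[THEN lin_closed] lin_comp[OF _ lB] lin_comp[OF _ lC]
    lin_comp[OF _ \<sigma>] homs(4,5)[THEN lin_comp[rotated]]
  have left: "sw B H ?W (?HB (tens K H B h b)) (\<lambda>b' a'.
      sw C H ?W (?HC (tens K H C a' c)) (\<lambda>c' a''.
        tens K (tensor K C B) H (\<sigma> (tens K B C b' c')) a'')) = I (?P b c) h" (is "?left = _")
    if asm: "h \<in> carrier H" "b \<in> carrier B" "c \<in> carrier C" for h b c
  proof -
    note L = L asm
    have "?left =
      delta_sum ?W h (\<lambda>h1 h2. delta_sum ?W h1 (\<lambda>a d.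
        tens K (tensor K C B) H (\<sigma> (tens K B C (lB (tens K H B h2 b)) (lC (tens K H C d c)))) a))"
      unfolding \<sigma>_HV_tens[OF B lB asm(1,2)]
      by (subst lift_lift, (rule L|assumption)+, rule lift_cong,
          subst lift_tens, (rule L|assumption)+,
          subst \<sigma>_HV_tens[OF C lC], (rule L|assumption)+,
          subst lift_lift, (rule L|assumption)+, rule lift_cong,
          rule lift_tens, (rule L|assumption)+)
    also have "\<dots> = delta_sum ?W h (\<lambda>h1 h2. delta_sum ?W h2 (\<lambda>d e.
        tens K (tensor K C B) H (\<sigma> (tens K B C (lB (tens K H B e b)) (lC (tens K H C d c)))) h1))"
      by (rule sweedler_coassoc[where F = "\<lambda>a d h2. tens K (tensor K C B) H
            (\<sigma> (tens K B C (lB (tens K H B h2 b)) (lC (tens K H C d c)))) a"], (rule L|assumption)+)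
    also have "\<dots> = I (?P b c) h"
      unfolding I_def
      by (rule lift_cong, rule tens_lift_left[symmetric], (rule L|assumption)+)
    finally show ?thesis .
  qed
  have right: "sw C B ?W (\<sigma> (tens K B C b c)) (\<lambda>c' b'.
      sw C H ?W (?HC (tens K H C h c')) (\<lambda>c'' a'.
        sw B H ?W (?HB (tens K H B a' b')) (\<lambda>b'' a''.
          tens3 K C B H c'' b'' a''))) = I (?Q b c) h" (is "?right = _")
    if asm: "h \<in> carrier H" "b \<in> carrier B" "c \<in> carrier C" for h b c
  proof -
    note L = L asm
    have inner: "sw C H ?W (?HC (tens K H C h c')) (\<lambda>c'' a'.
        sw B H ?W (?HB (tens K H B a' b')) (\<lambda>b'' a''.
          tens3 K C B H c'' b'' a'')) =
      delta_sum ?W h (\<lambda>h1 h2. delta_sum ?W h2 (\<lambda>a d.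
        tens3 K C B H (lC (tens K H C d c')) (lB (tens K H B a b')) h1))" (is "?inner = _")
      if cb: "c' \<in> carrier C" "b' \<in> carrier B" for c' b'
    proof -
      note L = L cb
      have "?inner =
        delta_sum ?W h (\<lambda>h1 h2. delta_sum ?W h1 (\<lambda>p q.
          tens3 K C B H (lC (tens K H C h2 c')) (lB (tens K H B q b')) p))"
        unfolding \<sigma>_HV_tens[OF C lC asm(1) cb(1)]
        by (subst lift_lift, (rule L|assumption)+, rule lift_cong,
            subst lift_tens, (rule L|assumption)+,
            subst \<sigma>_HV_tens[OF B lB], (rule L|assumption)+,
            subst lift_lift, (rule L|assumption)+, rule lift_cong,
            rule lift_tens, (rule L|assumption)+)
      also have "\<dots> = delta_sum ?W h (\<lambda>h1 h2. delta_sum ?W h2 (\<lambda>a d.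
          tens3 K C B H (lC (tens K H C d c')) (lB (tens K H B a b')) h1))"
        by (rule sweedler_coassoc[where F = "\<lambda>p q h2. tens3 K C B H (lC (tens K H C h2 c')) (lB
          (tens K H B q b')) p"], (rule L|assumption)+)
      finally show ?thesis .
    qed
    have "?right =
      sw C B ?W (\<sigma> (tens K B C b c)) (\<lambda>c' b'.
        delta_sum ?W h (\<lambda>h1 h2. delta_sum ?W h2 (\<lambda>a d.
          tens3 K C B H (lC (tens K H C d c')) (lB (tens K H B a b')) h1)))"
      by (rule tensor_lift_cong[OF inner refl])
    also have "\<dots> = delta_sum ?W h (\<lambda>h1 h2. sw C B ?W (\<sigma> (tens K B C b c)) (\<lambda>c' b'.
        delta_sum ?W h2 (\<lambda>a d.
          tens3 K C B H (lC (tens K H C d c')) (lB (tens K H B a b')) h1)))"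
      by (rule lift_swap, (rule L|assumption)+)
    also have "\<dots> = I (?Q b c) h"
      unfolding I_def
      by (rule lift_cong, rule sym, subst tens_lift_left, (rule L|assumption)+,
          rule lift_cong, rule tens_lift_left, (rule L|assumption)+)
    finally show ?thesis .
  qed
  have hom: "?P b c \<in> module_hom K H (tensor K C B)" "?Q b c \<in> module_hom K H (tensor K C B)"
    if "b \<in> carrier B" "c \<in> carrier C" for b c
    by (rule L that | assumption)+
  have CB: "module K (tensor K C B)" by (rule L)+
  have "cYBE K H B C ?HB ?HC \<sigma> \<longleftrightarrow>
      (\<forall>h\<in>carrier H. \<forall>b\<in>carrier B. \<forall>c\<in>carrier C. I (?P b c) h = I (?Q b c) h)"
    by (rule trans[OF cYBE_iff[OF module_axioms B C homs(4,5,3)]],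
        intro ball_cong refl arg_cong2[of _ _ _ _ "(=)"] left right)
  also have "\<dots> \<longleftrightarrow> (\<forall>h\<in>carrier H. \<forall>b\<in>carrier B. \<forall>c\<in>carrier C. ?P b c h = ?Q b c h)"
  proof (intro iffI ballI)
    fix h b c assume asm: "h \<in> carrier H" "b \<in> carrier B" "c \<in> carrier C"
      and eq: "\<forall>h\<in>carrier H. \<forall>b\<in>carrier B. \<forall>c\<in>carrier C. I (?P b c) h = I (?Q b c) h"
    then have "I (?P b c) h = I (?Q b c) h" by blast
    then show "?P b c h = ?Q b c h"
      unfolding I_def coinduced_cancel[OF CB hom(1)[OF asm(2,3)] asm(1), symmetric]
        coinduced_cancel[OF CB hom(2)[OF asm(2,3)] asm(1), symmetric]
      by (rule arg_cong)
  next
    fix h b c assume asm: "h \<in> carrier H" "b \<in> carrier B" "c \<in> carrier C"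
      and eq: "\<forall>h\<in>carrier H. \<forall>b\<in>carrier B. \<forall>c\<in>carrier C. ?P b c h = ?Q b c h"
    have "?P b c h = ?Q b c h" if "h \<in> carrier H" for h using eq that asm by blast
    then show "I (?P b c) h = I (?Q b c) h"
      unfolding I_def by (intro lift_cong) (simp only:)
  qed
  finally show ?thesis .
qed

text \<open>The injective map \<open>assoc_r\<close> carries the left-bracketed identity to the other one.\<close>

lemma coaction_assoc_iff:
  assumes V: "module K V" and del: "del \<in> module_hom K V (tensor K V H)" and v: "v \<in> carrier V"
  shows "assoc_r K V H H (tensor_map K V H (tensor K V H) H del id (del v)) =
      tensor_map K V H V (tensor K H H) id (comult H) (del v) \<longleftrightarrow>
    sw V H (tensor3 K V H H) (del v) (\<lambda>v0 v1. tens K (tensor K V H) H (del v0) v1) =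
    sw V H (tensor3 K V H H) (del v) (\<lambda>v0 v1.
      delta_sum (tensor3 K V H H) v1 (\<lambda>a b.
        tens3 K V H H v0 a b))"
    (is "?l = ?r \<longleftrightarrow> ?P = ?Q")
proof -
  note L = bialgebra_intros V v lin_comp[OF _ del] lin_closed[OF del]
  have P: "?P \<in> carrier (tensor3 K V H H)" by (rule L|assumption)+
  have l: "?l = assoc_r K V H H ?P" by (simp only: tensor_map_def id_apply)
  have "?r = sw V H (tensor K V (tensor K H H)) (del v) (\<lambda>v0 v1. tens K V (tensor K H H) v0
    (comult H v1))"
    by (simp only: tensor_map_def id_apply)
  also have "\<dots> = sw V H (tensor K V (tensor K H H)) (del v) (\<lambda>v0 v1.
      delta_sum (tensor K V (tensor K H H)) v1 (\<lambda>a b. tens K V (tensor K H H) v0 (tens K H H a b)))"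
    by (rule lift_cong, subst lift_tens_id[symmetric], (rule L|assumption)+,
        rule tens_lift_right, (rule L|assumption)+)
  also have "\<dots> = assoc_r K V H H ?Q"
    by (rule sym, rule hom_lift_eq[OF assoc_r_hom], (rule L|assumption)+,
        rule hom_lift_eq[OF assoc_r_hom], (rule L|assumption)+,
        subst assoc_r_tens, (rule L|assumption)+, rule lift_tens, (rule L|assumption)+)
  finally have r: "?r = assoc_r K V H H ?Q" .
  have Q: "?Q \<in> carrier (tensor3 K V H H)" by (rule L|assumption)+
  show ?thesis
  proof
    assume "?l = ?r"
    then have "assoc_l K V H H (assoc_r K V H H ?P) = assoc_l K V H H (assoc_r K V H H ?Q)"
      unfolding l r by (rule arg_cong)
    then show "?P = ?Q"
      unfolding assoc_l_assoc_r[OF V module_axioms module_axioms P]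
        assoc_l_assoc_r[OF V module_axioms module_axioms Q] .
  next
    assume "?P = ?Q"
    then show "?l = ?r" unfolding l r by (rule arg_cong)
  qed
qed

end

section \<open>The six equivalences\<close>

context bialgebra
begin

lemma \<sigma>_HH_hom: "\<sigma>_HH K H \<in> module_hom K (tensor K H H) (tensor K H H)"
  unfolding \<sigma>_HH_def[abs_def]
  by (rule hom_tens_left[OF module_axioms module_axioms lin_comp[OF hom_id mult_hom] unit_closed])

text \<open>Because the comultiplication is multiplicative, both sides have the form \<open>F(g\<^sub>(\<^sub>2\<^sub>),
  h\<^sub>(\<^sub>2\<^sub>)) \<otimes> g\<^sub>(\<^sub>1\<^sub>)h\<^sub>(\<^sub>1\<^sub>) \<otimes> 1\<close>, with \<open>F(g, h)\<close> the action of the product \<open>gh\<close> on one side and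
  the iterated action on the other; counits on the last two factors recover \<open>F(g, h)\<close>.\<close>

lemma cYBE_HHV_iff:
  assumes V: "module K V" and lam: "lam \<in> module_hom K (tensor K H V) V"
    and unit: "\<forall>v\<in>carrier V. lam (tens K H V 1\<^sub>H v) = v"
  shows "cYBE K H H V (\<sigma>_HH K H) (\<sigma>_HV K H V lam) (\<sigma>_HV K H V lam) \<longleftrightarrow> left_module K H V lam"
proof -
  let ?W = "tensor3 K V H H" and ?\<sigma> = "\<sigma>_HV K H V lam"
  note \<sigma> = \<sigma>_HV_hom[OF V lam] and \<sigma>t = \<sigma>_HV_tens[OF V lam]
  note L = bialgebra_intros counit_hom V lin_comp[OF _ lam] lin_closed[OF lam] unit_closed
    lin_comp[OF _ \<sigma>] lin_closed[OF \<sigma>] lin_comp[OF _ \<sigma>_HH_hom] lin_closed[OF \<sigma>_HH_hom]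
  define P where "P g h v = delta_sum ?W h (\<lambda>h1 h2. delta_sum ?W g (\<lambda>g1 g2.
      tens3 K V H H (lam (tens K H V (g2 \<cdot> h2) v)) (g1 \<cdot> h1) 1\<^sub>H))" for g h v
  define Q where "Q g h v = delta_sum ?W h (\<lambda>h1 h2. delta_sum ?W g (\<lambda>g1 g2.
      tens3 K V H H (lam (tens K H V g2 (lam (tens K H V h2 v)))) (g1 \<cdot> h1) 1\<^sub>H))" for g h v
  have left: "sw H H ?W (\<sigma>_HH K H (tens K H H g h)) (\<lambda>b' a'.
      sw V H ?W (?\<sigma> (tens K H V a' v)) (\<lambda>c' a''.
        tens K (tensor K V H) H (?\<sigma> (tens K H V b' c')) a'')) = P g h v" (is "?left = _")
    if asm: "g \<in> carrier H" "h \<in> carrier H" "v \<in> carrier V" for g h v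
  proof -
    note L = L asm
    have unit': "?\<sigma> (tens K H V 1\<^sub>H v) = tens K V H v 1\<^sub>H"
      by (subst \<sigma>t, (rule L)+, unfold comult_unit, subst lift_tens, (rule L|assumption)+,
          simp only: bspec[OF unit asm(3)])
    have gh: "g \<cdot> h \<in> carrier H" by (rule L)+
    have "?left =
      sw V H ?W (?\<sigma> (tens K H V 1\<^sub>H v)) (\<lambda>c' a''.
        tens K (tensor K V H) H (?\<sigma> (tens K H V (g \<cdot> h) c')) a'')"
      unfolding \<sigma>_HH_def by (rule lift_tens, (rule L|assumption)+)
    also have "\<dots> = tens K (tensor K V H) H (?\<sigma> (tens K H V (g \<cdot> h) v)) 1\<^sub>H"
      unfolding unit' by (rule lift_tens, (rule L|assumption)+)
    also have "\<dots> = delta_sum ?W (g \<cdot> h) (\<lambda>x1 x2.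
        tens3 K V H H (lam (tens K H V x2 v)) x1 1\<^sub>H)"
      unfolding \<sigma>t[OF gh asm(3)] by (rule tens_lift_left, (rule L|assumption)+)
    also have "\<dots> = delta_sum ?W g (\<lambda>g1 g2. delta_sum ?W h (\<lambda>h1 h2.
        tens3 K V H H (lam (tens K H V (g2 \<cdot> h2) v)) (g1 \<cdot> h1) 1\<^sub>H))"
      by (rule sweedler_mult, (rule L|assumption)+)
    also have "\<dots> = P g h v"
      unfolding P_def by (rule lift_swap, (rule L|assumption)+)
    finally show ?thesis .
  qed
  have right: "sw V H ?W (?\<sigma> (tens K H V h v)) (\<lambda>c' b'.
      sw V H ?W (?\<sigma> (tens K H V g c')) (\<lambda>c'' a'.
        sw H H ?W (\<sigma>_HH K H (tens K H H a' b')) (\<lambda>b'' a''.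
          tens3 K V H H c'' b'' a''))) = Q g h v"
    if asm: "g \<in> carrier H" "h \<in> carrier H" "v \<in> carrier V" for g h v
  proof -
    note L = L asm
    show ?thesis
      unfolding Q_def \<sigma>t[OF asm(2,3)]
      by (subst lift_lift, (rule L|assumption)+, rule lift_cong,
          subst lift_tens, (rule L|assumption)+, subst \<sigma>t, (rule L|assumption)+,
          subst lift_lift, (rule L|assumption)+, rule lift_cong,
          subst lift_tens, (rule L|assumption)+, unfold \<sigma>_HH_def,
          rule lift_tens, (rule L|assumption)+)
  qed
  \<comment> \<open>counits on the last two factors\<close>
  define R where "R t = sw (tensor K V H) H V t (\<lambda>s a.
      counit H a \<odot>\<^bsub>V\<^esub> sw V H V s (\<lambda>x b. counit H b \<odot>\<^bsub>V\<^esub> x))" for t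
  have R: "R \<in> module_hom K ?W V"
    unfolding R_def[abs_def] by (rule L|assumption)+
  have R_tens: "R (tens3 K V H H x b 1\<^sub>H) = counit H b \<odot>\<^bsub>V\<^esub> x"
    if xb: "x \<in> carrier V" "b \<in> carrier H" for x b
  proof -
    note L = L xb
    have "R (tens3 K V H H x b 1\<^sub>H) =
        counit H 1\<^sub>H \<odot>\<^bsub>V\<^esub> (counit H b \<odot>\<^bsub>V\<^esub> x)"
      unfolding R_def by (subst lift_tens, (rule L|assumption)+, subst lift_tens, (rule L refl |
        assumption)+)
    also have "\<dots> = counit H b \<odot>\<^bsub>V\<^esub> x"
      unfolding counit_unit by (rule Module.module.smult_one[OF V], (rule L)+)
    finally show ?thesis .
  qed
  have RF: "R (delta_sum ?W h (\<lambda>h1 h2. delta_sum ?W g (\<lambda>g1 g2.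
      tens3 K V H H (F g2 h2) (g1 \<cdot> h1) 1\<^sub>H))) = F g h"
    if asm: "g \<in> carrier H" "h \<in> carrier H" and F: "bilinear K H H V F" for g h F
  proof -
    note L = L asm bilinear_homs[OF F]
    have F2: "(\<lambda>h2. F g h2) \<in> module_hom K H V" by (rule L)+
    have "R (delta_sum ?W h (\<lambda>h1 h2. delta_sum ?W g (\<lambda>g1 g2.
        tens3 K V H H (F g2 h2) (g1 \<cdot> h1) 1\<^sub>H))) =
      delta_sum V h (\<lambda>h1 h2. delta_sum V g (\<lambda>g1 g2.
        counit H h1 \<odot>\<^bsub>V\<^esub> (counit H g1 \<odot>\<^bsub>V\<^esub> F g2 h2)))"
    proof (rule hom_lift_eq[OF R], (rule L|assumption)+, rule hom_lift_eq[OF R], (rule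
      L|assumption)+)
      fix h1 h2 g1 g2 assume hg: "h1 \<in> carrier H" "h2 \<in> carrier H" "g1 \<in> carrier H" "g2 \<in> carrier H"
      note L = L hg
      have "counit H (g1 \<cdot> h1) \<odot>\<^bsub>V\<^esub> F g2 h2 = (counit H h1 \<otimes>\<^bsub>K\<^esub> counit H g1) \<odot>\<^bsub>V\<^esub> F g2 h2"
        unfolding counit_mult[OF hg(3,1)] by (subst m_comm, (rule L refl)+)
      also have "\<dots> = counit H h1 \<odot>\<^bsub>V\<^esub> (counit H g1 \<odot>\<^bsub>V\<^esub> F g2 h2)"
        by (rule Module.module.smult_assoc1[OF V], (rule L)+)
      finally have eq: "counit H (g1 \<cdot> h1) \<odot>\<^bsub>V\<^esub> F g2 h2 = \<dots>" .
      show "R (tens3 K V H H (F g2 h2) (g1 \<cdot> h1) 1\<^sub>H) =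
          counit H h1 \<odot>\<^bsub>V\<^esub> (counit H g1 \<odot>\<^bsub>V\<^esub> F g2 h2)"
        by (subst R_tens, (rule L)+, rule eq)
    qed
    also have "\<dots> = delta_sum V h (\<lambda>h1 h2. counit H h1 \<odot>\<^bsub>V\<^esub>
        delta_sum V g (\<lambda>g1 g2. counit H g1 \<odot>\<^bsub>V\<^esub> F g2 h2))"
      by (rule lift_cong, rule smult_lift[symmetric], (rule L|assumption)+)
    also have "\<dots> = delta_sum V h (\<lambda>h1 h2. counit H h1 \<odot>\<^bsub>V\<^esub> F g h2)"
      by (rule lift_cong, subst sweedler_counit_left[OF V], (rule L refl | assumption)+)
    also have "\<dots> = F g h" by (rule sweedler_counit_left[OF V asm(2) F2])
    finally show ?thesis .
  qed
  have "cYBE K H H V (\<sigma>_HH K H) ?\<sigma> ?\<sigma> \<longleftrightarrow>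
      (\<forall>g\<in>carrier H. \<forall>h\<in>carrier H. \<forall>v\<in>carrier V. P g h v = Q g h v)"
    by (rule trans[OF cYBE_iff[OF module_axioms module_axioms V \<sigma>_HH_hom \<sigma> \<sigma>]],
        intro ball_cong refl arg_cong2[of _ _ _ _ "(=)"] left right)
  also have "\<dots> \<longleftrightarrow> (\<forall>g\<in>carrier H. \<forall>h\<in>carrier H. \<forall>v\<in>carrier V.
      lam (tens K H V (g \<cdot> h) v) = lam (tens K H V g (lam (tens K H V h v))))"
  proof (intro iffI ballI)
    fix g h v assume asm: "g \<in> carrier H" "h \<in> carrier H" "v \<in> carrier V"
      and eq: "\<forall>g\<in>carrier H. \<forall>h\<in>carrier H. \<forall>v\<in>carrier V. P g h v = Q g h v"
    note L = L asm
    have bl: "bilinear K H H V (\<lambda>g h. lam (tens K H V (g \<cdot> h) v))"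
      "bilinear K H H V (\<lambda>g h. lam (tens K H V g (lam (tens K H V h v))))"
      by (rule L|assumption)+
    have "R (P g h v) = R (Q g h v)" using eq asm by simp
    then show "lam (tens K H V (g \<cdot> h) v) = lam (tens K H V g (lam (tens K H V h v)))"
      unfolding P_def Q_def RF[OF asm(1,2) bl(1)] RF[OF asm(1,2) bl(2)] .
  next
    fix g h v assume asm: "g \<in> carrier H" "h \<in> carrier H" "v \<in> carrier V"
      and eq: "\<forall>g\<in>carrier H. \<forall>h\<in>carrier H. \<forall>v\<in>carrier V.
      lam (tens K H V (g \<cdot> h) v) = lam (tens K H V g (lam (tens K H V h v)))"
    show "P g h v = Q g h v"
      unfolding P_def Q_def using eq asm(3) by (intro lift_cong) simp
  qed
  also have "\<dots> \<longleftrightarrow> left_module K H V lam"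
    using lam unit by (simp add: left_module_def)
  finally show ?thesis .
qed

end

context
  fixes K :: "('k, 'r) ring_scheme" and V :: "('k, 'v, 'y) module_scheme"
    and mu :: "('k, 'v, 'v) tensor \<Rightarrow> 'v" and nu :: "'k \<Rightarrow> 'v"
  assumes V: "module K V" and mu: "mu \<in> module_hom K (tensor K V V) V"
    and nu: "nu \<in> module_hom K (ground K) V"
begin

lemma nu_one: "nu \<one>\<^bsub>K\<^esub> \<in> carrier V"
proof -
  interpret module K V by (rule V)
  show ?thesis using lin_closed[OF nu] by simp
qed

lemma \<sigma>_VV_hom: "\<sigma>_VV K V mu nu \<in> module_hom K (tensor K V V) (tensor K V V)"
  unfolding \<sigma>_VV_def[abs_def]
  by (rule hom_tens_right[OF V V nu_one lin_comp[OF hom_id mu]])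

text \<open>Both sides place two units in front of an iterated product; multiplying the factors together
  removes them.\<close>

lemma cYBE_VVV_iff:
  assumes unit: "\<forall>v\<in>carrier V. mu (tens K V V (nu \<one>\<^bsub>K\<^esub>) v) = v \<and> mu (tens K V V v (nu \<one>\<^bsub>K\<^esub>)) = v"
  shows "cYBE K V V V (\<sigma>_VV K V mu nu) (\<sigma>_VV K V mu nu) (\<sigma>_VV K V mu nu) \<longleftrightarrow>
    (\<forall>u\<in>carrier V. \<forall>v\<in>carrier V. \<forall>w\<in>carrier V.
      mu (tens K V V (mu (tens K V V u v)) w) = mu (tens K V V u (mu (tens K V V v w))))"
proof -
  let ?W = "tensor3 K V V V" and ?\<sigma> = "\<sigma>_VV K V mu nu" and ?e = "nu \<one>\<^bsub>K\<^esub>"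
  note \<sigma> = \<sigma>_VV_hom
  note L = lin_intros V nu_one lin_comp[OF _ mu] lin_closed[OF mu] lin_comp[OF _ \<sigma>] lin_closed[OF \<sigma>]
  have unit1: "mu (tens K V V ?e v) = v" and unit2: "mu (tens K V V v ?e) = v" if "v \<in> carrier V"
    for v
    using unit that by auto
  define J where "J x = tens3 K V V V ?e ?e x" for x
  have left: "sweedler K V V ?W (?\<sigma> (tens K V V u v)) (\<lambda>b' a'. sweedler K V V ?W (?\<sigma> (tens K V V
    a' w)) (\<lambda>c' a''.
        tens K (tensor K V V) V (?\<sigma> (tens K V V b' c')) a'')) = J (mu (tens K V V (mu (tens K V V
          u v)) w))" (is "?left = _")
    if asm: "u \<in> carrier V" "v \<in> carrier V" "w \<in> carrier V" for u v w
  proof -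
    note L = L asm
    have "?left =
      sweedler K V V ?W (?\<sigma> (tens K V V (mu (tens K V V u v)) w)) (\<lambda>c' a''.
        tens K (tensor K V V) V (?\<sigma> (tens K V V ?e c')) a'')"
      by (subst \<sigma>_VV_def[of K V mu nu "tens K V V u v"], rule lift_tens, (rule L|assumption)+)
    also have "\<dots> = tens K (tensor K V V) V (?\<sigma> (tens K V V ?e ?e)) (mu (tens K V V (mu (tens K V V
      u v)) w))"
      by (subst \<sigma>_VV_def[of K V mu nu "tens K V V (mu (tens K V V u v)) w"],
          rule lift_tens, (rule L|assumption)+)
    finally show ?thesis by (simp only: J_def \<sigma>_VV_def unit1[OF nu_one])
  qed
  have right: "sweedler K V V ?W (?\<sigma> (tens K V V v w)) (\<lambda>c' b'. sweedler K V V ?W (?\<sigma> (tens K V V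
    u c')) (\<lambda>c'' a'.
        sweedler K V V ?W (?\<sigma> (tens K V V a' b')) (\<lambda>b'' a''.
          tens3 K V V V c'' b'' a''))) = J (mu (tens K V V u (mu (tens K V V v w))))" (is "?right
          = _")
    if asm: "u \<in> carrier V" "v \<in> carrier V" "w \<in> carrier V" for u v w
  proof -
    note L = L asm
    have "?right =
      sweedler K V V ?W (?\<sigma> (tens K V V u ?e)) (\<lambda>c'' a'.
        sweedler K V V ?W (?\<sigma> (tens K V V a' (mu (tens K V V v w)))) (\<lambda>b'' a''.
          tens3 K V V V c'' b'' a''))"
      by (subst \<sigma>_VV_def[of K V mu nu "tens K V V v w"], rule lift_tens, (rule L|assumption)+)
    also have "\<dots> = sweedler K V V ?W (?\<sigma> (tens K V V u (mu (tens K V V v w)))) (\<lambda>b'' a''.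
          tens3 K V V V ?e b'' a'')"
      by (subst \<sigma>_VV_def[of K V mu nu "tens K V V u ?e"], unfold unit2[OF asm(1)],
          rule lift_tens, (rule L|assumption)+)
    also have "\<dots> = J (mu (tens K V V u (mu (tens K V V v w))))"
      unfolding J_def by (subst \<sigma>_VV_def[of K V mu nu "tens K V V u (mu (tens K V V v w))"],
          rule lift_tens, (rule L|assumption)+)
    finally show ?thesis .
  qed
  have inj: "x = y" if xy: "x \<in> carrier V" "y \<in> carrier V" "J x = J y" for x y
  proof -
    have ret: "sweedler K (tensor K V V) V V (J z) (\<lambda>s z. mu (tens K V V (mu s) z)) = z" if z: "z
      \<in> carrier V" for z
      unfolding J_def
      by (subst lift_tens, (rule L z | assumption)+, simp only: unit1[OF nu_one] unit1[OF z])
    show ?thesis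
      by (rule trans[OF ret[OF xy(1), symmetric]], unfold xy(3), rule ret[OF xy(2)])
  qed
  have "cYBE K V V V ?\<sigma> ?\<sigma> ?\<sigma> \<longleftrightarrow> (\<forall>u\<in>carrier V. \<forall>v\<in>carrier V. \<forall>w\<in>carrier V.
      J (mu (tens K V V (mu (tens K V V u v)) w)) = J (mu (tens K V V u (mu (tens K V V v w)))))"
    by (rule trans[OF cYBE_iff[OF V V V \<sigma> \<sigma> \<sigma>]],
        intro ball_cong refl arg_cong2[of _ _ _ _ "(=)"] left right)
  also have "\<dots> \<longleftrightarrow> (\<forall>u\<in>carrier V. \<forall>v\<in>carrier V. \<forall>w\<in>carrier V.
      mu (tens K V V (mu (tens K V V u v)) w) = mu (tens K V V u (mu (tens K V V v w))))"
  proof (intro ball_cong refl iffI)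
    fix u v w assume asm: "u \<in> carrier V" "v \<in> carrier V" "w \<in> carrier V"
      and eq: "J (mu (tens K V V (mu (tens K V V u v)) w)) = J (mu (tens K V V u (mu (tens K V V v
        w))))"
    show "mu (tens K V V (mu (tens K V V u v)) w) = mu (tens K V V u (mu (tens K V V v w)))"
      by (rule inj[OF _ _ eq], (rule L asm)+)
  qed (rule arg_cong)
  finally show ?thesis .
qed

end

context bialgebra
begin

text \<open>By \<open>cYBE_bialgebra_iff\<close> the equation is the compatibility of \<open>\<lambda>\<close> with \<open>\<mu>\<close>, preceded on both
  sides by the unit of \<open>V\<close>, which a functional cancels.\<close>

lemma cYBE_HVV_iff:
  assumes V: "vectorspace K V" and lam: "lam \<in> module_hom K (tensor K H V) V"
    and mu: "mu \<in> module_hom K (tensor K V V) V" and nu: "nu \<in> module_hom K (ground K) V"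
    and nz: "nu \<one>\<^bsub>K\<^esub> = \<zero>\<^bsub>V\<^esub> \<longrightarrow> carrier V = {\<zero>\<^bsub>V\<^esub>}"
    and unit: "\<forall>h\<in>carrier H. \<forall>c\<in>carrier K. lam (tens K H V h (nu c)) = counit H h \<odot>\<^bsub>V\<^esub> nu c"
  shows "cYBE K H V V (\<sigma>_HV K H V lam) (\<sigma>_HV K H V lam) (\<sigma>_VV K V mu nu) \<longleftrightarrow>
    (\<forall>h\<in>carrier H. \<forall>v\<in>carrier V. \<forall>w\<in>carrier V.
      lam (tens K H V h (mu (tens K V V v w))) =
      delta_sum V h (\<lambda>h1 h2.
        mu (tens K V V (lam (tens K H V h2 v)) (lam (tens K H V h1 w)))))"
proof -
  have Vm: "module K V" by (rule vectorspace.axioms(1)[OF V])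
  let ?e = "nu \<one>\<^bsub>K\<^esub>" and ?\<sigma> = "\<sigma>_VV K V mu nu"
  note e = nu_one[OF Vm mu nu] and \<sigma> = \<sigma>_VV_hom[OF Vm mu nu]
  obtain g where g: "g \<in> module_hom K V (ground K)" "\<And>x. x \<in> carrier V \<Longrightarrow> g ?e \<odot>\<^bsub>V\<^esub> x = x"
    using vectorspace.unit_functional[OF V e nz] by blast
  note L = bialgebra_intros counit_hom Vm e lin_comp[OF _ lam] lin_closed[OF lam]
    lin_comp[OF _ mu] lin_closed[OF mu] lin_comp[OF _ g(1)]
    lin_closed[OF g(1), unfolded ground_simps] lin_comp[OF _ \<sigma>] lin_closed[OF \<sigma>]
  define J where "J x = tens K V V ?e x" for x
  have J: "J \<in> module_hom K V (tensor K V V)" unfolding J_def[abs_def] by (rule L)+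
  have inj: "x = y" if xy: "x \<in> carrier V" "y \<in> carrier V" "J x = J y" for x y
  proof -
    have ret: "sw V V V (J z) (\<lambda>x y. g x \<odot>\<^bsub>V\<^esub> y) = z" if z: "z \<in> carrier V" for z
      unfolding J_def by (subst lift_tens, (rule L z | assumption)+, rule g(2)[OF z])
    show ?thesis
      by (rule trans[OF ret[OF xy(1), symmetric]], unfold xy(3), rule ret[OF xy(2)])
  qed
  let ?P = "\<lambda>h v w. delta_sum V h (\<lambda>h1 h2. mu (tens K V V (lam (tens K H V h2 v)) (lam (tens K H V
    h1 w))))"
  have left: "delta_sum (tensor K V V) h (\<lambda>h1 h2.
      ?\<sigma> (tens K V V (lam (tens K H V h2 v)) (lam (tens K H V h1 w)))) = J (?P h v w)"
    if asm: "h \<in> carrier H" "v \<in> carrier V" "w \<in> carrier V" for h v w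
  proof -
    note L = L asm
    show ?thesis
      by (rule sym, rule hom_lift_eq[OF J], (rule L|assumption)+, simp only: J_def \<sigma>_VV_def)
  qed
  have right: "sw V V (tensor K V V) (?\<sigma> (tens K V V v w)) (\<lambda>c' b'.
      delta_sum (tensor K V V) h (\<lambda>h1 h2.
        tens K V V (lam (tens K H V h2 c')) (lam (tens K H V h1 b')))) =
      J (lam (tens K H V h (mu (tens K V V v w))))" (is "?right = _")
    if asm: "h \<in> carrier H" "v \<in> carrier V" "w \<in> carrier V" for h v w
  proof -
    note L = L asm
    have hom: "(\<lambda>h. J (lam (tens K H V h (mu (tens K V V v w))))) \<in> module_hom K H (tensor K V V)"
      unfolding J_def by (rule L)+
    have "?right =
      delta_sum (tensor K V V) h (\<lambda>h1 h2.
        tens K V V (lam (tens K H V h2 ?e)) (lam (tens K H V h1 (mu (tens K V V v w)))))"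
      by (subst \<sigma>_VV_def, rule lift_tens, (rule L|assumption)+)
    also have "\<dots> = delta_sum (tensor K V V) h (\<lambda>h1 h2.
        counit H h2 \<odot>\<^bsub>tensor K V V\<^esub> J (lam (tens K H V h1 (mu (tens K V V v w)))))"
    proof (rule lift_cong)
      fix h1 h2 assume h12: "h1 \<in> carrier H" "h2 \<in> carrier H"
      note L = L h12
      have eq: "lam (tens K H V h2 ?e) = counit H h2 \<odot>\<^bsub>V\<^esub> ?e" using unit h12 by blast
      show "tens K V V (lam (tens K H V h2 ?e)) (lam (tens K H V h1 (mu (tens K V V v w)))) =
          counit H h2 \<odot>\<^bsub>tensor K V V\<^esub> J (lam (tens K H V h1 (mu (tens K V V v w))))"
        unfolding J_def eq by (rule tens_smult_left, (rule L)+)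
    qed
    also have "\<dots> = J (lam (tens K H V h (mu (tens K V V v w))))"
      by (rule sweedler_counit_right[OF tensor_module[OF Vm Vm] asm(1) hom])
    finally show ?thesis .
  qed
  have "cYBE K H V V (\<sigma>_HV K H V lam) (\<sigma>_HV K H V lam) ?\<sigma> \<longleftrightarrow>
    (\<forall>h\<in>carrier H. \<forall>v\<in>carrier V. \<forall>w\<in>carrier V. J (?P h v w) = J (lam (tens K H V h (mu (tens K V V
      v w)))))"
    by (rule trans[OF cYBE_bialgebra_iff[OF Vm Vm lam lam \<sigma>]],
        intro ball_cong refl arg_cong2[of _ _ _ _ "(=)"] left right)
  also have "\<dots> \<longleftrightarrow> (\<forall>h\<in>carrier H. \<forall>v\<in>carrier V. \<forall>w\<in>carrier V.
      lam (tens K H V h (mu (tens K V V v w))) = ?P h v w)"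
  proof (intro ball_cong refl iffI)
    fix h v w assume asm: "h \<in> carrier H" "v \<in> carrier V" "w \<in> carrier V"
      and eq: "J (?P h v w) = J (lam (tens K H V h (mu (tens K V V v w))))"
    show "lam (tens K H V h (mu (tens K V V v w))) = ?P h v w"
      by (rule inj[OF _ _ eq[symmetric]], (rule L asm | assumption)+)
  qed (simp only:)
  finally show ?thesis .
qed

end

context finite_bialgebra
begin

lemma \<sigma>_HD_eq: "\<sigma>_HD K H = \<sigma>_VD K H H (comult H)"
  by (simp only: \<sigma>_HD_def \<sigma>_VD_def)

text \<open>Moving the factor \<open>h\<^sub>(\<^sub>1\<^sub>)\<close> of \<open>H\<close> out by coassociativity, colinearity of the braiding
  becomes the Yetter-Drinfeld identity \<open>Y(h)\<close> in the form \<open>Y(h\<^sub>(\<^sub>2\<^sub>))\<close> with \<open>h\<^sub>(\<^sub>1\<^sub>)\<close> inserted as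
  a middle factor; the counit on that factor removes it.\<close>

lemma cYBE_HVD_iff:
  assumes V: "module K V" and lam: "lam \<in> module_hom K (tensor K H V) V"
    and del: "del \<in> module_hom K V (tensor K V H)"
  shows "cYBE K H V D (\<sigma>_HV K H V lam) (\<sigma>_HD K H) (\<sigma>_VD K H V del) \<longleftrightarrow> YD_compatible K H V lam del"
proof -
  let ?U = "tensor K V H" and ?T = "tensor3 K V H H" and ?\<sigma> = "\<sigma>_HV K H V lam"
  note \<sigma> = \<sigma>_HV_hom[OF V lam]
  note L = dual_intros counit_hom V lin_comp[OF _ lam] lin_closed[OF lam]
    lin_comp[OF _ del] lin_closed[OF del] lin_comp[OF _ \<sigma>] lin_closed[OF \<sigma>]
  define \<Theta> where "\<Theta> x t = sw V H ?T t (\<lambda>v k. tens K ?U H (tens K V H v x) k)" for x t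
  have \<Theta>: "\<Theta> x \<in> module_hom K ?U ?T" if "x \<in> carrier H" for x
    unfolding \<Theta>_def[abs_def] by (rule L that | assumption)+
  have \<Theta>_tens: "\<Theta> x (tens K V H v k) = tens K ?U H (tens K V H v x) k"
    if "x \<in> carrier H" "v \<in> carrier V" "k \<in> carrier H" for x v k
    unfolding \<Theta>_def by (rule lift_tens, (rule L that | assumption)+)
  have \<Theta>_homs: "(\<lambda>y. \<Theta> (f y) t) \<in> module_hom K X ?T"
    if "module K X" "f \<in> module_hom K X H" "t \<in> carrier ?U" for f X t
    unfolding \<Theta>_def by (rule L that lin_closed[OF that(2)] | assumption)+
  define I where "I Y h = delta_sum ?T h (\<lambda>h1 h2. \<Theta> h1 (Y h2))" for Y h
  define YL where "YL v h = delta_sum ?U h (\<lambda>h1 h2.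
      sw V H ?U (del (lam (tens K H V h2 v))) (\<lambda>x0 x1. tens K V H x0 (x1 \<cdot> h1)))" for v h
  define YR where "YR v h = delta_sum ?U h (\<lambda>h1 h2.
      sw V H ?U (del v) (\<lambda>v0 v1. tens K V H (lam (tens K H V h1 v0)) (h2 \<cdot> v1)))" for v h
  have left: "sw V H ?T (?\<sigma> (tens K H V h v)) (\<lambda>b' a'.
      delta_sum ?T a' (\<lambda>a0 a1. sw V H ?T (del b') (\<lambda>b0 b1.
        tens K ?U H (tens K V H b0 a0) (b1 \<cdot> a1)))) = I (YL v) h" (is "?left = _")
    if asm: "h \<in> carrier H" "v \<in> carrier V" for h v
  proof -
    note L = L asm
    have "?left =
      delta_sum ?T h (\<lambda>h1 h2. delta_sum ?T h1 (\<lambda>a0 a1.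
        sw V H ?T (del (lam (tens K H V h2 v))) (\<lambda>b0 b1.
          tens K ?U H (tens K V H b0 a0) (b1 \<cdot> a1))))"
      unfolding \<sigma>_HV_tens[OF V lam asm]
      by (subst lift_lift, (rule L|assumption)+, rule lift_cong,
          rule lift_tens, (rule L|assumption)+)
    also have "\<dots> = delta_sum ?T h (\<lambda>h1 h2. delta_sum ?T h2 (\<lambda>a b.
        sw V H ?T (del (lam (tens K H V b v))) (\<lambda>b0 b1.
          tens K ?U H (tens K V H b0 h1) (b1 \<cdot> a))))"
      by (rule sweedler_coassoc[where F = "\<lambda>a0 a1 h2. sw V H ?T (del (lam (tens K H V h2 v)))
            (\<lambda>b0 b1. tens K ?U H (tens K V H b0 a0) (b1 \<cdot> a1))"], (rule L|assumption)+)
    also have "\<dots> = I (YL v) h"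
      unfolding I_def YL_def
    proof (rule lift_cong, rule sym)
      fix h1 h2 assume h12: "h1 \<in> carrier H" "h2 \<in> carrier H"
      note L = L h12
      show "\<Theta> h1 (delta_sum ?U h2 (\<lambda>h1 h2.
          sw V H ?U (del (lam (tens K H V h2 v))) (\<lambda>x0 x1. tens K V H x0 (x1 \<cdot> h1)))) =
        delta_sum ?T h2 (\<lambda>a b. sw V H ?T (del (lam (tens K H V b v)))
          (\<lambda>b0 b1. tens K ?U H (tens K V H b0 h1) (b1 \<cdot> a)))"
        by (rule hom_lift_eq[OF \<Theta>[OF h12(1)]], (rule L|assumption)+,
            rule hom_lift_eq[OF \<Theta>[OF h12(1)]], (rule L|assumption)+, rule \<Theta>_tens, (rule
            L|assumption)+)
    qed
    finally show ?thesis .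
  qed
  have right: "delta_sum ?T h (\<lambda>a0 a1. sw V H ?T (del v) (\<lambda>b0 b1.
      tens K ?U H (?\<sigma> (tens K H V a0 b0)) (a1 \<cdot> b1))) = I (YR v) h" (is "?right = _")
    if asm: "h \<in> carrier H" "v \<in> carrier V" for h v
  proof -
    note L = L asm
    have "?right =
      delta_sum ?T h (\<lambda>a0 a1. sw V H ?T (del v) (\<lambda>b0 b1.
        delta_sum ?T a0 (\<lambda>p q.
          tens K ?U H (tens K V H (lam (tens K H V q b0)) p) (a1 \<cdot> b1))))"
      by (rule lift_cong, rule lift_cong,
          subst \<sigma>_HV_tens[OF V lam], (rule L|assumption)+, rule tens_lift_left, (rule
          L|assumption)+)
    also have "\<dots> = delta_sum ?T h (\<lambda>a0 a1. delta_sum ?T a0 (\<lambda>p q.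
        sw V H ?T (del v) (\<lambda>b0 b1.
          tens K ?U H (tens K V H (lam (tens K H V q b0)) p) (a1 \<cdot> b1))))"
      by (rule lift_cong, rule lift_swap, (rule L|assumption)+)
    also have "\<dots> = delta_sum ?T h (\<lambda>h1 h2. delta_sum ?T h2 (\<lambda>a b.
        sw V H ?T (del v) (\<lambda>b0 b1.
          tens K ?U H (tens K V H (lam (tens K H V a b0)) h1) (b \<cdot> b1))))"
      by (rule sweedler_coassoc[where F = "\<lambda>p q a1. sw V H ?T (del v) (\<lambda>b0 b1.
            tens K ?U H (tens K V H (lam (tens K H V q b0)) p) (a1 \<cdot> b1))"], (rule L|assumption)+)
    also have "\<dots> = I (YR v) h"
      unfolding I_def YR_def
    proof (rule lift_cong, rule sym)
      fix h1 h2 assume h12: "h1 \<in> carrier H" "h2 \<in> carrier H"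
      note L = L h12
      show "\<Theta> h1 (delta_sum ?U h2 (\<lambda>h1 h2. sw V H ?U (del v)
          (\<lambda>v0 v1. tens K V H (lam (tens K H V h1 v0)) (h2 \<cdot> v1)))) =
        delta_sum ?T h2 (\<lambda>a b. sw V H ?T (del v) (\<lambda>b0 b1.
          tens K ?U H (tens K V H (lam (tens K H V a b0)) h1) (b \<cdot> b1)))"
        by (rule hom_lift_eq[OF \<Theta>[OF h12(1)]], (rule L|assumption)+,
            rule hom_lift_eq[OF \<Theta>[OF h12(1)]], (rule L|assumption)+, rule \<Theta>_tens, (rule
            L|assumption)+)
    qed
    finally show ?thesis .
  qed
  have Y: "YL v \<in> module_hom K H ?U" "YR v \<in> module_hom K H ?U" if "v \<in> carrier V" for v
    unfolding YL_def[abs_def] YR_def[abs_def] by (rule L that | assumption)+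
  \<comment> \<open>counit on the middle factor\<close>
  define R where "R t = sw ?U H ?U t (\<lambda>s k. sw V H ?U s (\<lambda>v a.
      counit H a \<odot>\<^bsub>?U\<^esub> tens K V H v k))" for t
  have R: "R \<in> module_hom K ?T ?U"
    unfolding R_def[abs_def] by (rule L|assumption)+
  have R\<Theta>: "R (\<Theta> x t) = counit H x \<odot>\<^bsub>?U\<^esub> t" if x: "x \<in> carrier H" and t: "t \<in> carrier ?U" for x t
  proof (rule tensor_hom_eqI[OF V module_axioms _ lin_comp[OF \<Theta>[OF x] R] _ _ t])
    note L = L x
    show "module K ?U" by (rule L)+
    show "(\<lambda>t. counit H x \<odot>\<^bsub>?U\<^esub> t) \<in> module_hom K ?U ?U" by (rule L)+
    fix v k assume vk: "v \<in> carrier V" "k \<in> carrier H"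
    note L = L vk
    show "R (\<Theta> x (tens K V H v k)) = counit H x \<odot>\<^bsub>?U\<^esub> tens K V H v k"
      unfolding \<Theta>_tens[OF x vk] R_def
      by (subst lift_tens, (rule L|assumption)+, rule lift_tens, (rule L|assumption)+)
  qed
  have RI: "R (I Y h) = Y h" if Y: "Y \<in> module_hom K H ?U" and h: "h \<in> carrier H" for Y h
  proof -
    note L = L h \<Theta>_homs lin_closed[OF \<Theta>] lin_comp[OF _ \<Theta>] lin_comp[OF _ Y] lin_closed[OF Y]
    have "R (I Y h) = delta_sum ?U h (\<lambda>h1 h2. counit H h1 \<odot>\<^bsub>?U\<^esub> Y h2)"
      unfolding I_def by (rule hom_lift_eq[OF R], (rule L|assumption)+, rule R\<Theta>, (rule
        L|assumption)+)
    also have "\<dots> = Y h" by (rule sweedler_counit_left[OF tensor_module[OF V module_axioms] h Y])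
    finally show ?thesis .
  qed
  have "cYBE K H V D ?\<sigma> (\<sigma>_HD K H) (\<sigma>_VD K H V del) \<longleftrightarrow>
      (\<forall>h\<in>carrier H. \<forall>v\<in>carrier V. I (YL v) h = I (YR v) h)"
    unfolding \<sigma>_HD_eq
    by (rule trans[OF cYBE_dual_iff[OF module_axioms V comult_hom del \<sigma>]],
        intro ball_cong refl arg_cong2[of _ _ _ _ "(=)"] left right)
  also have "\<dots> \<longleftrightarrow> (\<forall>h\<in>carrier H. \<forall>v\<in>carrier V. YL v h = YR v h)"
  proof (intro iffI ballI)
    fix h v assume asm: "h \<in> carrier H" "v \<in> carrier V"
      and "\<forall>h\<in>carrier H. \<forall>v\<in>carrier V. I (YL v) h = I (YR v) h"
    then have "R (I (YL v) h) = R (I (YR v) h)" by simp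
    then show "YL v h = YR v h" by (simp only: RI[OF Y(1)[OF asm(2)] asm(1)] RI[OF Y(2)[OF asm(2)]
      asm(1)])
  next
    fix h v assume asm: "h \<in> carrier H" "v \<in> carrier V"
      and eq: "\<forall>h\<in>carrier H. \<forall>v\<in>carrier V. YL v h = YR v h"
    show "I (YL v) h = I (YR v) h"
      unfolding I_def using eq asm(2) by (intro lift_cong) simp
  qed
  also have "\<dots> \<longleftrightarrow> YD_compatible K H V lam del"
    by (simp only: YD_compatible_def YL_def YR_def)
  finally show ?thesis .
qed

text \<open>By \<open>cYBE_dual_iff\<close> the equation is the compatibility of \<open>\<delta>\<close> with \<open>\<mu>\<close>, where the unit of \<open>V\<close>
  has been put in front of the \<open>V\<close>-component on both sides; a functional cancels it.\<close>

lemma cYBE_VVD_iff: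
  assumes V: "vectorspace K V" and del: "del \<in> module_hom K V (tensor K V H)"
    and mu: "mu \<in> module_hom K (tensor K V V) V" and nu: "nu \<in> module_hom K (ground K) V"
    and nz: "nu \<one>\<^bsub>K\<^esub> = \<zero>\<^bsub>V\<^esub> \<longrightarrow> carrier V = {\<zero>\<^bsub>V\<^esub>}"
    and unit: "\<forall>c\<in>carrier K. del (nu c) = tens K V H (nu c) 1\<^sub>H"
  shows "cYBE K V V D (\<sigma>_VV K V mu nu) (\<sigma>_VD K H V del) (\<sigma>_VD K H V del) \<longleftrightarrow>
    (\<forall>v\<in>carrier V. \<forall>w\<in>carrier V.
      del (mu (tens K V V v w)) =
      sw V H (tensor K V H) (del v) (\<lambda>v0 v1. sw V H (tensor K V H) (del w) (\<lambda>w0 w1.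
        tens K V H (mu (tens K V V v0 w0)) (v1 \<cdot> w1))))"
proof -
  have Vm: "module K V" by (rule vectorspace.axioms(1)[OF V])
  let ?e = "nu \<one>\<^bsub>K\<^esub>" and ?\<sigma> = "\<sigma>_VV K V mu nu" and ?T = "tensor3 K V V H"
  note e = nu_one[OF Vm mu nu] and \<sigma> = \<sigma>_VV_hom[OF Vm mu nu]
  obtain g where g: "g \<in> module_hom K V (ground K)" "\<And>x. x \<in> carrier V \<Longrightarrow> g ?e \<odot>\<^bsub>V\<^esub> x = x"
    using vectorspace.unit_functional[OF V e nz] by blast
  note L = dual_intros Vm e lin_comp[OF _ del] lin_closed[OF del]
    lin_comp[OF _ mu] lin_closed[OF mu] lin_comp[OF _ g(1)]
    lin_closed[OF g(1), unfolded ground_simps] lin_comp[OF _ \<sigma>] lin_closed[OF \<sigma>]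
  define J where "J t = sw V H ?T t (\<lambda>a k. tens3 K V V H ?e a k)" for t
  have J: "J \<in> module_hom K (tensor K V H) ?T"
    unfolding J_def[abs_def] by (rule L|assumption)+
  have J_tens: "J (tens K V H a k) = tens3 K V V H ?e a k"
    if "a \<in> carrier V" "k \<in> carrier H" for a k
    unfolding J_def by (rule lift_tens, (rule L that | assumption)+)
  have inj: "x = y" if xy: "x \<in> carrier (tensor K V H)" "y \<in> carrier (tensor K V H)" "J x = J y"
    for x y
  proof -
    \<comment> \<open>a left inverse of \<open>J\<close>\<close>
    define R where "R t = sw (tensor K V V) H (tensor K V H) t (\<lambda>s k.
        sw V V (tensor K V H) s (\<lambda>x y. g x \<odot>\<^bsub>tensor K V H\<^esub> tens K V H y k))" for t
    have R: "R \<in> module_hom K ?T (tensor K V H)"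
      unfolding R_def[abs_def] by (rule L|assumption)+
    have RJ: "R (J t) = t" if t: "t \<in> carrier (tensor K V H)" for t
    proof (rule tensor_hom_eqI[OF Vm module_axioms tensor_module[OF Vm module_axioms]
          lin_comp[OF J R] hom_id _ t])
      fix a k assume ak: "a \<in> carrier V" "k \<in> carrier H"
      note L = L ak
      have "R (J (tens K V H a k)) = g ?e \<odot>\<^bsub>tensor K V H\<^esub> tens K V H a k"
        unfolding J_tens[OF ak] R_def
        by (subst lift_tens, (rule L|assumption)+, rule lift_tens, (rule L|assumption)+)
      also have "\<dots> = tens K V H (g ?e \<odot>\<^bsub>V\<^esub> a) k"
        by (rule tens_smult_left[symmetric], (rule L)+)
      finally show "R (J (tens K V H a k)) = tens K V H a k" by (simp only: g(2)[OF ak(1)])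
    qed
    show ?thesis
      by (rule trans[OF RJ[OF xy(1), symmetric]], unfold xy(3), rule RJ[OF xy(2)])
  qed
  let ?Q = "\<lambda>v w. sw V H (tensor K V H) (del v) (\<lambda>v0 v1. sw V H (tensor K V H) (del w) (\<lambda>w0 w1.
        tens K V H (mu (tens K V V v0 w0)) (v1 \<cdot> w1)))"
  have left: "sw V V ?T (?\<sigma> (tens K V V v w)) (\<lambda>b' a'.
      sw V H ?T (del a') (\<lambda>a0 a1. sw V H ?T (del b') (\<lambda>b0 b1.
        tens3 K V V H b0 a0 (b1 \<cdot> a1)))) = J (del (mu (tens K V V v w)))" (is "?left = _")
    if asm: "v \<in> carrier V" "w \<in> carrier V" for v w
  proof -
    note L = L asm
    have del_e: "del ?e = tens K V H ?e 1\<^sub>H" using unit one_closed by blast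
    have "?left =
      sw V H ?T (del (mu (tens K V V v w))) (\<lambda>a0 a1. sw V H ?T (del ?e) (\<lambda>b0 b1.
          tens3 K V V H b0 a0 (b1 \<cdot> a1)))"
      by (subst \<sigma>_VV_def, rule lift_tens, (rule L|assumption)+)
    also have "\<dots> = J (del (mu (tens K V V v w)))"
      unfolding J_def del_e
      by (rule lift_cong, subst lift_tens, (rule L|assumption)+,
          simp only: unit_l)
    finally show ?thesis .
  qed
  have right: "sw V H ?T (del v) (\<lambda>a0 a1. sw V H ?T (del w) (\<lambda>b0 b1.
      tens K (tensor K V V) H (?\<sigma> (tens K V V a0 b0)) (a1 \<cdot> b1))) = J (?Q v w)"
    if asm: "v \<in> carrier V" "w \<in> carrier V" for v w
  proof -
    note L = L asm
    show ?thesis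
      by (rule sym, rule hom_lift_eq[OF J], (rule L|assumption)+, rule hom_lift_eq[OF J], (rule
        L|assumption)+,
          unfold \<sigma>_VV_def, rule J_tens, (rule L|assumption)+)
  qed
  have "cYBE K V V D ?\<sigma> (\<sigma>_VD K H V del) (\<sigma>_VD K H V del) \<longleftrightarrow>
      (\<forall>v\<in>carrier V. \<forall>w\<in>carrier V. J (del (mu (tens K V V v w))) = J (?Q v w))"
    by (rule trans[OF cYBE_dual_iff[OF Vm Vm del del \<sigma>]],
        intro ball_cong refl arg_cong2[of _ _ _ _ "(=)"] left right)
  also have "\<dots> \<longleftrightarrow> (\<forall>v\<in>carrier V. \<forall>w\<in>carrier V. del (mu (tens K V V v w)) = ?Q v w)"
  proof (intro ball_cong refl iffI)
    fix v w assume asm: "v \<in> carrier V" "w \<in> carrier V"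
      and eq: "J (del (mu (tens K V V v w))) = J (?Q v w)"
    show "del (mu (tens K V V v w)) = ?Q v w"
      by (rule inj[OF _ _ eq], (rule L asm | assumption)+)
  qed (rule arg_cong)
  finally show ?thesis .
qed

lemma dual_one_closed: "dual_one H \<in> carrier D"
  unfolding dual_one_def by (rule restrict_dual[OF counit_hom])

lemma ev_dual_one: "h \<in> carrier H \<Longrightarrow> ev (dual_one H) h = counit H h"
  by (simp only: ev_def dual_one_def restrict_apply')

lemma \<sigma>_DD:
  shows \<sigma>_DD_hom: "\<sigma>_DD K H \<in> module_hom K (tensor K D D) (tensor K D D)"
    and \<sigma>_DD_tens: "\<And>l m. l \<in> carrier D \<Longrightarrow> m \<in> carrier D \<Longrightarrow> \<sigma>_DD K H (tens K D D l m) =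
      tens K D D (dual_one H) (dual_mult K H (tens K D D l m))"
proof -
  note L = dual_intros dual_one_closed dual_mult_closed lin_comp[OF _ dual_mult_hom]
  have b: "bilinear K D D (tensor K D D) (\<lambda>l m. tens K D D (dual_one H) (dual_mult K H (tens K D D
    l m)))"
    by (rule L|assumption)+
  show "\<sigma>_DD K H \<in> module_hom K (tensor K D D) (tensor K D D)"
    unfolding \<sigma>_DD_def by (rule L b)+
  show "\<sigma>_DD K H (tens K D D l m) = tens K D D (dual_one H) (dual_mult K H (tens K D D l m))"
    if "l \<in> carrier D" "m \<in> carrier D" for l m
    unfolding \<sigma>_DD_def by (rule lift_tens[OF _ _ _ b that]) (rule L)+
qed

lemma translate_dual_one:
  assumes x: "x \<in> carrier H"
  shows "translate (dual_one H) x = counit H x \<odot>\<^bsub>D\<^esub> dual_one H"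
proof (rule dual_eqI)
  note L = dual_intros dual_one_closed x
  show "translate (dual_one H) x \<in> carrier D" "counit H x \<odot>\<^bsub>D\<^esub> dual_one H \<in> carrier D"
    by (rule L)+
  fix h assume h: "h \<in> carrier H"
  note L = L h
  have g: "(\<lambda>l. ev l h) \<in> module_hom K D (ground K)" by (rule L)+
  have hx: "h \<cdot> x \<in> carrier H" by (rule L)+
  have "ev (counit H x \<odot>\<^bsub>D\<^esub> dual_one H) h = counit H x \<otimes>\<^bsub>K\<^esub> counit H h"
    by (subst module_hom_smult[OF g], (rule L)+, simp only: ground_simps ev_dual_one[OF h])
  also have "\<dots> = counit H h \<otimes>\<^bsub>K\<^esub> counit H x" by (rule m_comm, (rule L)+)
  also have "\<dots> = ev (translate (dual_one H) x) h"
    by (simp only: ev_translate[OF h] ev_dual_one[OF hx] counit_mult[OF h x])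
  finally show "ev (translate (dual_one H) x) h = ev (counit H x \<odot>\<^bsub>D\<^esub> dual_one H) h" by (rule sym)
qed

text \<open>This is the multiplicativity of the comultiplication of \<open>H\<close>, tested on \<open>z\<close> after
  interchanging the sums over the coproducts of \<open>z\<close> and \<open>x\<close>.\<close>

lemma translate_dual_mult:
  assumes lm: "l \<in> carrier D" "m \<in> carrier D" and x: "x \<in> carrier H"
  shows "translate (dual_mult K H (tens K D D l m)) x =
    delta_sum D x (\<lambda>a b. dual_mult K H (tens K D D (translate l b) (translate m a)))"
proof (rule dual_eqI)
  note L = dual_intros dual_mult_closed lin_comp[OF _ dual_mult_hom] lm x
  let ?r = "delta_sum D x (\<lambda>a b. dual_mult K H (tens K D D (translate l b) (translate m a)))"
  show "translate (dual_mult K H (tens K D D l m)) x \<in> carrier D" "?r \<in> carrier D"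
    by (rule L|assumption)+
  fix z assume z: "z \<in> carrier H"
  note L = L z
  have g: "(\<lambda>l. ev l z) \<in> module_hom K D (ground K)" by (rule L)+
  have zx: "z \<cdot> x \<in> carrier H" by (rule L)+
  have "ev (translate (dual_mult K H (tens K D D l m)) x) z =
      delta_sum (ground K) (z \<cdot> x) (\<lambda>p q. ev l q \<otimes>\<^bsub>K\<^esub> ev m p)"
    by (simp only: ev_translate[OF z] ev_dual_mult[OF lm zx])
  also have "\<dots> = delta_sum (ground K) z (\<lambda>z1 z2. delta_sum (ground K) x (\<lambda>a b.
      ev l (z2 \<cdot> b) \<otimes>\<^bsub>K\<^esub> ev m (z1 \<cdot> a)))"
    by (rule sweedler_mult, (rule L|assumption)+)
  also have "\<dots> = delta_sum (ground K) x (\<lambda>a b. delta_sum (ground K) z (\<lambda>z1 z2.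
      ev l (z2 \<cdot> b) \<otimes>\<^bsub>K\<^esub> ev m (z1 \<cdot> a)))"
    by (rule lift_swap, (rule L|assumption)+)
  also have "\<dots> = ev ?r z"
  proof (rule sym, rule hom_lift_eq[OF g], (rule L|assumption)+)
    fix a b assume ab: "a \<in> carrier H" "b \<in> carrier H"
    note L = L ab
    have tr: "translate l b \<in> carrier D" "translate m a \<in> carrier D" by (rule L)+
    show "ev (dual_mult K H (tens K D D (translate l b) (translate m a))) z =
        delta_sum (ground K) z (\<lambda>z1 z2. ev l (z2 \<cdot> b) \<otimes>\<^bsub>K\<^esub> ev m (z1 \<cdot> a))"
      unfolding ev_dual_mult[OF tr z] by (rule lift_cong) (simp only: ev_translate)
  qed
  finally show "ev (translate (dual_mult K H (tens K D D l m)) x) z = ev ?r z" .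
qed

text \<open>The braiding passes \<open>\<epsilon>\<close> through \<open>V\<close> unchanged, by the counit assumption, so both sides are
  images of the two sides of coassociativity under \<open>(x \<otimes> a) \<otimes> b \<mapsto> (\<epsilon> \<otimes> l(_ b) m(_ a)) \<otimes> x\<close>.
  Evaluating the two dual factors at the unit gives \<open>l(b) m(a) x\<close>, and pairs of functionals
  separate the points of \<open>(V \<otimes> H) \<otimes> H\<close>.\<close>

lemma cYBE_VDD_iff:
  assumes V: "module K V" and del: "del \<in> module_hom K V (tensor K V H)"
    and unit: "\<forall>v\<in>carrier V. sw V H V (del v) (\<lambda>v0 v1. counit H v1 \<odot>\<^bsub>V\<^esub> v0) = v"
  shows "cYBE K V D D (\<sigma>_VD K H V del) (\<sigma>_VD K H V del) (\<sigma>_DD K H) \<longleftrightarrow> right_comodule K H V del"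
proof -
  let ?U = "tensor K V H" and ?T = "tensor3 K V H H" and ?W = "tensor3 K D D V"
    and ?\<sigma> = "\<sigma>_VD K H V del" and ?e = "dual_one H"
  let ?m = "\<lambda>l m. dual_mult K H (tens K D D l m)"
  note \<sigma> = \<sigma>_VD_hom[OF V del] and \<sigma>t = \<sigma>_VD_tens[OF V del]
  note L = dual_intros counit_hom dual_one_closed dual_mult_closed lin_comp[OF _ dual_mult_hom] V
    lin_comp[OF _ del] lin_closed[OF del] lin_comp[OF _ \<sigma>] lin_closed[OF \<sigma>]
    lin_comp[OF _ \<sigma>_DD_hom] lin_closed[OF \<sigma>_DD_hom]
  define P where "P v = sw V H ?T (del v) (\<lambda>v0 v1. tens K ?U H (del v0) v1)" for v
  define Q where "Q v = sw V H ?T (del v) (\<lambda>v0 v1. delta_sum ?T v1 (\<lambda>a b.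
      tens K ?U H (tens K V H v0 a) b))" for v
  have PQ: "P v \<in> carrier ?T" "Q v \<in> carrier ?T" if "v \<in> carrier V" for v
    unfolding P_def Q_def by (rule L that | assumption)+
  define N where "N l m t = sw ?U H ?W t (\<lambda>s b. sw V H ?W s (\<lambda>x a.
      tens3 K D D V ?e (?m (translate l b) (translate m a)) x))" for l m t
  have N: "N l m \<in> module_hom K ?T ?W" if "l \<in> carrier D" "m \<in> carrier D" for l m
    unfolding N_def[abs_def] by (rule L that | assumption)+
  have N_tens: "N l m (tens K ?U H s b) = sw V H ?W s (\<lambda>x a.
      tens3 K D D V ?e (?m (translate l b) (translate m a)) x)"
    if "l \<in> carrier D" "m \<in> carrier D" "s \<in> carrier ?U" "b \<in> carrier H" for l m s b
    unfolding N_def by (rule lift_tens, (rule L that | assumption)+)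
  have left: "sw D V ?W (?\<sigma> (tens K V D v l)) (\<lambda>l' v'. sw D V ?W (?\<sigma> (tens K V D v' m)) (\<lambda>m' v''.
      tens K (tensor K D D) V (\<sigma>_DD K H (tens K D D l' m')) v'')) = N l m (P v)" (is "?left = _")
    if asm: "v \<in> carrier V" "l \<in> carrier D" "m \<in> carrier D" for v l m
  proof -
    note L = L asm
    have "?left =
      sw V H ?W (del v) (\<lambda>v0 v1. sw V H ?W (del v0) (\<lambda>x a.
        tens3 K D D V ?e (?m (translate l v1) (translate m a)) x))"
      unfolding \<sigma>t[OF asm(1,2)]
      by (subst lift_lift, (rule L|assumption)+, rule lift_cong,
          subst lift_tens, (rule L|assumption)+, subst \<sigma>t, (rule L|assumption)+,
          subst lift_lift, (rule L|assumption)+, rule lift_cong,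
          subst lift_tens, (rule L|assumption)+, subst \<sigma>_DD_tens, (rule L refl | assumption)+)
    also have "\<dots> = N l m (P v)"
      unfolding P_def
      by (rule sym, rule hom_lift_eq[OF N[OF asm(2,3)]], (rule L|assumption)+, rule N_tens, (rule
        L|assumption)+)
    finally show ?thesis .
  qed
  have right: "sw D D ?W (\<sigma>_DD K H (tens K D D l m)) (\<lambda>m' l'. sw D V ?W (?\<sigma> (tens K V D v m'))
    (\<lambda>m'' v'.
      sw D V ?W (?\<sigma> (tens K V D v' l')) (\<lambda>l'' v''.
        tens3 K D D V m'' l'' v''))) = N l m (Q v)" (is "?right = _")
    if asm: "v \<in> carrier V" "l \<in> carrier D" "m \<in> carrier D" for v l m
  proof -
    note L = L asm
    have unit': "?\<sigma> (tens K V D v ?e) = tens K D V ?e v"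
    proof -
      have "?\<sigma> (tens K V D v ?e) = sw V H (tensor K D V) (del v) (\<lambda>v0 v1. tens K D V ?e (counit H
        v1 \<odot>\<^bsub>V\<^esub> v0))"
        by (subst \<sigma>t, (rule L)+, rule lift_cong, subst translate_dual_one, assumption,
            subst tens_smult_left, (rule L|assumption)+, rule tens_smult_right[symmetric], (rule
            L|assumption)+)
      also have "\<dots> = tens K D V ?e (sw V H V (del v) (\<lambda>v0 v1. counit H v1 \<odot>\<^bsub>V\<^esub> v0))"
        by (rule tens_lift_right[symmetric], (rule L|assumption)+)
      finally show ?thesis by (simp only: bspec[OF unit asm(1)])
    qed
    have "?right =
      sw D V ?W (?\<sigma> (tens K V D v ?e)) (\<lambda>m'' v'. sw D V ?W (?\<sigma> (tens K V D v' (?m l m))) (\<lambda>l'' v''.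
          tens3 K D D V m'' l'' v''))"
      unfolding \<sigma>_DD_tens[OF asm(2,3)] by (rule lift_tens, (rule L|assumption)+)
    also have "\<dots> = sw D V ?W (?\<sigma> (tens K V D v (?m l m))) (\<lambda>l'' v''.
          tens3 K D D V ?e l'' v'')"
      unfolding unit' by (rule lift_tens, (rule L|assumption)+)
    also have "\<dots> = sw V H ?W (del v) (\<lambda>v0 v1.
          tens3 K D D V ?e (translate (?m l m) v1) v0)"
      by (subst \<sigma>t, (rule L)+, subst lift_lift, (rule L|assumption)+, rule lift_cong,
          rule lift_tens, (rule L|assumption)+)
    also have "\<dots> = sw V H ?W (del v) (\<lambda>v0 v1. delta_sum ?W v1 (\<lambda>a b.
          tens3 K D D V ?e (?m (translate l b) (translate m a)) v0))"
    proof (rule lift_cong)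
      fix v0 v1 assume v01: "v0 \<in> carrier V" "v1 \<in> carrier H"
      note L = L v01
      have g: "(\<lambda>q. tens3 K D D V ?e q v0) \<in> module_hom K D ?W" by (rule L)+
      show "tens3 K D D V ?e (translate (?m l m) v1) v0 =
        delta_sum ?W v1 (\<lambda>a b.
          tens3 K D D V ?e (?m (translate l b) (translate m a)) v0)"
        unfolding translate_dual_mult[OF asm(2,3) v01(2)]
        by (rule hom_lift[OF _ _ _ _ g], (rule L|assumption)+)
    qed
    also have "\<dots> = N l m (Q v)"
      unfolding Q_def
      by (rule sym, rule hom_lift_eq[OF N[OF asm(2,3)]], (rule L|assumption)+,
          rule hom_lift_eq[OF N[OF asm(2,3)]], (rule L|assumption)+,
          subst N_tens, (rule L|assumption)+, rule lift_tens, (rule L|assumption)+)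
    finally show ?thesis .
  qed
  \<comment> \<open>evaluation of both dual factors at the unit\<close>
  define E where "E t = sw (tensor K D D) V V t (\<lambda>s x. sw D D V s (\<lambda>p q.
      ev p 1\<^sub>H \<odot>\<^bsub>V\<^esub> (ev q 1\<^sub>H \<odot>\<^bsub>V\<^esub> x)))" for t
  have E: "E \<in> module_hom K ?W V"
    unfolding E_def[abs_def] by (rule L|assumption)+
  have EN: "E (N l m t) = sw V H V (sw ?U H ?U t (\<lambda>s b. ev l b \<odot>\<^bsub>?U\<^esub> s)) (\<lambda>x a. ev m a \<odot>\<^bsub>V\<^esub> x)"
    if lm: "l \<in> carrier D" "m \<in> carrier D" and t: "t \<in> carrier ?T" for l m t
  proof (rule tensor3_hom_eqI[OF V module_axioms module_axioms V lin_comp[OF N[OF lm] E] _ _ t])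
    note L = L lm
    show "(\<lambda>t. sw V H V (sw ?U H ?U t (\<lambda>s b. ev l b \<odot>\<^bsub>?U\<^esub> s)) (\<lambda>x a. ev m a \<odot>\<^bsub>V\<^esub> x))
        \<in> module_hom K ?T V"
      by (rule L|assumption)+
    fix x a b assume xab: "x \<in> carrier V" "a \<in> carrier H" "b \<in> carrier H"
    note L = L xab
    have tr: "translate l b \<in> carrier D" "translate m a \<in> carrier D" by (rule L)+
    have K1: "\<one>\<^bsub>K\<^esub> \<odot>\<^bsub>V\<^esub> y = y" if "y \<in> carrier V" for y by (rule Module.module.smult_one[OF V that])
    have g: "(\<lambda>t. sw V H V t (\<lambda>x a. ev m a \<odot>\<^bsub>V\<^esub> x)) \<in> module_hom K ?U V"
      by (rule L|assumption)+
    have ev_m: "ev (?m (translate l b) (translate m a)) 1\<^sub>H = ev l b \<otimes>\<^bsub>K\<^esub> ev m a"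
      unfolding ev_dual_mult[OF tr unit_closed] comult_unit
      by (subst lift_tens, (rule L|assumption)+,
          simp only: ev_translate_unit[OF xab(2)] ev_translate_unit[OF xab(3)])
    have "N l m (tens K ?U H (tens K V H x a) b) =
        tens3 K D D V ?e (?m (translate l b) (translate m a)) x"
      by (subst N_tens, (rule L)+, rule lift_tens, (rule L|assumption)+)
    then have "E (N l m (tens K ?U H (tens K V H x a) b)) =
        E (tens3 K D D V ?e (?m (translate l b) (translate m a)) x)" by (rule arg_cong)
    also have "\<dots> = ev ?e 1\<^sub>H \<odot>\<^bsub>V\<^esub> (ev (?m (translate l b) (translate m a)) 1\<^sub>H \<odot>\<^bsub>V\<^esub> x)"
      unfolding E_def by (subst lift_tens, (rule L|assumption)+, rule lift_tens, (rule
        L|assumption)+)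
    also have "\<dots> = (ev l b \<otimes>\<^bsub>K\<^esub> ev m a) \<odot>\<^bsub>V\<^esub> x"
      unfolding ev_dual_one[OF unit_closed] counit_unit ev_m by (rule K1, (rule L)+)
    also have "\<dots> = ev l b \<odot>\<^bsub>V\<^esub> (ev m a \<odot>\<^bsub>V\<^esub> x)"
      by (rule Module.module.smult_assoc1[OF V], (rule L)+)
    also have "\<dots> = sw V H V (ev l b \<odot>\<^bsub>?U\<^esub> tens K V H x a) (\<lambda>x a. ev m a \<odot>\<^bsub>V\<^esub> x)"
      by (subst module_hom_smult[OF g], (rule L)+, subst lift_tens, (rule L refl | assumption)+)
    also have "\<dots> = sw V H V (sw ?U H ?U (tens K ?U H (tens K V H x a) b)
        (\<lambda>s b. ev l b \<odot>\<^bsub>?U\<^esub> s)) (\<lambda>x a. ev m a \<odot>\<^bsub>V\<^esub> x)"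
      by (subst lift_tens, (rule L refl | assumption)+)
    finally show "E (N l m (tens K ?U H (tens K V H x a) b)) = \<dots>" .
  qed
  have "cYBE K V D D ?\<sigma> ?\<sigma> (\<sigma>_DD K H) \<longleftrightarrow>
      (\<forall>v\<in>carrier V. \<forall>l\<in>carrier D. \<forall>m\<in>carrier D. N l m (P v) = N l m (Q v))"
    by (rule trans[OF cYBE_iff[OF V dual_module dual_module \<sigma> \<sigma> \<sigma>_DD_hom]],
        intro ball_cong refl arg_cong2[of _ _ _ _ "(=)"] left right)
  also have "\<dots> \<longleftrightarrow> (\<forall>v\<in>carrier V. P v = Q v)"
  proof (intro ball_cong refl iffI)
    fix v assume v: "v \<in> carrier V"
      and eq: "\<forall>l\<in>carrier D. \<forall>m\<in>carrier D. N l m (P v) = N l m (Q v)"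
    note L = L PQ[OF v]
    show "P v = Q v"
    proof (rule functionals_separate[OF _ PQ[OF v]])
      show "module K ?U" by (rule L)+
      fix l assume l: "l \<in> carrier D"
      note L = L l
      show "sw ?U H ?U (P v) (\<lambda>s b. ev l b \<odot>\<^bsub>?U\<^esub> s) = sw ?U H ?U (Q v) (\<lambda>s b. ev l b \<odot>\<^bsub>?U\<^esub> s)"
      proof (rule functionals_separate[OF V])
        show "sw ?U H ?U (P v) (\<lambda>s b. ev l b \<odot>\<^bsub>?U\<^esub> s) \<in> carrier ?U"
          "sw ?U H ?U (Q v) (\<lambda>s b. ev l b \<odot>\<^bsub>?U\<^esub> s) \<in> carrier ?U"
          by (rule L|assumption)+
        fix m assume m: "m \<in> carrier D"
        have "E (N l m (P v)) = E (N l m (Q v))" by (simp only: bspec[OF bspec[OF eq l] m])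
        then show "sw V H V (sw ?U H ?U (P v) (\<lambda>s b. ev l b \<odot>\<^bsub>?U\<^esub> s)) (\<lambda>x a. ev m a \<odot>\<^bsub>V\<^esub> x) =
          sw V H V (sw ?U H ?U (Q v) (\<lambda>s b. ev l b \<odot>\<^bsub>?U\<^esub> s)) (\<lambda>x a. ev m a \<odot>\<^bsub>V\<^esub> x)"
          by (simp only: EN[OF l m PQ(1)[OF v]] EN[OF l m PQ(2)[OF v]])
      qed
    qed
  qed (intro ballI, simp only:)
  also have "\<dots> \<longleftrightarrow> right_comodule K H V del"
    unfolding right_comodule_def P_def Q_def
    using del unit coaction_assoc_iff[OF V del] by (simp only: simp_thms ball_triv cong: ball_cong)
  finally show ?thesis .
qed

end

theorem proposition3p17:
  fixes K :: "('k, 'r) ring_scheme"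
    and H :: "('k, 'h, 'z) bialgebra_scheme"
    and V :: "('k, 'v, 'y) module_scheme"
    and mu :: "('k, 'v, 'v) tensor \<Rightarrow> 'v"
    and nu :: "'k \<Rightarrow> 'v"
    and lam :: "('k, 'h, 'v) tensor \<Rightarrow> 'v"
    and del :: "'v \<Rightarrow> ('k, 'v, 'h) tensor"
  assumes "bialgebra K H" and "vectorspace.fin_dim K H"
    and "vectorspace K V"
    and "mu \<in> module_hom K (tensor K V V) V"
    and "nu \<in> module_hom K (ground K) V"
    and "lam \<in> module_hom K (tensor K H V) V"
    and "del \<in> module_hom K V (tensor K V H)"
  shows "
    (cYBE K H V (dual K H) (\<sigma>_HV K H V lam) (\<sigma>_HD K H) (\<sigma>_VD K H V del)
       \<longleftrightarrow> YD_compatible K H V lam del) \<and>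
    ((\<forall>v\<in>carrier V. lam (tens K H V (unit_map H \<one>\<^bsub>K\<^esub>) v) = v) \<longrightarrow>
     cYBE K H H V (\<sigma>_HH K H) (\<sigma>_HV K H V lam) (\<sigma>_HV K H V lam)
       \<longleftrightarrow> left_module K H V lam) \<and>
    ((\<forall>v\<in>carrier V. sweedler K V H V (del v) (\<lambda>v0 v1. counit H v1 \<odot>\<^bsub>V\<^esub> v0) = v) \<longrightarrow>
     cYBE K V (dual K H) (dual K H) (\<sigma>_VD K H V del) (\<sigma>_VD K H V del) (\<sigma>_DD K H)
       \<longleftrightarrow> right_comodule K H V del) \<and>
    ((nu \<one>\<^bsub>K\<^esub> = \<zero>\<^bsub>V\<^esub> \<longrightarrow> carrier V = {\<zero>\<^bsub>V\<^esub>}) \<longrightarrow>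
     (\<forall>h\<in>carrier H. \<forall>c\<in>carrier K. lam (tens K H V h (nu c)) = counit H h \<odot>\<^bsub>V\<^esub> nu c) \<longrightarrow>
     cYBE K H V V (\<sigma>_HV K H V lam) (\<sigma>_HV K H V lam) (\<sigma>_VV K V mu nu)
       \<longleftrightarrow> (\<forall>h\<in>carrier H. \<forall>v\<in>carrier V. \<forall>w\<in>carrier V.
             lam (tens K H V h (mu (tens K V V v w))) =
             sweedler K H H V (comult H h) (\<lambda>h1 h2.
               mu (tens K V V (lam (tens K H V h2 v)) (lam (tens K H V h1 w)))))) \<and>
    ((nu \<one>\<^bsub>K\<^esub> = \<zero>\<^bsub>V\<^esub> \<longrightarrow> carrier V = {\<zero>\<^bsub>V\<^esub>}) \<longrightarrow>
     (\<forall>c\<in>carrier K. del (nu c) = tens K V H (nu c) (unit_map H \<one>\<^bsub>K\<^esub>)) \<longrightarrow>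
     cYBE K V V (dual K H) (\<sigma>_VV K V mu nu) (\<sigma>_VD K H V del) (\<sigma>_VD K H V del)
       \<longleftrightarrow> (\<forall>v\<in>carrier V. \<forall>w\<in>carrier V.
             del (mu (tens K V V v w)) =
             sweedler K V H (tensor K V H) (del v) (\<lambda>v0 v1.
               sweedler K V H (tensor K V H) (del w) (\<lambda>w0 w1.
                 tens K V H (mu (tens K V V v0 w0)) (mult_map H (tens K H H v1 w1)))))) \<and>
    ((\<forall>v\<in>carrier V. mu (tens K V V (nu \<one>\<^bsub>K\<^esub>) v) = v \<and> mu (tens K V V v (nu \<one>\<^bsub>K\<^esub>)) = v) \<longrightarrow>
     cYBE K V V V (\<sigma>_VV K V mu nu) (\<sigma>_VV K V mu nu) (\<sigma>_VV K V mu nu)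
       \<longleftrightarrow> (\<forall>u\<in>carrier V. \<forall>v\<in>carrier V. \<forall>w\<in>carrier V.
             mu (tens K V V (mu (tens K V V u v)) w) = mu (tens K V V u (mu (tens K V V v w)))))"
proof -
  interpret bialgebra K H by fact
  obtain c where "canonical_element K H c" using canonical_element_exists[OF assms(2)] .
  then interpret finite_bialgebra K H c
    by unfold_locales
  have V: "module K V" by (rule vectorspace.axioms(1)[OF assms(3)])
  show ?thesis
    by (intro conjI impI cYBE_HVD_iff[OF V assms(6,7)] cYBE_HHV_iff[OF V assms(6)]
        cYBE_VDD_iff[OF V assms(7)] cYBE_HVV_iff[OF assms(3,6,4,5)] cYBE_VVD_iff[OF assms(3,7,4,5)]
        cYBE_VVV_iff[OF V assms(4,5)]) blast+
qed

end
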